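(* Let $\overline M$ be a $7$-dimensional Riemannian manifold with a $G_2$-structure of type $\mathcal X_2$. Let $\iota:M\to\overline M$ be an orientable hypersurface with unit normal vector field $n$, with the induced $SU(3)$-structure determined by $n$ and a smooth function $\theta$ on $M$. Then $$d^*\omega=6I\eta-2d\theta=-2\,\overline r(\varphi)(\iota_*\cdot,n).$$ Moreover, the $SU(3)$-structure on $M$ is of the type given on the left if and only if the condition on the right holds: 1. $\mathcal W_1^++\mathcal W_1^-+\mathcal W_2^++\mathcal W_2^-+\mathcal W_3+\mathcal W_4$: $d\theta=\overline r(\varphi)(\iota_*\cdot,n)$. 2. $\mathcal W_1^++\mathcal W_1^-+\mathcal W_2^++\mathcal W_2^-+\mathcal W_3+\mathcal W_5$: $\overline r(\varphi)(\iota_*\cdot,n)=0$. 3. $\mathcal W_1^++\mathcal W_1^-+\mathcal W_2^++\mathcal W_2^-+\mathcal W_4+\mathcal W_5$: $IB=B$. 4. $\mathcal W_1^++\mathcal W_1^-+\mathcal W_2^++\mathcal W_3+\mathcal W_4+\mathcal W_5$: $\sin\theta\left((I_{(1)}-I_{(2)})\iota^*\overline r(\varphi)+(1+I)B\right)=2h\sin\theta\,\langle\cdot,\cdot\rangle$. 5. $\mathcal W_1^++\mathcal W_1^-+\mathcal W_2^-+\mathcal W_3+\mathcal W_4+\mathcal W_5$: $\cos\theta\left((I_{(1)}-I_{(2)})\iota^*\overline r(\varphi)+(1+I)B\right)=2h\cos\theta\,\langle\cdot,\cdot\rangle$. 6. $\mathcal W_1^++\mathcal W_2^++\mathcal W_2^-+\mathcal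 W_3+\mathcal W_4+\mathcal W_5$: $h\sin\theta=0$. 7. $\mathcal W_1^-+\mathcal W_2^++\mathcal W_2^-+\mathcal W_3+\mathcal W_4+\mathcal W_5$: $h\cos\theta=0$. 8. $\mathcal W_1^++\mathcal W_1^-+\mathcal W_2^++\mathcal W_2^-+\mathcal W_3$: $\overline r(\varphi)(\iota_*\cdot,n)=0$ and $\theta$ is constant (i.e. $d\theta=0$). 9. $\mathcal W_1^++\mathcal W_1^-+\mathcal W_3+\mathcal W_4+\mathcal W_5$: $(I_{(1)}-I_{(2)})\iota^*\overline r(\varphi)+(1+I)B=2h\langle\cdot,\cdot\rangle$. 10. $\mathcal W_2^++\mathcal W_2^-+\mathcal W_3+\mathcal W_4+\mathcal W_5$: $M$ is a minimal variety.
   Context: $G_2$-structures: a $G_2$-structure on a Riemannian $7$-manifold $(\overline M,\langle\cdot,\cdot\rangle)$ is given by a global three-form $\varphi$ such that locally there is an orthonormal frame $\{e_0,\dots,e_6\}$ (a Cayley frame, indices in $\mathbb Z_7$) with $\varphi=\sum_ie_i\wedge e_{i+1}\wedge e_{i+3}$ (vectors are identified with one-forms via the metric). $\langle P(x,y),z\rangle=\varphi(x,y,z)$, and $*\varphi=-\sum_{i}e_{i+2}\wedge e_{i+4}\wedge e_{i+5}\wedge e_{i+6}$ (Hodge dual for the orientation $e_0\wedge\dots\wedge e_6$). $\overline\nabla$ is the Levi-Civita connection and $\overline r(\varphi)(x,y)=\frac14\langle\overline\nabla_x\varphi,y\lrcorner*\varphi\rangle$, where $\langle a,b\rangle=\frac1{p!}\sum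 a(e_{i_1},\dots)b(e_{i_1},\dots)$ for $p$-forms. Type $\mathcal X_2$ (almost parallel): $\overline r(\varphi)\in\mathfrak g_2$, i.e. $b=\overline r(\varphi)$ is skew-symmetric and $\sum_{j,k}\varphi(e_i,e_j,e_k)b(e_j,e_k)=0$ for all $i$. Induced structure on $M$: the induced metric, $Ix=P(n,x)$, and $\Psi=\psi_++i\psi_-$ with $\psi_+=\cos\theta\,\iota^*\varphi-\sin\theta\,\iota^*(n\lrcorner*\varphi)$, $\psi_-=\sin\theta\,\iota^*\varphi+\cos\theta\,\iota^*(n\lrcorner*\varphi)$. $B(x,y)=\langle II(x,y),n\rangle=\langle\overline\nabla_xy,n\rangle$ is the second fundamental form, $h=\frac16\mathrm{Tr}\,B$ (so $h=\langle H,n\rangle$, $H$ the mean curvature); minimal variety means $h=0$. For a bilinear form $b$ on $M$, $(I_{(1)}b)(x,y)=-b(Ix,y)$, $(I_{(2)}b)(x,y)=-b(x,Iy)$, $(Ib)(x,y)=b(Ix,Iy)$; for a one-form $\mu$, $(I\mu)(x)=-\mu(Ix)$. Types of $SU(3)$-structure: $\nabla$ is the Levi-Civita connection of $M$, $\omega(x,y)=\langle x,Iy\rangle$, $d^*\omega=-\sum_ie_i\lrcorner\nabla_{e_i}\omega$. $\nabla\omega$ lies in $\{\alpha\mid\alpha(x,y,z)=-\alpha(x,z,y)=-\alpha(x,Iy,Iz)\}=\mathcal W_1\oplus\mathcal W_2\oplus\mathcal W_3\oplus\mathcal W_4$ (Gray–Hervella), where $\mathcal W_1$: $\alpha$ totally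 skew; $\mathcal W_2$: cyclic sum of $\alpha(x,y,z)$ is zero; $\mathcal W_3$: $\alpha(Ix,Iy,z)=\alpha(x,y,z)$ and $\sum_i\alpha(e_i,e_i,z)=0$; $\mathcal W_4$: $\alpha(x,y,z)=\langle x,y\rangle\tau(z)-\langle x,z\rangle\tau(y)-\langle x,Iy\rangle\tau(Iz)+\langle x,Iz\rangle\tau(Iy)$ for some one-form $\tau$. With $r(\alpha)(x,y)=\frac12\langle x\lrcorner\alpha,y\lrcorner\psi_+\rangle$, for $i=1,2$ one has $\mathcal W_i=\mathcal W_i^+\oplus\mathcal W_i^-$, where $\mathcal W_i^+$ (resp. $\mathcal W_i^-$) is the set of $\alpha\in\mathcal W_i$ with $r(\alpha)$ symmetric (resp. skew-symmetric). The $\mathcal W_5$-part of the torsion is the one-form $\eta$ determined by requiring that the metric connection $\nabla+\eta+\xi$, with $\eta_XY=(I\eta)(X)IY$ and $\xi_XY=-\frac12I(\nabla_XI)Y$, makes $\omega,\psi_+,\psi_-$ parallel; equivalently $(I\eta)(X)=-\frac1{12}\langle\nabla_X\psi_+,\psi_-\rangle$. $M$ is of type $\mathcal U$, a sum of some of $\mathcal W_1^\pm,\mathcal W_2^\pm,\mathcal W_3,\mathcal W_4,\mathcal W_5$, if the components of $\nabla\omega$ in the $\mathcal W$'s not occurring in $\mathcal U$ vanish everywhere and, when $\mathcal W_5$ does not occur, $\eta=0$. *)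

theory Defs
  imports "HOL-Analysis.Analysis"
begin

section \<open>Smooth manifolds\<close>

text \<open>Differentiability classes of maps on an open set \<open>S\<close>.\<close>

primrec Ck_on :: "nat \<Rightarrow> 'a::real_normed_vector set \<Rightarrow> ('a \<Rightarrow> 'b::real_normed_vector) \<Rightarrow> bool" where
  "Ck_on 0 S f \<longleftrightarrow> continuous_on S f"
| "Ck_on (Suc k) S f \<longleftrightarrow>
     (\<forall>x\<in>S. f differentiable (at x)) \<and> (\<forall>v. Ck_on k S (\<lambda>x. frechet_derivative f (at x) v))"

definition smooth_on :: "'a::real_normed_vector set \<Rightarrow> ('a \<Rightarrow> 'b::real_normed_vector) \<Rightarrow> bool" where
  "smooth_on S f \<longleftrightarrow> (\<forall>k. Ck_on k S f)"

text \<open>A chart is a pair of its domain and its coordinate map; values of the coordinate map outside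
  of the domain are irrelevant.\<close>

type_synonym ('m, 'n) chart = "'m set \<times> ('m \<Rightarrow> real ^ 'n)"

definition cinv :: "('m, 'n::finite) chart \<Rightarrow> real ^ 'n \<Rightarrow> 'm" where
  "cinv c = inv_into (fst c) (snd c)"

text \<open>\<open>cderiv c f p u\<close> is the derivative of \<open>f\<close> at the point \<open>p\<close> in the direction of the tangent
  vector with components \<open>u\<close> in the chart \<open>c\<close>.\<close>

definition cderiv :: "('m, 'n::finite) chart \<Rightarrow> ('m \<Rightarrow> 'b::real_normed_vector) \<Rightarrow> 'm \<Rightarrow> real ^ 'n \<Rightarrow> 'b" where
  "cderiv c f p u = frechet_derivative (f \<circ> cinv c) (at (snd c p)) u"

definition smooth_manifold :: "'m topology \<Rightarrow> ('m, 'n::finite) chart set \<Rightarrow> bool" where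
  "smooth_manifold M A \<longleftrightarrow>
     Hausdorff_space M \<and> second_countable M \<and> (\<Union>c\<in>A. fst c) = topspace M \<and>
     (\<forall>c\<in>A. openin M (fst c) \<and> open (snd c ` fst c) \<and>
        homeomorphic_map (subtopology M (fst c)) (top_of_set (snd c ` fst c)) (snd c)) \<and>
     (\<forall>c\<in>A. \<forall>d\<in>A. smooth_on (snd c ` (fst c \<inter> fst d)) (snd d \<circ> cinv c))"

definition everywhere :: "('m, 'n::finite) chart set \<Rightarrow> (('m, 'n) chart \<Rightarrow> 'm \<Rightarrow> bool) \<Rightarrow> bool" where
  "everywhere A P \<longleftrightarrow> (\<forall>c\<in>A. \<forall>p\<in>fst c. P c p)"

definition chart_at :: "('m, 'n::finite) chart set \<Rightarrow> 'm \<Rightarrow> ('m, 'n) chart" where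
  "chart_at A p = (SOME c. c \<in> A \<and> p \<in> fst c)"

text \<open>Tensors are given by their components: \<open>T c p\<close> is the multilinear form (or endomorphism) on
  \<open>real ^ 'n\<close> representing the tensor at \<open>p\<close> in the chart \<open>c\<close>, where \<open>p\<close> lies in the domain
  of \<open>c\<close>.  The components in two charts are related by the tangent map \<open>cderiv c (snd d) p\<close> of the
  change of charts.\<close>

type_synonym ('m, 'n) endo_field = "('m, 'n) chart \<Rightarrow> 'm \<Rightarrow> real ^ 'n \<Rightarrow> real ^ 'n"
type_synonym ('m, 'n) tensor1 = "('m, 'n) chart \<Rightarrow> 'm \<Rightarrow> real ^ 'n \<Rightarrow> real"
type_synonym ('m, 'n) tensor2 = "('m, 'n) chart \<Rightarrow> 'm \<Rightarrow> real ^ 'n \<Rightarrow> real ^ 'n \<Rightarrow> real"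
type_synonym ('m, 'n) tensor3 =
  "('m, 'n) chart \<Rightarrow> 'm \<Rightarrow> real ^ 'n \<Rightarrow> real ^ 'n \<Rightarrow> real ^ 'n \<Rightarrow> real"

definition smooth_function :: "('m, 'n::finite) chart set \<Rightarrow> ('m \<Rightarrow> real) \<Rightarrow> bool" where
  "smooth_function A f \<longleftrightarrow> (\<forall>c\<in>A. smooth_on (snd c ` fst c) (f \<circ> cinv c))"

definition trilinear :: "(real ^ 'n \<Rightarrow> real ^ 'n \<Rightarrow> real ^ 'n \<Rightarrow> real) \<Rightarrow> bool" where
  "trilinear T \<longleftrightarrow> (\<forall>y z. linear (\<lambda>x. T x y z)) \<and> (\<forall>x z. linear (\<lambda>y. T x y z)) \<and>
     (\<forall>x y. linear (\<lambda>z. T x y z))"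

definition smooth_tensor2 :: "('m, 'n::finite) chart set \<Rightarrow> ('m, 'n) tensor2 \<Rightarrow> bool" where
  "smooth_tensor2 A T \<longleftrightarrow>
     everywhere A (\<lambda>c p. bilinear (T c p)) \<and>
     (\<forall>c\<in>A. \<forall>d\<in>A. \<forall>p\<in>fst c \<inter> fst d. \<forall>u v.
        T c p u v = T d p (cderiv c (snd d) p u) (cderiv c (snd d) p v)) \<and>
     (\<forall>c\<in>A. \<forall>u v. smooth_on (snd c ` fst c) (\<lambda>x. T c (cinv c x) u v))"

definition smooth_tensor3 :: "('m, 'n::finite) chart set \<Rightarrow> ('m, 'n) tensor3 \<Rightarrow> bool" where
  "smooth_tensor3 A T \<longleftrightarrow>
     everywhere A (\<lambda>c p. trilinear (T c p)) \<and>
     (\<forall>c\<in>A. \<forall>d\<in>A. \<forall>p\<in>fst c \<inter> fst d. \<forall>u v w.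
        T c p u v w = T d p (cderiv c (snd d) p u) (cderiv c (snd d) p v) (cderiv c (snd d) p w)) \<and>
     (\<forall>c\<in>A. \<forall>u v w. smooth_on (snd c ` fst c) (\<lambda>x. T c (cinv c x) u v w))"

section \<open>Riemannian geometry\<close>

definition riemannian_manifold :: "'m topology \<Rightarrow> ('m, 'n::finite) chart set \<Rightarrow> ('m, 'n) tensor2 \<Rightarrow> bool" where
  "riemannian_manifold M A g \<longleftrightarrow> smooth_manifold M A \<and> smooth_tensor2 A g \<and>
     everywhere A (\<lambda>c p. (\<forall>u v. g c p u v = g c p v u) \<and> (\<forall>u. u \<noteq> 0 \<longrightarrow> g c p u u > 0))"

text \<open>Connection coefficients in the chart \<open>c\<close> of the Levi-Civita connection, the unique
  torsion-free connection for which the metric is parallel: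
  \<open>\<nabla>\<^sub>u Y = cderiv c Y p u + levi_civita g c p u (Y p)\<close>.\<close>

definition levi_civita :: "('m, 'n::finite) tensor2 \<Rightarrow> ('m, 'n) chart \<Rightarrow> 'm \<Rightarrow>
    real ^ 'n \<Rightarrow> real ^ 'n \<Rightarrow> real ^ 'n" where
  "levi_civita g c p = (THE \<Gamma>. bilinear \<Gamma> \<and> (\<forall>u v. \<Gamma> u v = \<Gamma> v u) \<and>
     (\<forall>u v w. cderiv c (\<lambda>q. g c q v w) p u = g c p (\<Gamma> u v) w + g c p v (\<Gamma> u w)))"

text \<open>Covariant derivatives \<open>(\<nabla>\<^sub>u T)(x, \<dots>)\<close> at \<open>p\<close> for a connection with coefficients \<open>\<Gamma>\<close> at \<open>p\<close>.\<close>

definition cov_endo :: "(real ^ 'n \<Rightarrow> real ^ 'n \<Rightarrow> real ^ 'n) \<Rightarrow> ('m, 'n::finite) endo_field \<Rightarrow>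
    ('m, 'n) chart \<Rightarrow> 'm \<Rightarrow> real ^ 'n \<Rightarrow> real ^ 'n \<Rightarrow> real ^ 'n" where
  "cov_endo \<Gamma> J c p u x = cderiv c (\<lambda>q. J c q x) p u + \<Gamma> u (J c p x) - J c p (\<Gamma> u x)"

definition cov2 :: "(real ^ 'n \<Rightarrow> real ^ 'n \<Rightarrow> real ^ 'n) \<Rightarrow> ('m, 'n::finite) tensor2 \<Rightarrow>
    ('m, 'n) chart \<Rightarrow> 'm \<Rightarrow> real ^ 'n \<Rightarrow> real ^ 'n \<Rightarrow> real ^ 'n \<Rightarrow> real" where
  "cov2 \<Gamma> T c p u x y = cderiv c (\<lambda>q. T c q x y) p u - T c p (\<Gamma> u x) y - T c p x (\<Gamma> u y)"

definition cov3 :: "(real ^ 'n \<Rightarrow> real ^ 'n \<Rightarrow> real ^ 'n) \<Rightarrow> ('m, 'n::finite) tensor3 \<Rightarrow>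
    ('m, 'n) chart \<Rightarrow> 'm \<Rightarrow> real ^ 'n \<Rightarrow> real ^ 'n \<Rightarrow> real ^ 'n \<Rightarrow> real ^ 'n \<Rightarrow> real" where
  "cov3 \<Gamma> T c p u x y z = cderiv c (\<lambda>q. T c q x y z) p u
     - T c p (\<Gamma> u x) y z - T c p x (\<Gamma> u y) z - T c p x y (\<Gamma> u z)"

text \<open>Pointwise algebra for an inner product \<open>G\<close>.  Traces and inner products of forms do not depend
  on the orthonormal frame that is used.\<close>

definition orthonormal_frame :: "(real ^ 'n \<Rightarrow> real ^ 'n \<Rightarrow> real) \<Rightarrow> ('n::finite \<Rightarrow> real ^ 'n) \<Rightarrow> bool" where
  "orthonormal_frame G e \<longleftrightarrow> (\<forall>i j. G (e i) (e j) = (if i = j then 1 else 0))"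

definition some_frame :: "(real ^ 'n \<Rightarrow> real ^ 'n \<Rightarrow> real) \<Rightarrow> 'n::finite \<Rightarrow> real ^ 'n" where
  "some_frame G = (SOME e. orthonormal_frame G e)"

definition tr :: "(real ^ 'n \<Rightarrow> real ^ 'n \<Rightarrow> real) \<Rightarrow> (real ^ 'n \<Rightarrow> real ^ 'n \<Rightarrow> real) \<Rightarrow> real" where
  "tr G b = (\<Sum>i\<in>UNIV. b (some_frame G i) (some_frame G i))"

definition inner_form2 :: "(real ^ 'n \<Rightarrow> real ^ 'n \<Rightarrow> real) \<Rightarrow>
    (real ^ 'n \<Rightarrow> real ^ 'n \<Rightarrow> real) \<Rightarrow> (real ^ 'n \<Rightarrow> real ^ 'n \<Rightarrow> real) \<Rightarrow> real" where
  "inner_form2 G a b = (let e = some_frame G in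
     1 / 2 * (\<Sum>i\<in>UNIV. \<Sum>j\<in>UNIV. a (e i) (e j) * b (e i) (e j)))"

definition inner_form3 :: "(real ^ 'n \<Rightarrow> real ^ 'n \<Rightarrow> real) \<Rightarrow>
    (real ^ 'n \<Rightarrow> real ^ 'n \<Rightarrow> real ^ 'n \<Rightarrow> real) \<Rightarrow> (real ^ 'n \<Rightarrow> real ^ 'n \<Rightarrow> real ^ 'n \<Rightarrow> real) \<Rightarrow> real" where
  "inner_form3 G a b = (let e = some_frame G in
     1 / 6 * (\<Sum>i\<in>UNIV. \<Sum>j\<in>UNIV. \<Sum>k\<in>UNIV. a (e i) (e j) (e k) * b (e i) (e j) (e k)))"

definition wedge3 :: "('v \<Rightarrow> real) \<Rightarrow> ('v \<Rightarrow> real) \<Rightarrow> ('v \<Rightarrow> real) \<Rightarrow> 'v \<Rightarrow> 'v \<Rightarrow> 'v \<Rightarrow> real" where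
  "wedge3 a b c x y z = det (vector [vector [a x, a y, a z], vector [b x, b y, b z],
     vector [c x, c y, c z]] :: real ^ 3 ^ 3)"

definition wedge4 :: "('v \<Rightarrow> real) \<Rightarrow> ('v \<Rightarrow> real) \<Rightarrow> ('v \<Rightarrow> real) \<Rightarrow> ('v \<Rightarrow> real) \<Rightarrow>
    'v \<Rightarrow> 'v \<Rightarrow> 'v \<Rightarrow> 'v \<Rightarrow> real" where
  "wedge4 a b c d x y z w = det (vector [vector [a x, a y, a z, a w], vector [b x, b y, b z, b w],
     vector [c x, c y, c z, c w], vector [d x, d y, d z, d w]] :: real ^ 4 ^ 4)"

section \<open>G2-structures\<close>

text \<open>The numeral type \<open>7\<close> is the ring of integers modulo 7, so index arithmetic is cyclic;
  \<open>G (e i)\<close> is the one-form dual to \<open>e i\<close>.\<close>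

definition cayley_frame :: "(real ^ 7 \<Rightarrow> real ^ 7 \<Rightarrow> real) \<Rightarrow>
    (real ^ 7 \<Rightarrow> real ^ 7 \<Rightarrow> real ^ 7 \<Rightarrow> real) \<Rightarrow> (7 \<Rightarrow> real ^ 7) \<Rightarrow> bool" where
  "cayley_frame G f e \<longleftrightarrow> orthonormal_frame G e \<and>
     (\<forall>x y z. f x y z = (\<Sum>i\<in>UNIV. wedge3 (G (e i)) (G (e (i + 1))) (G (e (i + 3))) x y z))"

text \<open>The four-form \<open>*\<phi>\<close>: the Hodge dual for the orientation given by a Cayley frame.  It does
  not depend on the Cayley frame.\<close>

definition star_form :: "(real ^ 7 \<Rightarrow> real ^ 7 \<Rightarrow> real) \<Rightarrow>
    (real ^ 7 \<Rightarrow> real ^ 7 \<Rightarrow> real ^ 7 \<Rightarrow> real) \<Rightarrow>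
    real ^ 7 \<Rightarrow> real ^ 7 \<Rightarrow> real ^ 7 \<Rightarrow> real ^ 7 \<Rightarrow> real" where
  "star_form G f x y z w = (let e = (SOME e. cayley_frame G f e) in
     - (\<Sum>i\<in>UNIV. wedge4 (G (e (i + 2))) (G (e (i + 4))) (G (e (i + 5))) (G (e (i + 6))) x y z w))"

definition cross :: "(real ^ 7 \<Rightarrow> real ^ 7 \<Rightarrow> real) \<Rightarrow>
    (real ^ 7 \<Rightarrow> real ^ 7 \<Rightarrow> real ^ 7 \<Rightarrow> real) \<Rightarrow> real ^ 7 \<Rightarrow> real ^ 7 \<Rightarrow> real ^ 7" where
  "cross G f x y = (THE v. \<forall>z. G v z = f x y z)"

definition g2_structure :: "'m topology \<Rightarrow> ('m, 7) chart set \<Rightarrow> ('m, 7) tensor2 \<Rightarrow> ('m, 7) tensor3 \<Rightarrow> bool" where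
  "g2_structure M A g \<phi> \<longleftrightarrow> smooth_tensor3 A \<phi> \<and>
     (\<forall>p\<in>topspace M. \<exists>c\<in>A. \<exists>V E. p \<in> V \<and> V \<subseteq> fst c \<and> openin M V \<and>
        (\<forall>i. smooth_on (snd c ` V) (\<lambda>x. E (cinv c x) i)) \<and>
        (\<forall>q\<in>V. cayley_frame (g c q) (\<phi> c q) (E q)))"

definition rbar :: "('m, 7) tensor2 \<Rightarrow> ('m, 7) tensor3 \<Rightarrow> ('m, 7) tensor2" where
  "rbar g \<phi> c p x y = 1 / 4 * inner_form3 (g c p)
     (cov3 (levi_civita g c p) \<phi> c p x) (star_form (g c p) (\<phi> c p) y)"

definition g2_type_X2 :: "('m, 7) chart set \<Rightarrow> ('m, 7) tensor2 \<Rightarrow> ('m, 7) tensor3 \<Rightarrow> bool" where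
  "g2_type_X2 A g \<phi> \<longleftrightarrow> everywhere A (\<lambda>c p.
     (\<forall>x y. rbar g \<phi> c p x y = - rbar g \<phi> c p y x) \<and>
     (\<forall>e. orthonormal_frame (g c p) e \<longrightarrow>
        (\<forall>i. (\<Sum>j\<in>UNIV. \<Sum>k\<in>UNIV. \<phi> c p (e i) (e j) (e k) * rbar g \<phi> c p (e j) (e k)) = 0)))"

section \<open>Hypersurfaces\<close>

text \<open>\<open>A\<close> is the atlas of \<open>M\<close> and \<open>Ab\<close> the one of the ambient manifold \<open>Mb\<close>.\<close>

definition push :: "('b \<Rightarrow> real ^ 7) \<Rightarrow> ('a \<Rightarrow> 'b) \<Rightarrow> ('a, 6) chart \<Rightarrow> 'a \<Rightarrow> real ^ 6 \<Rightarrow> real ^ 7" where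
  "push c \<iota> a p u = cderiv a (c \<circ> \<iota>) p u"

definition hypersurface :: "'b topology \<Rightarrow> ('b, 7) chart set \<Rightarrow> 'a topology \<Rightarrow> ('a, 6) chart set \<Rightarrow>
    ('a \<Rightarrow> 'b) \<Rightarrow> bool" where
  "hypersurface Mb Ab M A \<iota> \<longleftrightarrow> smooth_manifold M A \<and> continuous_map M Mb \<iota> \<and>
     (\<forall>a\<in>A. \<forall>c\<in>Ab. smooth_on (snd a ` (fst a \<inter> \<iota> -` fst c)) (snd c \<circ> \<iota> \<circ> cinv a) \<and>
        (\<forall>p\<in>fst a \<inter> \<iota> -` fst c. inj (push (snd c) \<iota> a p)))"

text \<open>A vector field along \<open>\<iota>\<close> is given by its components \<open>n c p\<close> for the charts \<open>c\<close> of the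
  ambient manifold around \<open>\<iota> p\<close>.\<close>

definition unit_normal :: "('b, 7) chart set \<Rightarrow> ('b, 7) tensor2 \<Rightarrow> ('a, 6) chart set \<Rightarrow>
    ('a \<Rightarrow> 'b) \<Rightarrow> (('b, 7) chart \<Rightarrow> 'a \<Rightarrow> real ^ 7) \<Rightarrow> bool" where
  "unit_normal Ab g A \<iota> n \<longleftrightarrow>
     (\<forall>a\<in>A. \<forall>c\<in>Ab.
        smooth_on (snd a ` (fst a \<inter> \<iota> -` fst c)) (n c \<circ> cinv a) \<and>
        (\<forall>p\<in>fst a \<inter> \<iota> -` fst c.
           (\<forall>d\<in>Ab. \<iota> p \<in> fst d \<longrightarrow> n d p = cderiv c (snd d) (\<iota> p) (n c p)) \<and>
           g c (\<iota> p) (n c p) (n c p) = 1 \<and>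
           (\<forall>u. g c (\<iota> p) (push (snd c) \<iota> a p u) (n c p) = 0)))"

text \<open>Tensors on \<open>M\<close> obtained from ambient ones are computed in the ambient chart
  \<open>chart_at Ab (\<iota> p)\<close>; any other chart around \<open>\<iota> p\<close> gives the same result.\<close>

definition pull2 :: "('b, 7) chart set \<Rightarrow> ('a \<Rightarrow> 'b) \<Rightarrow> ('b, 7) tensor2 \<Rightarrow> ('a, 6) tensor2" where
  "pull2 Ab \<iota> T a p u v = (let c = chart_at Ab (\<iota> p); i = push (snd c) \<iota> a p in
     T c (\<iota> p) (i u) (i v))"

definition pull3 :: "('b, 7) chart set \<Rightarrow> ('a \<Rightarrow> 'b) \<Rightarrow> ('b, 7) tensor3 \<Rightarrow> ('a, 6) tensor3" where
  "pull3 Ab \<iota> T a p u v w = (let c = chart_at Ab (\<iota> p); i = push (snd c) \<iota> a p in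
     T c (\<iota> p) (i u) (i v) (i w))"

text \<open>The one-form \<open>x \<mapsto> T(\<iota>\<^sub>* x, n)\<close>.\<close>

definition normal_part :: "('b, 7) chart set \<Rightarrow> ('a \<Rightarrow> 'b) \<Rightarrow> (('b, 7) chart \<Rightarrow> 'a \<Rightarrow> real ^ 7) \<Rightarrow>
    ('b, 7) tensor2 \<Rightarrow> ('a, 6) tensor1" where
  "normal_part Ab \<iota> n T a p u = (let c = chart_at Ab (\<iota> p) in
     T c (\<iota> p) (push (snd c) \<iota> a p u) (n c p))"

text \<open>\<open>\<iota>\<^sup>*(n \<lrcorner> *\<phi>)\<close>\<close>

definition pull_n_star :: "('b, 7) chart set \<Rightarrow> ('b, 7) tensor2 \<Rightarrow> ('b, 7) tensor3 \<Rightarrow> ('a \<Rightarrow> 'b) \<Rightarrow>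
    (('b, 7) chart \<Rightarrow> 'a \<Rightarrow> real ^ 7) \<Rightarrow> ('a, 6) tensor3" where
  "pull_n_star Ab g \<phi> \<iota> n a p u v w = (let c = chart_at Ab (\<iota> p); i = push (snd c) \<iota> a p in
     star_form (g c (\<iota> p)) (\<phi> c (\<iota> p)) (n c p) (i u) (i v) (i w))"

definition induced_I :: "('b, 7) chart set \<Rightarrow> ('b, 7) tensor2 \<Rightarrow> ('b, 7) tensor3 \<Rightarrow> ('a \<Rightarrow> 'b) \<Rightarrow>
    (('b, 7) chart \<Rightarrow> 'a \<Rightarrow> real ^ 7) \<Rightarrow> ('a, 6) endo_field" where
  "induced_I Ab g \<phi> \<iota> n a p u = (let c = chart_at Ab (\<iota> p); i = push (snd c) \<iota> a p in
     (THE v. i v = cross (g c (\<iota> p)) (\<phi> c (\<iota> p)) (n c p) (i u)))"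

definition induced_psi_plus :: "('b, 7) chart set \<Rightarrow> ('b, 7) tensor2 \<Rightarrow> ('b, 7) tensor3 \<Rightarrow> ('a \<Rightarrow> 'b) \<Rightarrow>
    (('b, 7) chart \<Rightarrow> 'a \<Rightarrow> real ^ 7) \<Rightarrow> ('a \<Rightarrow> real) \<Rightarrow> ('a, 6) tensor3" where
  "induced_psi_plus Ab g \<phi> \<iota> n \<theta> a p u v w =
     cos (\<theta> p) * pull3 Ab \<iota> \<phi> a p u v w - sin (\<theta> p) * pull_n_star Ab g \<phi> \<iota> n a p u v w"

definition induced_psi_minus :: "('b, 7) chart set \<Rightarrow> ('b, 7) tensor2 \<Rightarrow> ('b, 7) tensor3 \<Rightarrow> ('a \<Rightarrow> 'b) \<Rightarrow>
    (('b, 7) chart \<Rightarrow> 'a \<Rightarrow> real ^ 7) \<Rightarrow> ('a \<Rightarrow> real) \<Rightarrow> ('a, 6) tensor3" where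
  "induced_psi_minus Ab g \<phi> \<iota> n \<theta> a p u v w =
     sin (\<theta> p) * pull3 Ab \<iota> \<phi> a p u v w + cos (\<theta> p) * pull_n_star Ab g \<phi> \<iota> n a p u v w"

text \<open>\<open>B(u, v) = \<langle>\<nabla>\<^sub>u v, n\<rangle>\<close> with the ambient Levi-Civita connection, where \<open>v\<close> is extended to the
  vector field along \<open>\<iota>\<close> that is the image of the field with constant components in the chart \<open>a\<close>.\<close>

definition second_form :: "('b, 7) chart set \<Rightarrow> ('b, 7) tensor2 \<Rightarrow> ('a \<Rightarrow> 'b) \<Rightarrow>
    (('b, 7) chart \<Rightarrow> 'a \<Rightarrow> real ^ 7) \<Rightarrow> ('a, 6) tensor2" where
  "second_form Ab g \<iota> n a p u v = (let c = chart_at Ab (\<iota> p); i = push (snd c) \<iota> a in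
     g c (\<iota> p) (cderiv a (\<lambda>q. i q v) p u + levi_civita g c (\<iota> p) (i p u) (i p v)) (n c p))"

section \<open>SU(3)-structures\<close>

definition act_form :: "('v \<Rightarrow> 'v) \<Rightarrow> ('v \<Rightarrow> real) \<Rightarrow> 'v \<Rightarrow> real" where
  "act_form J \<mu> x = - \<mu> (J x)"

definition act1 :: "('v \<Rightarrow> 'v) \<Rightarrow> ('v \<Rightarrow> 'v \<Rightarrow> real) \<Rightarrow> 'v \<Rightarrow> 'v \<Rightarrow> real" where
  "act1 J b x y = - b (J x) y"

definition act2 :: "('v \<Rightarrow> 'v) \<Rightarrow> ('v \<Rightarrow> 'v \<Rightarrow> real) \<Rightarrow> 'v \<Rightarrow> 'v \<Rightarrow> real" where
  "act2 J b x y = - b x (J y)"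

definition act :: "('v \<Rightarrow> 'v) \<Rightarrow> ('v \<Rightarrow> 'v \<Rightarrow> real) \<Rightarrow> 'v \<Rightarrow> 'v \<Rightarrow> real" where
  "act J b x y = b (J x) (J y)"

definition kaehler_form :: "('m, 'n::finite) tensor2 \<Rightarrow> ('m, 'n) endo_field \<Rightarrow> ('m, 'n) tensor2" where
  "kaehler_form G J a p x y = G a p x (J a p y)"

definition nabla_omega :: "('m, 'n::finite) tensor2 \<Rightarrow> ('m, 'n) endo_field \<Rightarrow> ('m, 'n) tensor3" where
  "nabla_omega G J a p = cov2 (levi_civita G a p) (kaehler_form G J) a p"

definition dstar_omega :: "('m, 'n::finite) tensor2 \<Rightarrow> ('m, 'n) endo_field \<Rightarrow> ('m, 'n) tensor1" where
  "dstar_omega G J a p z = - tr (G a p) (\<lambda>x y. nabla_omega G J a p x y z)"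

text \<open>\<open>\<nabla> + \<eta> + \<xi>\<close>, where \<open>\<eta>\<^sub>X Y = (I\<eta>)(X) IY\<close> and \<open>\<xi>\<^sub>X Y = -1/2 I(\<nabla>\<^sub>X I)Y\<close>.\<close>

definition su3_connection :: "('m, 6) tensor2 \<Rightarrow> ('m, 6) endo_field \<Rightarrow> (real ^ 6 \<Rightarrow> real) \<Rightarrow>
    ('m, 6) chart \<Rightarrow> 'm \<Rightarrow> real ^ 6 \<Rightarrow> real ^ 6 \<Rightarrow> real ^ 6" where
  "su3_connection G J \<mu> a p X Y = levi_civita G a p X Y + act_form (J a p) \<mu> X *\<^sub>R J a p Y
     - (1 / 2) *\<^sub>R J a p (cov_endo (levi_civita G a p) J a p X Y)"

definition su3_eta :: "('m, 6) tensor2 \<Rightarrow> ('m, 6) endo_field \<Rightarrow> ('m, 6) tensor3 \<Rightarrow> ('m, 6) tensor3 \<Rightarrow>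
    ('m, 6) tensor1" where
  "su3_eta G J \<psi>p \<psi>m a p = (THE \<mu>. linear \<mu> \<and>
     (let \<Gamma> = su3_connection G J \<mu> a p in
       (\<forall>u x y. cov2 \<Gamma> (kaehler_form G J) a p u x y = 0) \<and>
       (\<forall>u x y z. cov3 \<Gamma> \<psi>p a p u x y z = 0) \<and>
       (\<forall>u x y z. cov3 \<Gamma> \<psi>m a p u x y z = 0)))"

datatype su3_class = W1p | W1m | W2p | W2m | W3 | W4 | W5

definition gray_hervella :: "(real ^ 6 \<Rightarrow> real ^ 6) \<Rightarrow> (real ^ 6 \<Rightarrow> real ^ 6 \<Rightarrow> real ^ 6 \<Rightarrow> real) set" where
  "gray_hervella J = {\<alpha>. trilinear \<alpha> \<and> (\<forall>x y z. \<alpha> x y z = - \<alpha> x z y \<and> \<alpha> x y z = - \<alpha> x (J y) (J z))}"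

definition class_W1 :: "(real ^ 6 \<Rightarrow> real ^ 6) \<Rightarrow> (real ^ 6 \<Rightarrow> real ^ 6 \<Rightarrow> real ^ 6 \<Rightarrow> real) set" where
  "class_W1 J = {\<alpha> \<in> gray_hervella J. \<forall>x y z. \<alpha> x y z = - \<alpha> y x z}"

definition class_W2 :: "(real ^ 6 \<Rightarrow> real ^ 6) \<Rightarrow> (real ^ 6 \<Rightarrow> real ^ 6 \<Rightarrow> real ^ 6 \<Rightarrow> real) set" where
  "class_W2 J = {\<alpha> \<in> gray_hervella J. \<forall>x y z. \<alpha> x y z + \<alpha> y z x + \<alpha> z x y = 0}"

definition class_W3 :: "(real ^ 6 \<Rightarrow> real ^ 6 \<Rightarrow> real) \<Rightarrow> (real ^ 6 \<Rightarrow> real ^ 6) \<Rightarrow>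
    (real ^ 6 \<Rightarrow> real ^ 6 \<Rightarrow> real ^ 6 \<Rightarrow> real) set" where
  "class_W3 G J = {\<alpha> \<in> gray_hervella J.
     (\<forall>x y z. \<alpha> (J x) (J y) z = \<alpha> x y z) \<and> (\<forall>z. tr G (\<lambda>x y. \<alpha> x y z) = 0)}"

definition class_W4 :: "(real ^ 6 \<Rightarrow> real ^ 6 \<Rightarrow> real) \<Rightarrow> (real ^ 6 \<Rightarrow> real ^ 6) \<Rightarrow>
    (real ^ 6 \<Rightarrow> real ^ 6 \<Rightarrow> real ^ 6 \<Rightarrow> real) set" where
  "class_W4 G J = {\<alpha> \<in> gray_hervella J. \<exists>\<tau>. linear \<tau> \<and> (\<forall>x y z. \<alpha> x y z =
     G x y * \<tau> z - G x z * \<tau> y - G x (J y) * \<tau> (J z) + G x (J z) * \<tau> (J y))}"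

definition r_map :: "(real ^ 6 \<Rightarrow> real ^ 6 \<Rightarrow> real) \<Rightarrow> (real ^ 6 \<Rightarrow> real ^ 6 \<Rightarrow> real ^ 6 \<Rightarrow> real) \<Rightarrow>
    (real ^ 6 \<Rightarrow> real ^ 6 \<Rightarrow> real ^ 6 \<Rightarrow> real) \<Rightarrow> real ^ 6 \<Rightarrow> real ^ 6 \<Rightarrow> real" where
  "r_map G \<psi>p \<alpha> x y = 1 / 2 * inner_form2 G (\<alpha> x) (\<psi>p y)"

definition sym_form :: "('v \<Rightarrow> 'v \<Rightarrow> real) \<Rightarrow> bool" where
  "sym_form b \<longleftrightarrow> (\<forall>x y. b x y = b y x)"

definition skew_form :: "('v \<Rightarrow> 'v \<Rightarrow> real) \<Rightarrow> bool" where
  "skew_form b \<longleftrightarrow> (\<forall>x y. b x y = - b y x)"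

text \<open>The class \<open>W5\<close> concerns \<open>\<eta>\<close> only; it contributes nothing to \<open>\<nabla>\<omega>\<close>.\<close>

fun torsion_class :: "(real ^ 6 \<Rightarrow> real ^ 6 \<Rightarrow> real) \<Rightarrow> (real ^ 6 \<Rightarrow> real ^ 6) \<Rightarrow>
    (real ^ 6 \<Rightarrow> real ^ 6 \<Rightarrow> real ^ 6 \<Rightarrow> real) \<Rightarrow> su3_class \<Rightarrow>
    (real ^ 6 \<Rightarrow> real ^ 6 \<Rightarrow> real ^ 6 \<Rightarrow> real) set" where
  "torsion_class G J \<psi>p W1p = {\<alpha> \<in> class_W1 J. sym_form (r_map G \<psi>p \<alpha>)}"
| "torsion_class G J \<psi>p W1m = {\<alpha> \<in> class_W1 J. skew_form (r_map G \<psi>p \<alpha>)}"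
| "torsion_class G J \<psi>p W2p = {\<alpha> \<in> class_W2 J. sym_form (r_map G \<psi>p \<alpha>)}"
| "torsion_class G J \<psi>p W2m = {\<alpha> \<in> class_W2 J. skew_form (r_map G \<psi>p \<alpha>)}"
| "torsion_class G J \<psi>p W3 = class_W3 G J"
| "torsion_class G J \<psi>p W4 = class_W4 G J"
| "torsion_class G J \<psi>p W5 = {\<lambda>x y z. 0}"

text \<open>As the sum of the classes is direct, the components of \<open>\<alpha>\<close> in the classes outside of \<open>U\<close>
  vanish if and only if \<open>\<alpha>\<close> is a sum of elements of the classes in \<open>U\<close>.\<close>

definition in_classes :: "(real ^ 6 \<Rightarrow> real ^ 6 \<Rightarrow> real) \<Rightarrow> (real ^ 6 \<Rightarrow> real ^ 6) \<Rightarrow>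
    (real ^ 6 \<Rightarrow> real ^ 6 \<Rightarrow> real ^ 6 \<Rightarrow> real) \<Rightarrow> su3_class set \<Rightarrow>
    (real ^ 6 \<Rightarrow> real ^ 6 \<Rightarrow> real ^ 6 \<Rightarrow> real) \<Rightarrow> bool" where
  "in_classes G J \<psi>p U \<alpha> \<longleftrightarrow>
     (\<exists>\<beta>. (\<forall>k\<in>U. \<beta> k \<in> torsion_class G J \<psi>p k) \<and> (\<forall>x y z. \<alpha> x y z = (\<Sum>k\<in>U. \<beta> k x y z)))"

definition su3_type :: "('m, 6) chart set \<Rightarrow> ('m, 6) tensor2 \<Rightarrow> ('m, 6) endo_field \<Rightarrow>
    ('m, 6) tensor3 \<Rightarrow> ('m, 6) tensor3 \<Rightarrow> su3_class set \<Rightarrow> bool" where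
  "su3_type A G J \<psi>p \<psi>m U \<longleftrightarrow>
     everywhere A (\<lambda>a p. in_classes (G a p) (J a p) (\<psi>p a p) U (nabla_omega G J a p)) \<and>
     (W5 \<notin> U \<longrightarrow> everywhere A (\<lambda>a p. \<forall>x. su3_eta G J \<psi>p \<psi>m a p x = 0))"

end

theory Submission
  imports Defs
begin

text \<open>Differentiating the identity \<open>P(x, P(x, y)) = \<langle>x, y\<rangle> x - \<langle>x, x\<rangle> y\<close> shows that
  \<open>\<nabla>\<^sub>w\<phi> = *\<phi>(\<rho>, \<sqdot>, \<sqdot>, \<sqdot>)\<close> for the vector \<open>\<rho>\<close> dual to \<open>rbar(w, \<sqdot>)\<close>.  With the Gauss and Weingarten
  formulas this gives \<open>\<nabla>\<omega>(x, y, z) = \<phi>(Ax, y, z)\<close> on the hypersurface, where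
  \<open>\<langle>Ax, y\<rangle> = B(x, y) + rbar(x, Iy)\<close>.  The torsion classes are thereby read off from the \<open>U(3)\<close>-components
  of the endomorphism \<open>A\<close>: its trace, given by \<open>h\<close>, for \<open>W\<^sub>1\<close>; its traceless part commuting with \<open>I\<close> for
  \<open>W\<^sub>2\<close>; the part of \<open>B\<close> anticommuting with \<open>I\<close> for \<open>W\<^sub>3\<close>; and the part of \<open>rbar\<close> anticommuting with
  \<open>I\<close> for \<open>W\<^sub>4\<close>, which the condition \<open>rbar \<in> g\<^sub>2\<close> expresses by \<open>rbar(\<sqdot>, n)\<close>.  The rotation by \<open>\<theta>\<close>
  splits the first two of them into their signed parts.  In the derivatives of \<open>\<psi>\<^sub>+\<close> and \<open>\<psi>\<^sub>-\<close> the only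
  terms not cancelled by \<open>\<xi>\<close> are \<open>d\<theta>\<close> and \<open>rbar(\<sqdot>, n)\<close>, which determines \<open>\<eta>\<close>.\<close>

section \<open>Multilinear algebra\<close>

text \<open>Two features of the definitions have to be overcome. The cross product and
  \<open>I\<close> are definite descriptions, and \<open>star_form\<close> depends on a chosen
  Cayley frame, so smoothness is not visible in any of them. The first two are differentiated as
  solutions of linear systems with differentiable coefficients; the restriction of the contraction
  of n with the four-form is expressed by \<open>Phi\<close> and \<open>I\<close>, so that the
  four-form itself is never differentiated. Moreover, pulled-back tensors use an ambient chart
  chosen separately at each point, and must be rewritten in one fixed chart before a derivative is
  taken. The signed splitting rests on 1 = c (c + i s) + s (s - i c) for c = cos \<theta>, s = sin
  \<theta>: applied to a symmetric endomorphism commuting with \<open>I\<close>, the first summand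
  has symmetric \<open>r_map\<close>, the second a skew one. This is why the cosine goes with the
  plus classes and the sine with the minus classes. The constants in the formula for d*\<omega> come
  from \<open>I\<close> acting in three slots of the complex volume form: parallelism means 3
  I\<eta> = d\<theta> - rbar(., n).\<close>

lemma bilinear_sum_left: "bilinear b \<Longrightarrow> b (\<Sum>i\<in>S. f i) y = (\<Sum>i\<in>S. b (f i) y)"
  unfolding bilinear_def using linear_sum[of "\<lambda>x. b x y" f S] by blast

lemma bilinear_sum_right: "bilinear b \<Longrightarrow> b x (\<Sum>i\<in>S. f i) = (\<Sum>i\<in>S. b x (f i))"
  unfolding bilinear_def using linear_sum[of "b x" f S] by blast

lemmas bilinear_simps = bilinear_ladd bilinear_radd bilinear_lmul bilinear_rmul
  bilinear_lneg bilinear_rneg bilinear_lsub bilinear_rsub bilinear_lzero bilinear_rzero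
  bilinear_sum_left bilinear_sum_right

context
  fixes T :: "real ^ 'n \<Rightarrow> real ^ 'n \<Rightarrow> real ^ 'n \<Rightarrow> real"
  assumes T: "trilinear T"
begin

lemma trilinear_linear:
  "linear (\<lambda>x. T x y z)" "linear (\<lambda>y. T x y z)" "linear (\<lambda>z. T x y z)"
  using T by (auto simp: trilinear_def)

lemmas trilinear_simps =
  trilinear_linear(1)[THEN linear_add] trilinear_linear(2)[THEN linear_add] trilinear_linear(3)[THEN linear_add]
  trilinear_linear(1)[THEN linear_cmul] trilinear_linear(2)[THEN linear_cmul] trilinear_linear(3)[THEN linear_cmul]
  trilinear_linear(1)[THEN linear_neg] trilinear_linear(2)[THEN linear_neg] trilinear_linear(3)[THEN linear_neg]
  trilinear_linear(1)[THEN linear_diff] trilinear_linear(2)[THEN linear_diff] trilinear_linear(3)[THEN linear_diff]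
  trilinear_linear(1)[THEN linear_0] trilinear_linear(2)[THEN linear_0] trilinear_linear(3)[THEN linear_0]
  trilinear_linear(1)[THEN linear_sum] trilinear_linear(2)[THEN linear_sum] trilinear_linear(3)[THEN linear_sum]

end

section \<open>Inner products, orthonormal frames and contractions\<close>

locale inner_form =
  fixes G :: "real ^ 'n \<Rightarrow> real ^ 'n::finite \<Rightarrow> real"
  assumes bil: "bilinear G" and sym: "G u v = G v u" and pos: "u \<noteq> 0 \<Longrightarrow> G u u > 0"
begin

lemmas G_simps = bilinear_simps[OF bil]

lemma nondegenerate: "(\<And>z. G x z = G y z) \<Longrightarrow> x = y"
proof (rule ccontr)
  assume "\<And>z. G x z = G y z" "x \<noteq> y"
  then have "G (x - y) (x - y) = 0" "G (x - y) (x - y) > 0"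
    using pos[of "x - y"] by (simp_all add: G_simps)
  then show False by simp
qed

text \<open>The coordinate map \<open>L\<close> is injective because \<open>G\<close> is definite,
  hence onto by dimension.\<close>

lemma riesz:
  assumes "linear b"
  obtains v where "\<And>z. G v z = b z"
proof -
  define L where "L = (\<lambda>v. \<chi> k. G v (axis k 1))"
  have lin: "linear L"
    by (rule linearI) (auto simp: L_def vec_eq_iff G_simps)
  have expand: "c z = (\<Sum>k\<in>UNIV. z $ k * c (axis k 1))" if "linear c" for c :: "real ^ 'n \<Rightarrow> real" and z
    by (metis (mono_tags, lifting) that basis_expansion linear_sum linear_cmul real_scaleR_def
        scalar_mult_eq_scaleR sum.cong)
  have linG: "linear (G v)" for v
    using bil by (simp add: bilinear_def)
  have "inj L"
    unfolding linear_injective_0[OF lin]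
  proof (intro allI impI)
    fix v assume "L v = 0"
    then have "G v (axis k 1) = 0" for k
      by (simp add: L_def vec_eq_iff)
    then have "G v z = G 0 z" for z
      using expand[OF linG, of v z] by (simp add: G_simps)
    then show "v = 0" by (rule nondegenerate)
  qed
  then have "surj L"
    using lin linear_injective_imp_surjective by blast
  then obtain v where "L v = (\<chi> k. b (axis k 1))" by (metis surjD)
  then have "G v (axis k 1) = b (axis k 1)" for k
    by (simp add: L_def vec_eq_iff)
  then have "G v z = b z" for z
    using expand[OF linG, of v z] expand[OF assms, of z] by simp
  then show ?thesis by (rule that)
qed

text \<open>This evaluates the definite descriptions behind the cross product and the Koszul
  formula.\<close>

lemma the_riesz:
  assumes "linear b"
  shows "G (THE v. \<forall>z. G v z = b z) z = b z"
proof -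
  obtain v where v: "\<And>z. G v z = b z" using riesz[OF assms] by blast
  then have "\<exists>!v. \<forall>z. G v z = b z"
    using nondegenerate by metis
  from theI'[OF this] show ?thesis by blast
qed

lemma frame_orthonormal: "orthonormal_frame G e \<Longrightarrow> G (e i) (e j) = (if i = j then 1 else 0)"
  by (simp add: orthonormal_frame_def)

lemma frame_expansion:
  assumes "orthonormal_frame G e"
  shows "x = (\<Sum>i\<in>UNIV. G x (e i) *\<^sub>R e i)"
proof -
  define m where "m = (\<lambda>y. \<Sum>i\<in>UNIV. (y $ i) *\<^sub>R e i)"
  have lin: "linear m"
    by (rule linearI) (simp_all add: m_def scaleR_add_left sum.distrib scaleR_sum_right)
  have coord: "G (m y) (e i) = y $ i" for y i
    by (simp add: m_def G_simps frame_orthonormal[OF assms] if_distrib cong: if_cong)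
  have "inj m"
    by (metis coord injI vec_eq_iff)
  then obtain y where "x = m y"
    using lin linear_injective_imp_surjective by (metis surjD)
  then show ?thesis
    by (simp add: coord) (simp add: m_def)
qed

lemma frame_inner:
  assumes "orthonormal_frame G e"
  shows "G x y = (\<Sum>i\<in>UNIV. G x (e i) * G y (e i))"
  by (subst frame_expansion[OF assms, of x]) (simp add: G_simps sym)

text \<open>Expanding each \<open>e i\<close> in the frame \<open>f\<close> and summing over
  \<open>i\<close> first produces the transition matrix times its transpose, whose entries are
  \<open>G (f j) (f k)\<close>, hence those of the identity.\<close>

lemma frame_sum_cong:
  assumes e: "orthonormal_frame G e" and f: "orthonormal_frame G f" and b: "bilinear b"
  shows "(\<Sum>i\<in>UNIV. b (e i) (e i)) = (\<Sum>i\<in>UNIV. b (f i) (f i) :: real)"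
proof -
  have "b (e i) (e i) = (\<Sum>j\<in>UNIV. \<Sum>k\<in>UNIV. G (e i) (f j) * G (e i) (f k) * b (f j) (f k))" for i
    by (subst (1 2) frame_expansion[OF f, of "e i"])
      (simp add: bilinear_simps[OF b] sum_distrib_left, subst sum.swap, simp add: mult_ac)
  then have "(\<Sum>i\<in>UNIV. b (e i) (e i)) =
      (\<Sum>i\<in>UNIV. \<Sum>j\<in>UNIV. \<Sum>k\<in>UNIV. G (e i) (f j) * G (e i) (f k) * b (f j) (f k))"
    by simp
  also have "\<dots> = (\<Sum>j\<in>UNIV. \<Sum>k\<in>UNIV. \<Sum>i\<in>UNIV. G (e i) (f j) * G (e i) (f k) * b (f j) (f k))"
    by (subst sum.swap) (intro sum.cong refl sum.swap)
  also have "\<dots> = (\<Sum>j\<in>UNIV. \<Sum>k\<in>UNIV. G (f j) (f k) * b (f j) (f k))"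
    by (simp add: frame_inner[OF e, of "f _" "f _"] sum_distrib_right sym)
  also have "\<dots> = (\<Sum>j\<in>UNIV. b (f j) (f j))"
    by (simp add: frame_orthonormal[OF f] if_distrib[of "\<lambda>x. x * _"] cong: if_cong)
  finally show ?thesis .
qed

text \<open>Existence of an orthonormal frame is an input here; it will be supplied by a Cayley
  frame in the ambient space and by a unitary frame on the hypersurface.\<close>

lemma some_frame:
  assumes "orthonormal_frame G e"
  shows "orthonormal_frame G (some_frame G)"
  unfolding some_frame_def using assms by (rule someI[of "orthonormal_frame G"])

lemma tr_frame:
  assumes "orthonormal_frame G e" "bilinear b"
  shows "tr G b = (\<Sum>i\<in>UNIV. b (e i) (e i))"
  unfolding tr_def by (rule frame_sum_cong[OF some_frame[OF assms(1)] assms])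

text \<open>The frame is exchanged in one slot at a time, the other slots being fixed or already
  summed.\<close>

lemma inner_form2_frame:
  assumes e: "orthonormal_frame G e" and a: "bilinear a" and b: "bilinear b"
  shows "inner_form2 G a b = 1 / 2 * (\<Sum>i\<in>UNIV. \<Sum>j\<in>UNIV. a (e i) (e j) * b (e i) (e j))"
proof -
  let ?s = "some_frame G"
  note s = some_frame[OF e]
  have "(\<Sum>j\<in>UNIV. a u (?s j) * b v (?s j)) = (\<Sum>j\<in>UNIV. a u (e j) * b v (e j))" for u v
    by (rule frame_sum_cong[OF s e, of "\<lambda>x y. a u x * b v y"])
      (auto simp: bilinear_def bilinear_simps[OF a] bilinear_simps[OF b] algebra_simps intro!: linearI)
  moreover have "(\<Sum>i\<in>UNIV. \<Sum>j\<in>UNIV. a (?s i) (e j) * b (?s i) (e j)) =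
      (\<Sum>i\<in>UNIV. \<Sum>j\<in>UNIV. a (e i) (e j) * b (e i) (e j))"
    by (rule frame_sum_cong[OF s e, of "\<lambda>x y. \<Sum>j\<in>UNIV. a x (e j) * b y (e j)"])
      (auto simp: bilinear_def bilinear_simps[OF a] bilinear_simps[OF b] algebra_simps
        sum.distrib sum_distrib_left intro!: linearI)
  ultimately show ?thesis
    by (simp add: inner_form2_def Let_def)
qed

lemma inner_form3_frame:
  assumes e: "orthonormal_frame G e" and a: "trilinear a" and b: "trilinear b"
  shows "inner_form3 G a b =
    1 / 6 * (\<Sum>i\<in>UNIV. \<Sum>j\<in>UNIV. \<Sum>k\<in>UNIV. a (e i) (e j) (e k) * b (e i) (e j) (e k))"
proof -
  let ?s = "some_frame G"
  note s = some_frame[OF e]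
  note ab = trilinear_simps[OF a] trilinear_simps[OF b]
  have "(\<Sum>k\<in>UNIV. a u v (?s k) * b u v (?s k)) = (\<Sum>k\<in>UNIV. a u v (e k) * b u v (e k))" for u v
    by (rule frame_sum_cong[OF s e, of "\<lambda>x y. a u v x * b u v y"])
      (auto simp: bilinear_def ab algebra_simps intro!: linearI)
  moreover have "(\<Sum>j\<in>UNIV. \<Sum>k\<in>UNIV. a u (?s j) (e k) * b u (?s j) (e k)) =
      (\<Sum>j\<in>UNIV. \<Sum>k\<in>UNIV. a u (e j) (e k) * b u (e j) (e k))" for u
    by (rule frame_sum_cong[OF s e, of "\<lambda>x y. \<Sum>k\<in>UNIV. a u x (e k) * b u y (e k)"])
      (auto simp: bilinear_def ab algebra_simps sum.distrib sum_distrib_left intro!: linearI)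
  moreover have "(\<Sum>i\<in>UNIV. \<Sum>j\<in>UNIV. \<Sum>k\<in>UNIV. a (?s i) (e j) (e k) * b (?s i) (e j) (e k)) =
      (\<Sum>i\<in>UNIV. \<Sum>j\<in>UNIV. \<Sum>k\<in>UNIV. a (e i) (e j) (e k) * b (e i) (e j) (e k))"
    by (rule frame_sum_cong[OF s e, of "\<lambda>x y. \<Sum>j\<in>UNIV. \<Sum>k\<in>UNIV. a x (e j) (e k) * b y (e j) (e k)"])
      (auto simp: bilinear_def ab algebra_simps sum.distrib sum_distrib_left intro!: linearI)
  ultimately show ?thesis
    by (simp add: inner_form3_def Let_def)
qed

end

section \<open>The cross product of a G2-structure\<close>

lemma UNIV_7: "UNIV = {0, 1, 2, 3, 4, 5, 6 :: 7}"
proof (rule sym, rule card_subset_eq)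
  show "card {0, 1, 2, 3, 4, 5, 6 :: 7} = card (UNIV :: 7 set)" by simp
qed auto

lemma sum_7: "sum f (UNIV :: 7 set) = f 0 + f 1 + f 2 + f 3 + f 4 + f 5 + f 6"
  unfolding UNIV_7 by (simp add: add.assoc)

lemma forall_7: "(\<forall>i :: 7. P i) \<longleftrightarrow> P 0 \<and> P 1 \<and> P 2 \<and> P 3 \<and> P 4 \<and> P 5 \<and> P 6"
proof -
  have "(\<forall>i. P i) \<longleftrightarrow> (\<forall>i\<in>UNIV. P i)" by simp
  then show ?thesis unfolding UNIV_7 by simp
qed

lemma add_7:
  "0 + 1 = (1 :: 7)" "0 + 2 = (2 :: 7)" "0 + 3 = (3 :: 7)" "0 + 4 = (4 :: 7)" "0 + 5 = (5 :: 7)" "0 + 6 = (6 :: 7)"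
  "1 + 1 = (2 :: 7)" "1 + 2 = (3 :: 7)" "1 + 3 = (4 :: 7)" "1 + 4 = (5 :: 7)" "1 + 5 = (6 :: 7)" "1 + 6 = (0 :: 7)"
  "2 + 1 = (3 :: 7)" "2 + 2 = (4 :: 7)" "2 + 3 = (5 :: 7)" "2 + 4 = (6 :: 7)" "2 + 5 = (0 :: 7)" "2 + 6 = (1 :: 7)"
  "3 + 1 = (4 :: 7)" "3 + 2 = (5 :: 7)" "3 + 3 = (6 :: 7)" "3 + 4 = (0 :: 7)" "3 + 5 = (1 :: 7)" "3 + 6 = (2 :: 7)"
  "4 + 1 = (5 :: 7)" "4 + 2 = (6 :: 7)" "4 + 3 = (0 :: 7)" "4 + 4 = (1 :: 7)" "4 + 5 = (2 :: 7)" "4 + 6 = (3 :: 7)"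
  "5 + 1 = (6 :: 7)" "5 + 2 = (0 :: 7)" "5 + 3 = (1 :: 7)" "5 + 4 = (2 :: 7)" "5 + 5 = (3 :: 7)" "5 + 6 = (4 :: 7)"
  "6 + 1 = (0 :: 7)" "6 + 2 = (1 :: 7)" "6 + 3 = (2 :: 7)" "6 + 4 = (3 :: 7)" "6 + 5 = (4 :: 7)" "6 + 6 = (5 :: 7)"
  by simp_all

text \<open>The expansion along the first row. It turns \<open>wedge4\<close> into a polynomial, on
  which identities can be decided algebraically.\<close>

lemma det_4:
  "det (A::'a::comm_ring_1^4^4) =
    A$1$1 * (A$2$2 * A$3$3 * A$4$4 + A$2$3 * A$3$4 * A$4$2 + A$2$4 * A$3$2 * A$4$3
      - A$2$2 * A$3$4 * A$4$3 - A$2$3 * A$3$2 * A$4$4 - A$2$4 * A$3$3 * A$4$2)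
    - A$1$2 * (A$2$1 * A$3$3 * A$4$4 + A$2$3 * A$3$4 * A$4$1 + A$2$4 * A$3$1 * A$4$3
      - A$2$1 * A$3$4 * A$4$3 - A$2$3 * A$3$1 * A$4$4 - A$2$4 * A$3$3 * A$4$1)
    + A$1$3 * (A$2$1 * A$3$2 * A$4$4 + A$2$2 * A$3$4 * A$4$1 + A$2$4 * A$3$1 * A$4$2
      - A$2$1 * A$3$4 * A$4$2 - A$2$2 * A$3$1 * A$4$4 - A$2$4 * A$3$2 * A$4$1)
    - A$1$4 * (A$2$1 * A$3$2 * A$4$3 + A$2$2 * A$3$3 * A$4$1 + A$2$3 * A$3$1 * A$4$2
      - A$2$1 * A$3$3 * A$4$2 - A$2$2 * A$3$1 * A$4$3 - A$2$3 * A$3$2 * A$4$1)"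
proof -
  have f1234: "finite {2::4, 3, 4}" "1 \<notin> {2::4, 3, 4}" by auto
  have f234: "finite {3::4, 4}" "2 \<notin> {3::4, 4}" by auto
  have f34: "finite {4::4}" "3 \<notin> {4::4}" by auto
  show ?thesis
    unfolding det_def UNIV_4
    unfolding sum_over_permutations_insert[OF f1234]
    unfolding sum_over_permutations_insert[OF f234]
    unfolding sum_over_permutations_insert[OF f34]
    unfolding permutes_sing
    by (simp add: sign_swap_id permutation_swap_id permutation_compose sign_compose sign_id swap_id_eq
        algebra_simps)
qed

lemma vector_4 [simp]:
  "(vector [x, y, z, w] :: 'a::zero ^ 4) $ 1 = x"
  "(vector [x, y, z, w] :: 'a::zero ^ 4) $ 2 = y"
  "(vector [x, y, z, w] :: 'a::zero ^ 4) $ 3 = z"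
  "(vector [x, y, z, w] :: 'a::zero ^ 4) $ 4 = w"
  unfolding vector_def by simp_all

text \<open>The components of the cross product in a Cayley frame.\<close>

definition cayley_prod :: "(7 \<Rightarrow> real) \<Rightarrow> (7 \<Rightarrow> real) \<Rightarrow> 7 \<Rightarrow> real" where
  "cayley_prod x y k = x (k + 1) * y (k + 3) - x (k + 3) * y (k + 1) +
     (x (k + 2) * y (k + 6) - x (k + 6) * y (k + 2)) + (x (k + 4) * y (k + 5) - x (k + 5) * y (k + 4))"

text \<open>A polynomial identity in 28 variables, the Lagrange identity with an octonionic
  correction. The correction enters with a plus sign because the definition of
  \<open>star_form\<close> carries a minus sign.\<close>

lemma cayley_prod_inner:
  fixes x y z w :: "7 \<Rightarrow> real"
  shows "(\<Sum>k\<in>UNIV. cayley_prod x y k * cayley_prod z w k) =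
    (\<Sum>k\<in>UNIV. x k * z k) * (\<Sum>k\<in>UNIV. y k * w k) - (\<Sum>k\<in>UNIV. x k * w k) * (\<Sum>k\<in>UNIV. y k * z k)
    + (\<Sum>i\<in>UNIV. wedge4 (\<lambda>v. v (i + 2)) (\<lambda>v. v (i + 4)) (\<lambda>v. v (i + 5)) (\<lambda>v. v (i + 6)) x y z w)"
  unfolding cayley_prod_def wedge4_def det_4 vector_4 sum_7 add_7
  by algebra

section \<open>Frame-free algebra of the cross product and of its four-form\<close>

locale g2_form = inner_form G for G :: "real ^ 7 \<Rightarrow> real ^ 7 \<Rightarrow> real" +
  fixes f :: "real ^ 7 \<Rightarrow> real ^ 7 \<Rightarrow> real ^ 7 \<Rightarrow> real"
  assumes ex_cayley: "\<exists>e. cayley_frame G f e"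
begin

abbreviation "P \<equiv> cross G f"
abbreviation "Q \<equiv> star_form G f"

text \<open>The wedge sum regrouped by the coordinates of the last argument: each index lies on
  three of the seven triples, which gives the three brackets of \<open>cayley_prod\<close>.\<close>

lemma f_coords:
  assumes "cayley_frame G f e"
  shows "f x y z = (\<Sum>k\<in>UNIV. cayley_prod (\<lambda>i. G (e i) x) (\<lambda>i. G (e i) y) k * G (e k) z)"
proof -
  have "f x y z = (\<Sum>i\<in>UNIV. wedge3 (G (e i)) (G (e (i + 1))) (G (e (i + 3))) x y z)"
    using assms by (simp add: cayley_frame_def)
  then show ?thesis
    unfolding cayley_prod_def wedge3_def det_3 vector_3 sum_7 add_7 by algebra
qed

lemma trilinear_f: "trilinear f"
proof -
  obtain e where "cayley_frame G f e" using ex_cayley by blast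
  note * = f_coords[OF this]
  have "f (x + x') y z = f x y z + f x' y z" "f x (y + y') z = f x y z + f x y' z"
      "f x y (z + z') = f x y z + f x y z'" for x x' y y' z z'
    unfolding * cayley_prod_def sum_7 add_7 G_simps by algebra+
  moreover have "f (c *\<^sub>R x) y z = c *\<^sub>R f x y z" "f x (c *\<^sub>R y) z = c *\<^sub>R f x y z"
      "f x y (c *\<^sub>R z) = c *\<^sub>R f x y z" for c x y z
    unfolding * cayley_prod_def sum_7 add_7 G_simps real_scaleR_def by algebra+
  ultimately show ?thesis
    by (auto simp: trilinear_def intro!: linearI)
qed

lemmas f_simps = trilinear_simps[OF trilinear_f]

lemma f_skew: "f y x z = - f x y z" "f x z y = - f x y z"
proof -
  obtain e where "cayley_frame G f e" using ex_cayley by blast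
  note * = f_coords[OF this]
  show "f y x z = - f x y z"
    unfolding * cayley_prod_def sum_7 add_7 by algebra
  show "f x z y = - f x y z"
    unfolding * cayley_prod_def sum_7 add_7 by algebra
qed

lemma f_same: "f x x z = 0" "f x z z = 0" "f x z x = 0"
  using f_skew[of x x z] f_skew[of z x x] f_skew[of x z z] f_skew[of x z x] f_skew[of x x z] by linarith+

lemma f_rot: "f y z x = f x y z"
  using f_skew(1)[of x y z] f_skew(2)[of y x z] by linarith

lemma cross_inner: "G (P x y) z = f x y z"
  unfolding cross_def by (rule the_riesz) (use trilinear_f in \<open>simp add: trilinear_def\<close>)

lemma bilinear_cross: "bilinear P"
  unfolding bilinear_def
  by (auto intro!: linearI nondegenerate simp: cross_inner f_simps G_simps)

lemmas P_simps = bilinear_simps[OF bilinear_cross]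

lemma cross_inner_cross:
  assumes e: "cayley_frame G f e"
  shows "G (P x y) (P z w) = G x z * G y w - G x w * G y z +
    (\<Sum>i\<in>UNIV. wedge4 (G (e (i + 2))) (G (e (i + 4))) (G (e (i + 5))) (G (e (i + 6))) x y z w)"
proof -
  have on: "orthonormal_frame G e" using e by (simp add: cayley_frame_def)
  have Pe: "G (P x y) (e k) = cayley_prod (\<lambda>i. G (e i) x) (\<lambda>i. G (e i) y) k" for x y k
    by (simp add: cross_inner f_coords[OF e] frame_orthonormal[OF on] if_distrib cong: if_cong)
  have in_e: "G u v = (\<Sum>k\<in>UNIV. G (e k) u * G (e k) v)" for u v
    using frame_inner[OF on, of u v] by (simp add: sym)
  show ?thesis
    unfolding frame_inner[OF on, of "P x y"] Pe cayley_prod_inner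
    by (simp add: in_e[symmetric] wedge4_def)
qed

text \<open>This removes the chosen Cayley frame: the four-form is determined by the metric and the
  cross product, being the defect in the Lagrange identity.\<close>

lemma star_eq: "Q x y z w = G x z * G y w - G x w * G y z - G (P x y) (P z w)"
  using cross_inner_cross[OF someI_ex[OF ex_cayley], of x y z w] by (simp add: star_form_def Let_def)

lemma cross_skew: "P y x = - P x y"
  by (rule nondegenerate) (simp add: cross_inner G_simps f_skew(1)[of x y])

lemma cross_same: "P x x = 0"
  by (rule nondegenerate) (simp add: cross_inner G_simps f_same)

text \<open>The formula \<open>star_eq\<close> shows the skew-symmetry in the outer pairs but hides
  the one in the middle, which is therefore read from the coordinates.\<close>

lemma star_skew_23: "Q x z y w = - Q x y z w"
proof -
  obtain e where "cayley_frame G f e" using ex_cayley by blast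
  note * = cross_inner_cross[OF this]
  show ?thesis
    unfolding star_eq * wedge4_def det_4 vector_4 sum_7 add_7 by (simp only: sym) algebra
qed

lemma star_skew: "Q y x z w = - Q x y z w" "Q x z y w = - Q x y z w" "Q x y w z = - Q x y z w"
proof -
  show "Q y x z w = - Q x y z w"
    unfolding star_eq cross_skew[of x y] G_simps by simp
  show "Q x y w z = - Q x y z w"
    unfolding star_eq cross_skew[of z w] G_simps by simp
qed (rule star_skew_23)

lemma linear_star: "linear (\<lambda>x. Q x y z w)"
  by (rule linearI) (simp_all add: star_eq G_simps P_simps algebra_simps)

lemma trilinear_star: "trilinear (Q x)"
  by (auto simp: trilinear_def star_eq G_simps P_simps algebra_simps intro!: linearI)

text \<open>Paired with \<open>z\<close>, the left side is an inner product of two cross products;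
  in its Lagrange identity the four-form has a repeated argument and drops out.\<close>

lemma cross_cross: "P x (P x y) = G x y *\<^sub>R x - G x x *\<^sub>R y"
proof (rule nondegenerate)
  fix z
  have "G (P x (P x y)) z = f z x (P x y)"
    using f_rot[of x "P x y" z] by (simp add: cross_inner)
  also have "\<dots> = G (P z x) (P x y)"
    by (simp add: cross_inner)
  also have "\<dots> = G z x * G x y - G z y * G x x - Q z x x y"
    by (simp add: star_eq)
  also have "Q z x x y = 0"
    using star_skew(2)[of z x x y] by simp
  finally show "G (P x (P x y)) z = G (G x y *\<^sub>R x - G x x *\<^sub>R y) z"
    by (simp add: G_simps sym algebra_simps)
qed

lemma cross_cross_polar:
  "P x (P y z) + P y (P x z) = G x z *\<^sub>R y + G y z *\<^sub>R x - (2 * G x y) *\<^sub>R z"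
proof -
  have "P x (P y z) + P y (P x z) = P (x + y) (P (x + y) z) - P x (P x z) - P y (P y z)"
    by (simp add: P_simps)
  also have "\<dots> = G x z *\<^sub>R y + G y z *\<^sub>R x - (2 * G x y) *\<^sub>R z"
    unfolding cross_cross by (simp add: G_simps algebra_simps sym[of y x] scaleR_2 flip: scaleR_scaleR)
  finally show ?thesis .
qed

text \<open>The multiplication table of the imaginary octonions: every product of two distinct frame
  vectors is one of these or its negative.\<close>

lemma cross_frame:
  assumes e: "cayley_frame G f e"
  shows "P (e i) (e (i + 1)) = e (i + 3)" "P (e i) (e (i + 2)) = e (i + 6)" "P (e i) (e (i + 4)) = e (i + 5)"
proof -
  have on: "orthonormal_frame G e" using e by (simp add: cayley_frame_def)
  have Pe: "G (P x y) (e k) = cayley_prod (\<lambda>i. G (e i) x) (\<lambda>i. G (e i) y) k" for x y k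
    by (simp add: cross_inner f_coords[OF e] frame_orthonormal[OF on] if_distrib cong: if_cong)
  have eq: "P (e i) (e j) = e k" if "i \<noteq> j" "G (P (e i) (e j)) (e k) = 1" for i j k
  proof (rule ccontr)
    assume "P (e i) (e j) \<noteq> e k"
    \<comment> \<open>Both vectors have length one and their inner product is one, so the squared
      length of the difference is 1 - 2 + 1 = 0.\<close>
    then have "0 < G (P (e i) (e j) - e k) (P (e i) (e j) - e k)" by (simp add: pos)
    moreover have "G (P (e i) (e j)) (P (e i) (e j)) = 1"
      using star_eq[of "e i" "e j" "e i" "e j"] star_skew(2)[of "e i" "e i" "e j" "e j"]
        star_skew(1)[of "e i" "e i" "e j" "e j"] that(1)
      by (simp add: frame_orthonormal[OF on])
    ultimately show False
      using that(2) by (simp add: G_simps frame_orthonormal[OF on] sym[of "e k"])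
  qed
  show "P (e i) (e (i + 1)) = e (i + 3)" "P (e i) (e (i + 2)) = e (i + 6)" "P (e i) (e (i + 4)) = e (i + 5)"
    by (rule eq; simp add: Pe cayley_prod_def frame_orthonormal[OF on])+
qed

end

section \<open>Components of contractions of the four-form\<close>

lemma add_add_7:
  fixes m :: 7
  shows
  "m + 1 + 1 = m + 2" "m + 1 + 2 = m + 3" "m + 1 + 3 = m + 4" "m + 1 + 4 = m + 5" "m + 1 + 5 = m + 6" "m + 1 + 6 = m"
  "m + 2 + 1 = m + 3" "m + 2 + 2 = m + 4" "m + 2 + 3 = m + 5" "m + 2 + 4 = m + 6" "m + 2 + 5 = m" "m + 2 + 6 = m + 1"
  "m + 3 + 1 = m + 4" "m + 3 + 2 = m + 5" "m + 3 + 3 = m + 6" "m + 3 + 4 = m" "m + 3 + 5 = m + 1" "m + 3 + 6 = m + 2"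
  "m + 4 + 1 = m + 5" "m + 4 + 2 = m + 6" "m + 4 + 3 = m" "m + 4 + 4 = m + 1" "m + 4 + 5 = m + 2" "m + 4 + 6 = m + 3"
  "m + 5 + 1 = m + 6" "m + 5 + 2 = m" "m + 5 + 3 = m + 1" "m + 5 + 4 = m + 2" "m + 5 + 5 = m + 3" "m + 5 + 6 = m + 4"
  "m + 6 + 1 = m" "m + 6 + 2 = m + 1" "m + 6 + 3 = m + 2" "m + 6 + 4 = m + 3" "m + 6 + 5 = m + 4" "m + 6 + 6 = m + 5"
  by simp_all

text \<open>The components of \<open>*\<phi>(\<rho>, \<sqdot>, \<sqdot>, \<sqdot>)\<close> in a Cayley frame.\<close>

definition star_components :: "(7 \<Rightarrow> real) \<Rightarrow> (7 \<Rightarrow> 7 \<Rightarrow> 7 \<Rightarrow> real) \<Rightarrow> bool" where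
  "star_components \<rho> t \<longleftrightarrow> (\<forall>i j k. t j i k = - t i j k \<and> t i k j = - t i j k) \<and>
     (\<forall>m. t m (m + 1) (m + 3) = 0 \<and> t (m + 2) (m + 3) (m + 4) = - \<rho> m \<and>
        t (m + 5) (m + 1) (m + 2) = \<rho> m \<and> t (m + 4) (m + 6) (m + 1) = - \<rho> m \<and>
        t (m + 3) (m + 5) (m + 6) = \<rho> m)"

text \<open>Of the 35 unordered triples of indices, seven are lines of the Fano plane. Each of the
  other 28 is completed by a unique index \<open>m\<close> to the complement of a line, so every
  \<open>m\<close> owns four triples. Skew-symmetry spreads each prescribed value over six orders,
  giving a complete table for rewriting.\<close>

lemma star_components_values:
  assumes "star_components \<rho> t"
  shows "t i i k = 0" "t i k i = 0" "t k i i = 0"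
    and "\<forall>m. t m (m + 1) (m + 3) = 0 \<and> t m (m + 3) (m + 1) = 0 \<and> t (m + 1) m (m + 3) = 0 \<and>
      t (m + 1) (m + 3) m = 0 \<and> t (m + 3) m (m + 1) = 0 \<and> t (m + 3) (m + 1) m = 0" (is ?v1)
    and "\<forall>m. t (m + 2) (m + 3) (m + 4) = - \<rho> m \<and> t (m + 3) (m + 4) (m + 2) = - \<rho> m \<and>
      t (m + 4) (m + 2) (m + 3) = - \<rho> m \<and> t (m + 3) (m + 2) (m + 4) = \<rho> m \<and>
      t (m + 2) (m + 4) (m + 3) = \<rho> m \<and> t (m + 4) (m + 3) (m + 2) = \<rho> m" (is ?v2)
    and "\<forall>m. t (m + 5) (m + 1) (m + 2) = \<rho> m \<and> t (m + 1) (m + 2) (m + 5) = \<rho> m \<and>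
      t (m + 2) (m + 5) (m + 1) = \<rho> m \<and> t (m + 1) (m + 5) (m + 2) = - \<rho> m \<and>
      t (m + 5) (m + 2) (m + 1) = - \<rho> m \<and> t (m + 2) (m + 1) (m + 5) = - \<rho> m" (is ?v3)
    and "\<forall>m. t (m + 4) (m + 6) (m + 1) = - \<rho> m \<and> t (m + 6) (m + 1) (m + 4) = - \<rho> m \<and>
      t (m + 1) (m + 4) (m + 6) = - \<rho> m \<and> t (m + 6) (m + 4) (m + 1) = \<rho> m \<and>
      t (m + 4) (m + 1) (m + 6) = \<rho> m \<and> t (m + 1) (m + 6) (m + 4) = \<rho> m" (is ?v4)
    and "\<forall>m. t (m + 3) (m + 5) (m + 6) = \<rho> m \<and> t (m + 5) (m + 6) (m + 3) = \<rho> m \<and>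
      t (m + 6) (m + 3) (m + 5) = \<rho> m \<and> t (m + 5) (m + 3) (m + 6) = - \<rho> m \<and>
      t (m + 3) (m + 6) (m + 5) = - \<rho> m \<and> t (m + 6) (m + 5) (m + 3) = - \<rho> m" (is ?v5)
proof -
  have alt: "t j i k = - t i j k" "t i k j = - t i j k" for i j k
    using assms unfolding star_components_def by blast+
  have base: "t m (m + 1) (m + 3) = 0" "t (m + 2) (m + 3) (m + 4) = - \<rho> m" "t (m + 5) (m + 1) (m + 2) = \<rho> m"
      "t (m + 4) (m + 6) (m + 1) = - \<rho> m" "t (m + 3) (m + 5) (m + 6) = \<rho> m" for m
    using assms unfolding star_components_def by blast+
  have zero: "t i i k = 0" "t k i i = 0" for i k
    using alt(1)[of i i k] alt(2)[of k i i] by linarith+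
  show "t i i k = 0" "t k i i = 0" "t i k i = 0"
    using zero(1)[of i k] zero(2)[of k i] zero(1)[of i k] zero(2)[of k i] alt(1)[of k i i] by simp_all
  have orbit: "t a b c = v \<Longrightarrow> t a b c = v \<and> t b c a = v \<and> t c a b = v \<and> t b a c = - v \<and> t a c b = - v \<and> t c b a = - v"
    for a b c v
    using alt(1)[of a b c] alt(2)[of a b c] alt(1)[of a c b] alt(2)[of b a c] alt(2)[of c a b]
    by linarith
  show ?v1 using orbit[OF base(1)] by simp
  show ?v2 using orbit[OF base(2)] by simp
  show ?v3 using orbit[OF base(3)] by simp
  show ?v4 using orbit[OF base(4)] by simp
  show ?v5 using orbit[OF base(5)] by simp
qed

lemma star_components_unique:
  assumes "star_components \<rho> t" "star_components \<rho> s"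
  shows "t i j k = s i j k"
proof -
  note t = star_components_values(1-3)[OF assms(1)]
    star_components_values(4-)[OF assms(1), unfolded forall_7 add_7 add_0_left]
  note s = star_components_values(1-3)[OF assms(2)]
    star_components_values(4-)[OF assms(2), unfolded forall_7 add_7 add_0_left]
  have "\<forall>i j k. t i j k = s i j k"
    unfolding forall_7 by (simp add: t s)
  then show ?thesis by blast
qed

text \<open>The constant is 24 = 4 * 6: four triples for each index, each in six orders.\<close>

lemma star_components_inner:
  assumes "star_components \<rho> t" "star_components \<sigma> s"
  shows "(\<Sum>i\<in>UNIV. \<Sum>j\<in>UNIV. \<Sum>k\<in>UNIV. t i j k * s i j k) = 24 * (\<Sum>m\<in>UNIV. \<rho> m * \<sigma> m)"
proof -
  note t = star_components_values(1-3)[OF assms(1)]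
    star_components_values(4-)[OF assms(1), unfolded forall_7 add_7 add_0_left]
  note s = star_components_values(1-3)[OF assms(2)]
    star_components_values(4-)[OF assms(2), unfolded forall_7 add_7 add_0_left]
  show ?thesis
    unfolding sum_7 by (simp add: t s)
qed

context g2_form
begin

text \<open>For distinct indices the metric terms of \<open>star_eq\<close> vanish, and the
  four-form becomes minus the inner product of \<open>x\<close> with an iterated cross product,
  which the multiplication table evaluates.\<close>

lemma star_components_star:
  assumes e: "cayley_frame G f e"
  shows "star_components (\<lambda>m. G x (e m)) (\<lambda>i j k. Q x (e i) (e j) (e k))"
proof -
  have on: "orthonormal_frame G e" using e by (simp add: cayley_frame_def)
  note P = cross_frame[OF e]
  have mP: "P (e b) (e a) = - e c" if "P (e a) (e b) = e c" for a b c
    using that cross_skew[of "e b" "e a"] by simp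
  have P': "P (e (m + 3)) (e (m + 4)) = e (m + 6)" "P (e (m + 2)) (e (m + 6)) = e m"
      "P (e (m + 1)) (e (m + 2)) = e (m + 4)" "P (e (m + 5)) (e (m + 4)) = - e m"
      "P (e (m + 6)) (e (m + 1)) = e (m + 5)" "P (e (m + 4)) (e (m + 5)) = e m"
      "P (e (m + 5)) (e (m + 6)) = e (m + 1)" "P (e (m + 3)) (e (m + 1)) = - e m"
      "P (e (m + 1)) (e (m + 3)) = e m" for m
    using P(1)[of "m + 3"] P(3)[of "m + 2"] P(1)[of "m + 1"] mP[OF P(1)[of "m + 4"]]
      P(2)[of "m + 6"] P(1)[of "m + 4"] P(1)[of "m + 5"] mP[OF P(2)[of "m + 1"]] P(2)[of "m + 1"]
    unfolding add_add_7 by blast+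
  have Q: "Q x (e i) (e j) (e k) = - G x (P (e i) (P (e j) (e k)))" if "i \<noteq> j" "i \<noteq> k" for i j k
    using that f_rot[of "e i" "P (e j) (e k)" x]
    by (simp add: star_eq frame_orthonormal[OF on] cross_inner sym[of x "P (e i) (P (e j) (e k))"])
  show ?thesis
    unfolding star_components_def
    by (intro conjI allI star_skew(2) star_skew(3)) (simp_all add: Q P' G_simps cross_same)
qed

text \<open>The factor 4 is 24 / 6. It cancels the 1/4 in the definition of
  \<open>rbar\<close>.\<close>

lemma star_inner: "inner_form3 G (Q x) (Q y) = 4 * G x y"
proof -
  obtain e where e: "cayley_frame G f e" using ex_cayley by blast
  then have on: "orthonormal_frame G e" by (simp add: cayley_frame_def)
  show ?thesis
    using star_components_inner[OF star_components_star[OF e, of x] star_components_star[OF e, of y]]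
    by (simp add: inner_form3_frame[OF on trilinear_star trilinear_star] frame_inner[OF on, of x y])
qed

text \<open>The tangent space at \<open>f\<close> of the set of all cross products for \<open>G\<close>.\<close>

lemma cross_variation:
  assumes T: "trilinear T" and skew: "\<And>x y z. T y x z = - T x y z" "\<And>x y z. T x z y = - T x y z"
    and rel: "\<And>x y z. T x (P x y) z = T x y (P x z)"
  obtains \<rho> where "\<And>x y z. T x y z = Q \<rho> x y z"
proof -
  obtain e where e: "cayley_frame G f e" using ex_cayley by blast
  then have on: "orthonormal_frame G e" by (simp add: cayley_frame_def)
  note P = cross_frame[OF e]
  note T_simps = trilinear_simps[OF T]
  define t where "t = (\<lambda>i j k. T (e i) (e j) (e k))"
  have tskew: "t j i k = - t i j k" "t i k j = - t i j k" for i j k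
    unfolding t_def by (rule skew)+
  have mP: "P (e b) (e a) = - e c" if "P (e a) (e b) = e c" for a b c
    using that cross_skew[of "e b" "e a"] by simp
  \<comment> \<open>The four triples owned by \<open>m\<close> should carry one common value up to
    sign. It is read off from this triple, and \<open>rel_t\<close> and \<open>rel_m\<close>
    transport it to the other three.\<close>
  define r where "r = (\<lambda>m. t (m + 5) (m + 1) (m + 2))"
  have rel_t: "t i b c = t i a d" if "P (e i) (e a) = e b" "P (e i) (e c) = e d" for i a b c d
    using rel[of "e i" "e a" "e c"] that by (simp add: t_def)
  have rel_m: "t i b c = - t i a d" if "P (e i) (e a) = e b" "P (e c) (e i) = e d" for i a b c d
    using rel[of "e i" "e a" "e c"] mP[OF that(2)] that by (simp add: t_def T_simps)
  \<comment> \<open>On a line the relation compares the two orders of the last two indices, so the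
    value is symmetric as well as skew in them.\<close>
  have "t m (m + 1) (m + 3) = 0" for m
    using rel_t[OF P(1)[of m] P(1)[of m]] tskew(2)[of m "m + 1" "m + 3"] by simp
  moreover have "t (m + 2) (m + 3) (m + 4) = - r m" for m
    using rel_m[OF P(1)[of "m + 2"] P(1)[of "m + 1", unfolded add_add_7], unfolded add_add_7]
      tskew(1)[of "m + 2" "m + 5" "m + 1"] tskew(2)[of "m + 5" "m + 2" "m + 1"]
    unfolding r_def by linarith
  moreover have "t (m + 4) (m + 6) (m + 1) = - r m" for m
    using rel_m[OF P(3)[of "m + 1"] P(3)[of "m + 4", unfolded add_add_7], unfolded add_add_7]
      tskew(1)[of "m + 1" "m + 5" "m + 2"] tskew(1)[of "m + 1" "m + 4" "m + 6"]
      tskew(2)[of "m + 1" "m + 4" "m + 6"] tskew(2)[of "m + 4" "m + 6" "m + 1"]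
    unfolding r_def by linarith
  moreover have "t (m + 3) (m + 5) (m + 6) = r m" for m
    using rel_t[OF P(3)[of "m + 5"] P(1)[of "m + 5"], unfolded add_add_7]
      tskew(1)[of "m + 3" "m + 5" "m + 6"] tskew(2)[of "m + 5" "m + 2" "m + 1"]
    unfolding r_def by linarith
  ultimately have "star_components r t"
    unfolding star_components_def by (intro conjI allI tskew) (simp_all add: r_def)
  define \<rho> where "\<rho> = (\<Sum>m\<in>UNIV. r m *\<^sub>R e m)"
  have "G \<rho> (e m) = r m" for m
    by (simp add: \<rho>_def G_simps frame_orthonormal[OF on] if_distrib cong: if_cong)
  then have eq: "T (e i) (e j) (e k) = Q \<rho> (e i) (e j) (e k)" for i j k
    using star_components_unique[OF \<open>star_components r t\<close>, of "\<lambda>i j k. Q \<rho> (e i) (e j) (e k)" i j k]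
      star_components_star[OF e, of \<rho>] by (simp add: t_def)
  have "T x y z = Q \<rho> x y z" for x y z
    by (subst (1 2) frame_expansion[OF on, of x], subst (1 2) frame_expansion[OF on, of y],
        subst (1 2) frame_expansion[OF on, of z])
      (simp add: T_simps trilinear_simps[OF trilinear_star] eq)
  then show ?thesis by (rule that)
qed

end

section \<open>Calculus\<close>

lemma smooth_on_differentiable: "smooth_on S f \<Longrightarrow> x \<in> S \<Longrightarrow> f differentiable (at x)"
  unfolding smooth_on_def by (metis Ck_on.simps(2))

lemma smooth_on_derivative: "smooth_on S f \<Longrightarrow> smooth_on S (\<lambda>x. frechet_derivative f (at x) v)"
  unfolding smooth_on_def by (metis Ck_on.simps(2))

lemma smooth_on_continuous: "smooth_on S f \<Longrightarrow> continuous_on S f"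
  unfolding smooth_on_def by (metis Ck_on.simps(1))

lemma smooth_on_has_derivative:
  "smooth_on S f \<Longrightarrow> x \<in> S \<Longrightarrow> (f has_derivative frechet_derivative f (at x)) (at x)"
  using smooth_on_differentiable frechet_derivative_works by blast

lemma has_derivative_along_line:
  fixes f :: "'a::real_normed_vector \<Rightarrow> real"
  assumes "f differentiable (at (a + s *\<^sub>R u))"
  shows "((\<lambda>s. f (a + s *\<^sub>R u)) has_real_derivative frechet_derivative f (at (a + s *\<^sub>R u)) u) (at s)"
proof -
  let ?D = "frechet_derivative f (at (a + s *\<^sub>R u))"
  have "(f has_derivative ?D) (at (a + s *\<^sub>R u))"
    using assms frechet_derivative_works by blast
  then have "((\<lambda>s. f (a + s *\<^sub>R u)) has_derivative (\<lambda>t. ?D (t *\<^sub>R u))) (at s)"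
    by (rule has_derivative_compose[rotated]) (auto intro!: derivative_eq_intros)
  moreover have "?D (t *\<^sub>R u) = ?D u * t" for t
    using linear_frechet_derivative[OF assms] by (simp add: linear_cmul)
  ultimately show ?thesis
    by (simp add: has_field_derivative_def)
qed

section \<open>Symmetry of second derivatives\<close>

text \<open>The mean value theorem is used twice: along \<open>u\<close> for the difference of
  \<open>f\<close> and its translate by \<open>h v\<close>, then along \<open>v\<close> for the
  derivative in direction \<open>u\<close>.\<close>

lemma second_difference:
  fixes f :: "'a::real_normed_vector \<Rightarrow> real"
  assumes S: "\<And>y. y \<in> ball x d \<Longrightarrow> f differentiable (at y)"
    "\<And>y. y \<in> ball x d \<Longrightarrow> (\<lambda>z. frechet_derivative f (at z) u) differentiable (at y)"
    and h: "0 < h" "h * (norm u + norm v) < d"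
  shows "\<exists>y\<in>ball x d. f (x + h *\<^sub>R u + h *\<^sub>R v) - f (x + h *\<^sub>R u) - f (x + h *\<^sub>R v) + f x =
    h * h * frechet_derivative (\<lambda>z. frechet_derivative f (at z) u) (at y) v"
proof -
  let ?D = "\<lambda>z. frechet_derivative f (at z) u"
  have in_ball: "x + s *\<^sub>R u + t *\<^sub>R v \<in> ball x d" if "0 \<le> s" "s \<le> h" "0 \<le> t" "t \<le> h" for s t
  proof -
    have "norm (s *\<^sub>R u + t *\<^sub>R v) \<le> s * norm u + t * norm v"
      using norm_triangle_ineq[of "s *\<^sub>R u" "t *\<^sub>R v"] that by simp
    also have "\<dots> \<le> h * norm u + h * norm v"
      using that by (intro add_mono mult_right_mono) auto
    finally have "norm (s *\<^sub>R u + t *\<^sub>R v) < d"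
      using h by (simp add: algebra_simps)
    moreover have "dist x (x + s *\<^sub>R u + t *\<^sub>R v) = norm (s *\<^sub>R u + t *\<^sub>R v)"
      by (metis add.assoc add_diff_cancel_left' dist_commute dist_norm)
    ultimately show ?thesis by simp
  qed
  define p where "p = (\<lambda>s. f (x + h *\<^sub>R v + s *\<^sub>R u) - f (x + s *\<^sub>R u))"
  have "(p has_real_derivative ?D (x + h *\<^sub>R v + s *\<^sub>R u) - ?D (x + s *\<^sub>R u)) (at s)"
    if "0 \<le> s" "s \<le> h" for s
    unfolding p_def using in_ball[of s h] in_ball[of s 0] that h
    by (intro DERIV_diff has_derivative_along_line S) (auto simp: algebra_simps)
  then obtain s where s: "0 < s" "s < h" "p h - p 0 = (h - 0) * (?D (x + h *\<^sub>R v + s *\<^sub>R u) - ?D (x + s *\<^sub>R u))"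
    using MVT2[OF h(1), of p "\<lambda>s. ?D (x + h *\<^sub>R v + s *\<^sub>R u) - ?D (x + s *\<^sub>R u)"] by blast
  have "((\<lambda>t. ?D (x + s *\<^sub>R u + t *\<^sub>R v)) has_real_derivative
      frechet_derivative ?D (at (x + s *\<^sub>R u + t *\<^sub>R v)) v) (at t)" if "0 \<le> t" "t \<le> h" for t
    using in_ball[of s t] that s by (intro has_derivative_along_line S) auto
  then obtain t where t: "0 < t" "t < h" "?D (x + s *\<^sub>R u + h *\<^sub>R v) - ?D (x + s *\<^sub>R u + 0 *\<^sub>R v) =
      (h - 0) * frechet_derivative ?D (at (x + s *\<^sub>R u + t *\<^sub>R v)) v"
    using MVT2[OF h(1), of "\<lambda>t. ?D (x + s *\<^sub>R u + t *\<^sub>R v)"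
      "\<lambda>t. frechet_derivative ?D (at (x + s *\<^sub>R u + t *\<^sub>R v)) v"] by blast
  have "f (x + h *\<^sub>R u + h *\<^sub>R v) - f (x + h *\<^sub>R u) - f (x + h *\<^sub>R v) + f x = p h - p 0"
    by (simp add: p_def algebra_simps)
  also have "\<dots> = h * h * frechet_derivative ?D (at (x + s *\<^sub>R u + t *\<^sub>R v)) v"
    using s(3) t(3) by (simp add: algebra_simps)
  finally show ?thesis
    using in_ball[of s t] s t by force
qed

text \<open>The second difference is symmetric in \<open>u\<close> and \<open>v\<close>, so the two
  mixed derivatives agree at two points that may be taken close to \<open>x\<close>; continuity
  forces agreement at \<open>x\<close>.\<close>

lemma second_derivative_symmetric_real:
  fixes f :: "'a::real_normed_vector \<Rightarrow> real"
  assumes S: "open S" "x \<in> S" and f: "smooth_on S f"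
  shows "frechet_derivative (\<lambda>z. frechet_derivative f (at z) v) (at x) u =
    frechet_derivative (\<lambda>z. frechet_derivative f (at z) u) (at x) v" (is "?A x = ?B x")
proof (rule ccontr)
  assume neq: "?A x \<noteq> ?B x"
  \<comment> \<open>With half the gap as tolerance, a value near \<open>?A x\<close> cannot equal a
    value near \<open>?B x\<close>.\<close>
  define e where "e = \<bar>?A x - ?B x\<bar> / 2"
  have "e > 0" using neq by (simp add: e_def)
  have "continuous_on S ?A" "continuous_on S ?B"
    using f by (intro smooth_on_continuous smooth_on_derivative; assumption)+
  then have "isCont ?A x" "isCont ?B x"
    using S by (simp_all add: continuous_on_eq_continuous_at)
  then obtain d1 d2 where d1: "d1 > 0" "\<And>y. dist y x < d1 \<Longrightarrow> dist (?A y) (?A x) < e"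
    and d2: "d2 > 0" "\<And>y. dist y x < d2 \<Longrightarrow> dist (?B y) (?B x) < e"
    using \<open>e > 0\<close> unfolding continuous_at_eps_delta by metis
  obtain d3 where d3: "d3 > 0" "ball x d3 \<subseteq> S"
    using S open_contains_ball by blast
  define d where "d = min d1 (min d2 d3)"
  have d: "d > 0" using d1 d2 d3 by (simp add: d_def)
  \<comment> \<open>This keeps all translates inside the ball; the added 1 avoids division by zero
    when both directions vanish.\<close>
  define h where "h = d / (2 * (norm u + norm v + 1))"
  have pos: "norm u + norm v + 1 > 0" by (simp add: add_nonneg_pos)
  have h: "h > 0" using d pos by (simp add: h_def)
  have "h * (norm u + norm v) \<le> h * (norm u + norm v + 1)"
    using h by simp
  also have "\<dots> = d / 2"
    using pos by (simp add: h_def field_simps)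
  finally have hd: "h * (norm u + norm v) < d" "h * (norm v + norm u) < d"
    using d by (simp_all add: add.commute)
  have bS: "y \<in> S" if "y \<in> ball x d" for y
    using that d3 by (auto simp: d_def)
  obtain y where y: "y \<in> ball x d"
    "f (x + h *\<^sub>R u + h *\<^sub>R v) - f (x + h *\<^sub>R u) - f (x + h *\<^sub>R v) + f x = h * h * ?B y"
    using second_difference[OF smooth_on_differentiable[OF f bS]
        smooth_on_differentiable[OF smooth_on_derivative[OF f] bS] h hd(1)] by blast
  obtain z where z: "z \<in> ball x d"
    "f (x + h *\<^sub>R v + h *\<^sub>R u) - f (x + h *\<^sub>R v) - f (x + h *\<^sub>R u) + f x = h * h * ?A z"
    using second_difference[OF smooth_on_differentiable[OF f bS]
        smooth_on_differentiable[OF smooth_on_derivative[OF f] bS] h hd(2)] by blast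
  have swap: "x + h *\<^sub>R v + h *\<^sub>R u = x + h *\<^sub>R u + h *\<^sub>R v"
    by (simp add: add_ac)
  have "h * h * ?A z = h * h * ?B y"
    using y(2) z(2) unfolding swap by linarith
  then have "?A z = ?B y"
    using h by (metis mult_cancel_left mult_pos_pos less_irrefl)
  moreover have "dist (?A z) (?A x) < e" "dist (?B y) (?B x) < e"
    using d1(2)[of z] d2(2)[of y] y(1) z(1) by (auto simp: d_def dist_commute)
  ultimately show False
    by (simp add: e_def dist_real_def abs_if split: if_splits)
qed

lemma frechet_derivative_component:
  fixes f :: "'a::real_normed_vector \<Rightarrow> real ^ 'n"
  assumes "f differentiable (at x)"
  shows "frechet_derivative (\<lambda>z. f z $ i) (at x) u = frechet_derivative f (at x) u $ i"
proof -
  have "((\<lambda>z. f z $ i) has_derivative (\<lambda>u. frechet_derivative f (at x) u $ i)) (at x)"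
    using assms by (intro bounded_linear.has_derivative[OF bounded_linear_vec_nth])
      (simp add: frechet_derivative_works)
  from frechet_derivative_at[OF this] show ?thesis by metis
qed

lemma Ck_on_cong:
  assumes "open S" "\<And>x. x \<in> S \<Longrightarrow> f x = g x" "Ck_on k S f"
  shows "Ck_on k S g"
  using assms(2,3)
proof (induction k arbitrary: f g)
  case 0
  then show ?case by (simp cong: continuous_on_cong)
next
  case (Suc k)
  have *: "(g has_derivative frechet_derivative f (at x)) (at x)" if "x \<in> S" for x
    using Suc.prems that assms(1)
    by (auto intro!: has_derivative_transform_within_open[of f _ x UNIV S g] simp: frechet_derivative_works)
  then have "frechet_derivative g (at x) = frechet_derivative f (at x)" if "x \<in> S" for x
    using that frechet_derivative_at by metis
  then show ?case
    using * Suc by (auto simp: differentiable_def)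
qed

lemma smooth_on_component:
  fixes f :: "'a::real_normed_vector \<Rightarrow> real ^ 'n"
  assumes "open S" "smooth_on S f"
  shows "smooth_on S (\<lambda>x. f x $ i)"
proof -
  have "Ck_on k S (\<lambda>x. f x $ i)" if "Ck_on k S f" for k and f :: "'a \<Rightarrow> real ^ 'n"
    using that
  proof (induction k arbitrary: f)
    case 0
    then show ?case by (simp add: continuous_on_component)
  next
    case (Suc k)
    have "(\<lambda>x. f x $ i) differentiable (at x)" if "x \<in> S" for x
    proof -
      have "(f has_derivative frechet_derivative f (at x)) (at x)"
        using Suc.prems that by (simp flip: frechet_derivative_works)
      from bounded_linear.has_derivative[OF bounded_linear_vec_nth this] show ?thesis
        by (rule differentiableI)
    qed
    moreover have "Ck_on k S (\<lambda>x. frechet_derivative (\<lambda>x. f x $ i) (at x) v)" for v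
      by (rule Ck_on_cong[OF assms(1), of "\<lambda>x. frechet_derivative f (at x) v $ i"])
        (use Suc in \<open>auto simp: frechet_derivative_component\<close>)
    ultimately show ?case by simp
  qed
  then show ?thesis using assms by (simp add: smooth_on_def)
qed

lemma second_derivative_symmetric:
  fixes f :: "'a::real_normed_vector \<Rightarrow> real ^ 'n"
  assumes S: "open S" "x \<in> S" and f: "smooth_on S f"
  shows "frechet_derivative (\<lambda>z. frechet_derivative f (at z) v) (at x) u =
    frechet_derivative (\<lambda>z. frechet_derivative f (at z) u) (at x) v"
proof -
  have "frechet_derivative (\<lambda>z. frechet_derivative f (at z) v) (at x) u $ i =
      frechet_derivative (\<lambda>z. frechet_derivative (\<lambda>z. f z $ i) (at z) v) (at x) u" for i u v
  proof -
    have "((\<lambda>z. frechet_derivative f (at z) v $ i) has_derivative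
        (\<lambda>u. frechet_derivative (\<lambda>z. frechet_derivative f (at z) v) (at x) u $ i)) (at x)"
      using smooth_on_has_derivative[OF smooth_on_derivative[OF f] S(2)]
      by (rule bounded_linear.has_derivative[OF bounded_linear_vec_nth])
    then have "((\<lambda>z. frechet_derivative (\<lambda>z. f z $ i) (at z) v) has_derivative
        (\<lambda>u. frechet_derivative (\<lambda>z. frechet_derivative f (at z) v) (at x) u $ i)) (at x)"
      by (rule has_derivative_transform_within_open[OF _ S])
        (simp add: frechet_derivative_component smooth_on_differentiable[OF f])
    from frechet_derivative_at[OF this] show ?thesis by metis
  qed
  then show ?thesis
    using second_derivative_symmetric_real[OF S smooth_on_component[OF S(1) f]]
    by (simp add: vec_eq_iff)
qed

section \<open>Product rules for fields of multilinear forms\<close>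

lemma linear_field_derivative:
  fixes l :: "'a::real_normed_vector \<Rightarrow> real ^ 'n \<Rightarrow> 'b::real_normed_vector"
  assumes S: "open S" "x \<in> S" and lin: "\<And>y. y \<in> S \<Longrightarrow> linear (l y)"
    and l': "\<And>u. ((\<lambda>y. l y u) has_derivative (\<lambda>w. l' w u)) (at x)"
  shows "linear (l' w)"
proof (rule linearI)
  fix u v :: "real ^ 'n" and c :: real
  have "((\<lambda>y. l y (u + v)) has_derivative (\<lambda>w. l' w u + l' w v)) (at x)"
    by (rule has_derivative_transform_within_open[OF has_derivative_add[OF l' l'] S])
      (simp add: linear_add[OF lin])
  then show "l' w (u + v) = l' w u + l' w v"
    using has_derivative_unique[OF l'] by metis
  have "((\<lambda>y. l y (c *\<^sub>R u)) has_derivative (\<lambda>w. c *\<^sub>R l' w u)) (at x)"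
    by (rule has_derivative_transform_within_open[OF has_derivative_scaleR_right[OF l'] S])
      (simp add: linear_cmul[OF lin])
  then show "l' w (c *\<^sub>R u) = c *\<^sub>R l' w u"
    using has_derivative_unique[OF l'] by metis
qed

lemma linear_axis_expansion:
  fixes l :: "real ^ 'n \<Rightarrow> 'b::real_normed_vector"
  assumes "linear l"
  shows "l u = (\<Sum>i\<in>UNIV. (u $ i) *\<^sub>R l (axis i 1))"
  by (metis (mono_tags, lifting) assms basis_expansion linear_cmul linear_sum scalar_mult_eq_scaleR sum.cong)

text \<open>Differentiability of \<open>l\<close> is known only for each fixed argument. Expanding
  the moving argument on the standard basis reduces the claim to finitely many scalar
  products.\<close>

lemma has_derivative_linear_field:
  fixes l :: "'a::real_normed_vector \<Rightarrow> real ^ 'n \<Rightarrow> 'b::real_normed_vector"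
  assumes S: "open S" "x \<in> S" and lin: "\<And>y. y \<in> S \<Longrightarrow> linear (l y)"
    and l': "\<And>u. ((\<lambda>y. l y u) has_derivative (\<lambda>w. l' w u)) (at x)"
    and X: "(X has_derivative X') (at x)"
  shows "((\<lambda>y. l y (X y)) has_derivative (\<lambda>w. l' w (X x) + l x (X' w))) (at x)"
proof -
  have Xi: "((\<lambda>y. X y $ i) has_derivative (\<lambda>w. X' w $ i)) (at x)" for i
    using bounded_linear.has_derivative[OF bounded_linear_vec_nth X] .
  have "((\<lambda>y. \<Sum>i\<in>UNIV. (X y $ i) *\<^sub>R l y (axis i 1)) has_derivative
      (\<lambda>w. \<Sum>i\<in>UNIV. (X x $ i) *\<^sub>R l' w (axis i 1) + (X' w $ i) *\<^sub>R l x (axis i 1))) (at x)"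
    by (intro has_derivative_sum has_derivative_scaleR Xi l')
  also have "(\<lambda>w. \<Sum>i\<in>UNIV. (X x $ i) *\<^sub>R l' w (axis i 1) + (X' w $ i) *\<^sub>R l x (axis i 1)) =
      (\<lambda>w. l' w (X x) + l x (X' w))"
    by (simp add: sum.distrib flip: linear_axis_expansion[OF lin[OF S(2)]]
        linear_axis_expansion[OF linear_field_derivative[OF S lin l']])
  finally show ?thesis
    by (rule has_derivative_transform_within_open[OF _ S]) (simp flip: linear_axis_expansion[OF lin])
qed

context
  fixes b :: "'a::real_normed_vector \<Rightarrow> real ^ 'n \<Rightarrow> real ^ 'm \<Rightarrow> real" and S x b'
  assumes S: "open S" "x \<in> S" and bil: "\<And>y. y \<in> S \<Longrightarrow> bilinear (b y)"
    and b': "\<And>u v. ((\<lambda>y. b y u v) has_derivative (\<lambda>w. b' w u v)) (at x)"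
begin

lemma bilinear_field_linear:
  "y \<in> S \<Longrightarrow> linear (\<lambda>u. b y u v)" "y \<in> S \<Longrightarrow> linear (\<lambda>v. b y u v)"
  using bil by (auto simp: bilinear_def)

lemma bilinear_field_derivative: "bilinear (b' w)"
  unfolding bilinear_def
proof (intro conjI allI)
  show "linear (\<lambda>v. b' w u v)" for u
    by (rule linear_field_derivative[OF S bilinear_field_linear(2) b'])
  show "linear (\<lambda>u. b' w u v)" for v
    by (rule linear_field_derivative[OF S bilinear_field_linear(1) b'])
qed

lemma has_derivative_bilinear_field:
  assumes X: "(X has_derivative X') (at x)" and Y: "(Y has_derivative Y') (at x)"
  shows "((\<lambda>y. b y (X y) (Y y)) has_derivative
    (\<lambda>w. b' w (X x) (Y x) + b x (X' w) (Y x) + b x (X x) (Y' w))) (at x)"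
proof -
  have "((\<lambda>y. b y (X y) v) has_derivative (\<lambda>w. b' w (X x) v + b x (X' w) v)) (at x)" for v
    by (rule has_derivative_linear_field[OF S bilinear_field_linear(1) b' X])
  from has_derivative_linear_field[OF S bilinear_field_linear(2) this Y] show ?thesis .
qed

end

context
  fixes t :: "'a::real_normed_vector \<Rightarrow> real ^ 'n \<Rightarrow> real ^ 'n \<Rightarrow> real ^ 'n \<Rightarrow> real" and S x t'
  assumes S: "open S" "x \<in> S" and tri: "\<And>y. y \<in> S \<Longrightarrow> trilinear (t y)"
    and t': "\<And>u v z. ((\<lambda>y. t y u v z) has_derivative (\<lambda>w. t' w u v z)) (at x)"
begin

lemma trilinear_field_derivative: "trilinear (t' w)"
  unfolding trilinear_def
proof (intro conjI allI)
  show "linear (\<lambda>u. t' w u v z)" for v z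
    by (rule linear_field_derivative[OF S trilinear_linear(1)[OF tri] t'])
  show "linear (\<lambda>v. t' w u v z)" for u z
    by (rule linear_field_derivative[OF S trilinear_linear(2)[OF tri] t'])
  show "linear (\<lambda>z. t' w u v z)" for u v
    by (rule linear_field_derivative[OF S trilinear_linear(3)[OF tri] t'])
qed

lemma has_derivative_trilinear_field:
  assumes X: "(X has_derivative X') (at x)" and Y: "(Y has_derivative Y') (at x)"
    and Z: "(Z has_derivative Z') (at x)"
  shows "((\<lambda>y. t y (X y) (Y y) (Z y)) has_derivative
    (\<lambda>w. t' w (X x) (Y x) (Z x) + t x (X' w) (Y x) (Z x) + t x (X x) (Y' w) (Z x) + t x (X x) (Y x) (Z' w))) (at x)"
proof -
  have "((\<lambda>y. t y (X y) v z) has_derivative (\<lambda>w. t' w (X x) v z + t x (X' w) v z)) (at x)" for v z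
    by (rule has_derivative_linear_field[OF S trilinear_linear(1)[OF tri] t' X])
  from has_derivative_linear_field[OF S trilinear_linear(2)[OF tri] this Y]
  have "((\<lambda>y. t y (X y) (Y y) z) has_derivative
      (\<lambda>w. t' w (X x) (Y x) z + t x (X' w) (Y x) z + t x (X x) (Y' w) z)) (at x)" for z .
  from has_derivative_linear_field[OF S trilinear_linear(3)[OF tri] this Z] show ?thesis .
qed

end

section \<open>Differentiability of solutions of linear systems\<close>

lemma differentiable_prod [derivative_intros]:
  fixes f :: "'i \<Rightarrow> 'a::real_normed_vector \<Rightarrow> real"
  assumes "\<And>i. i \<in> I \<Longrightarrow> f i differentiable (at x)"
  shows "(\<lambda>x. \<Prod>i\<in>I. f i x) differentiable (at x)"
  using assms by (induction I rule: infinite_finite_induct) (auto intro!: differentiable_mult)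

lemma differentiable_det:
  fixes m :: "'a::real_normed_vector \<Rightarrow> real ^ 'n ^ 'n"
  assumes "\<And>i j. (\<lambda>x. m x $ i $ j) differentiable (at x)"
  shows "(\<lambda>x. det (m x)) differentiable (at x)"
  unfolding det_def
  by (intro differentiable_sum differentiable_mult differentiable_prod differentiable_const assms ballI)
    (auto intro: finite_permutations)

lemma differentiable_vec:
  fixes f :: "'a::real_normed_vector \<Rightarrow> real ^ 'n"
  assumes "\<And>k. (\<lambda>y. f y $ k) differentiable (at x)"
  shows "f differentiable (at x)"
proof -
  have "(\<lambda>y. \<Sum>k\<in>UNIV. (f y $ k) *\<^sub>R (axis k 1 :: real ^ 'n)) differentiable (at x)"
    using assms by (intro differentiable_sum differentiable_scaleR differentiable_const finite ballI) auto
  then show ?thesis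
    by (simp add: basis_expansion flip: scalar_mult_eq_scaleR)
qed

text \<open>By Cramer's rule.\<close>

lemma differentiable_riesz:
  fixes G :: "'a::real_normed_vector \<Rightarrow> real ^ 'n \<Rightarrow> real ^ 'n \<Rightarrow> real"
  assumes S: "open S" "x \<in> S" and G: "\<And>y. y \<in> S \<Longrightarrow> inner_form (G y)"
    and dG: "\<And>u v. (\<lambda>y. G y u v) differentiable (at x)"
    and db: "\<And>z. (\<lambda>y. b y z) differentiable (at x)"
    and eq: "\<And>y z. y \<in> S \<Longrightarrow> G y (v y) z = b y z"
  shows "v differentiable (at x)"
proof -
  define m where "m = (\<lambda>y. \<chi> i j. G y (axis j 1) (axis i 1))"
  define r where "r = (\<lambda>y. (\<chi> i. b y (axis i 1)) :: real ^ 'n)"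
  have mv: "m y *v u = (\<chi> i. G y u (axis i 1))" if "y \<in> S" for y u
  proof -
    interpret inner_form "G y" using G[OF that] .
    have "linear (\<lambda>u. G y u z)" for z
      using bil by (simp add: bilinear_def)
    then show ?thesis
      by (simp add: m_def matrix_vector_mult_def vec_eq_iff linear_axis_expansion[of "\<lambda>u. G y u _" u] mult.commute)
  qed
  have det: "det (m y) \<noteq> 0" if "y \<in> S" for y
  proof -
    interpret inner_form "G y" using G[OF that] .
    have "u = 0" if "m y *v u = 0" for u
    proof (rule nondegenerate)
      fix z
      have "linear (G y u)" using bil by (simp add: bilinear_def)
      moreover have "G y u (axis i 1) = 0" for i
        using that mv[OF \<open>y \<in> S\<close>, of u] by (simp add: vec_eq_iff)
      ultimately show "G y u z = G y 0 z"
        by (simp add: linear_axis_expansion[of "G y u" z] G_simps)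
    qed
    then have "invertible (m y)"
      by (simp add: invertible_left_inverse matrix_left_invertible_ker)
    then show ?thesis by (simp add: invertible_det_nz)
  qed
  have v: "v y = (\<chi> k. det (\<chi> i j. if j = k then r y $ i else m y $ i $ j) / det (m y))" if "y \<in> S" for y
    using cramer[OF det[OF that], of "v y" "r y"] that by (simp add: mv r_def eq)
  have "(\<lambda>y. \<chi> k. det (\<chi> i j. if j = k then r y $ i else m y $ i $ j) / det (m y)) differentiable (at x)"
  proof (rule differentiable_vec)
    fix k
    have "(\<lambda>y. (\<chi> i j. if j = k then r y $ i else m y $ i $ j) $ i $ j) differentiable (at x)" for i j
      using db dG by (cases "j = k") (simp_all add: r_def m_def)
    moreover have "(\<lambda>y. m y $ i $ j) differentiable (at x)" for i j
      using dG by (simp add: m_def)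
    ultimately show "(\<lambda>y. (\<chi> k. det (\<chi> i j. if j = k then r y $ i else m y $ i $ j) / det (m y)) $ k) differentiable (at x)"
      using det[OF S(2)] by (simp add: differentiable_divide differentiable_det)
  qed
  then show ?thesis
    unfolding differentiable_def
    using has_derivative_transform_within_open[OF _ S] v by (metis (no_types, lifting))
qed

section \<open>Charts and the Levi-Civita connection\<close>

context inner_form
begin

text \<open>The difference tensor is symmetric in its first two slots and skew in its last two; six
  alternating swaps return it to itself with the opposite sign.\<close>

lemma metric_connection_unique:
  assumes sym_D: "\<And>u v. C u v = C v u" "\<And>u v. D u v = D v u"
    and eq: "\<And>u v w. G (C u v) w + G v (C u w) = G (D u v) w + G v (D u w)"
  shows "C = D"
proof (intro ext nondegenerate)
  fix u v w
  define t where "t = (\<lambda>u v w. G (C u v) w - G (D u v) w)"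
  have "t u v w = - t u w v" for u v w
    using eq[of u v w] by (simp add: t_def sym[of v])
  moreover have "t u v w = t v u w" for u v w
    by (simp add: t_def sym_D(1)[of u v] sym_D(2)[of u v])
  ultimately have "t u v w = 0"
    by (metis add.inverse_inverse equal_neg_zero)
  then show "G (C u v) w = G (D u v) w"
    by (simp add: t_def)
qed

lemma metric_connection_exists:
  assumes D: "trilinear D" "\<And>u v w. D u v w = D u w v"
  shows "\<exists>C. bilinear C \<and> (\<forall>u v. C u v = C v u) \<and> (\<forall>u v w. D u v w = G (C u v) w + G v (C u w))"
proof -
  note D_simps = trilinear_simps[OF D(1)]
  \<comment> \<open>the Koszul formula\<close>
  define k where "k = (\<lambda>u v w. (D u v w + D v u w - D w u v) / 2)"
  have lin: "linear (k u v)" for u v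
    by (rule linearI) (simp_all add: k_def D_simps algebra_simps add_divide_distrib diff_divide_distrib)
  define C where "C = (\<lambda>u v. THE x. \<forall>w. G x w = k u v w)"
  have C: "G (C u v) w = k u v w" for u v w
    unfolding C_def by (rule the_riesz[OF lin])
  have sym_C: "C u v = C v u" for u v
    by (rule nondegenerate) (simp add: C k_def, metis add.commute D(2))
  have "linear (C u)" for u
    by (rule linearI; rule nondegenerate) (simp_all add: C G_simps k_def D_simps algebra_simps add_divide_distrib diff_divide_distrib)
  then have "bilinear C"
    unfolding bilinear_def using sym_C by (metis (no_types) ext)
  moreover have "D u v w = G (C u v) w + G v (C u w)" for u v w
    using sym[of v "C u w"] D(2)[of u w v] D(2)[of v w u] D(2)[of w v u]
    by (simp add: C k_def add_divide_distrib diff_divide_distrib)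
  ultimately show ?thesis using sym_C by blast
qed

end

lemma levi_civita_eqI:
  assumes "inner_form (g c p)" "bilinear C" "\<And>u v. C u v = C v u"
    "\<And>u v w. cderiv c (\<lambda>q. g c q v w) p u = g c p (C u v) w + g c p v (C u w)"
  shows "levi_civita g c p = C"
  unfolding levi_civita_def
proof (rule the_equality)
  fix D
  assume "bilinear D \<and> (\<forall>u v. D u v = D v u) \<and>
    (\<forall>u v w. cderiv c (\<lambda>q. g c q v w) p u = g c p (D u v) w + g c p v (D u w))"
  then show "D = C"
    using assms(3,4) by (intro inner_form.metric_connection_unique[OF assms(1)]) metis+
qed (use assms in auto)

lemma has_derivative_unique_at:
  "(f has_derivative f') (at x) \<Longrightarrow> (f has_derivative g') (at x) \<Longrightarrow> f' w = g' w"
  using has_derivative_unique by metis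

lemma smooth_tensor2_bilinear:
  "smooth_tensor2 A T \<Longrightarrow> c \<in> A \<Longrightarrow> p \<in> fst c \<Longrightarrow> bilinear (T c p)"
  unfolding smooth_tensor2_def everywhere_def by blast

lemma smooth_tensor2_change:
  "smooth_tensor2 A T \<Longrightarrow> c \<in> A \<Longrightarrow> d \<in> A \<Longrightarrow> p \<in> fst c \<Longrightarrow> p \<in> fst d \<Longrightarrow>
    T c p u v = T d p (cderiv c (snd d) p u) (cderiv c (snd d) p v)"
  unfolding smooth_tensor2_def by blast

lemma smooth_tensor3_trilinear:
  "smooth_tensor3 A T \<Longrightarrow> c \<in> A \<Longrightarrow> p \<in> fst c \<Longrightarrow> trilinear (T c p)"
  unfolding smooth_tensor3_def everywhere_def by blast

lemma smooth_tensor3_change: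
  "smooth_tensor3 A T \<Longrightarrow> c \<in> A \<Longrightarrow> d \<in> A \<Longrightarrow> p \<in> fst c \<Longrightarrow> p \<in> fst d \<Longrightarrow>
    T c p u v w = T d p (cderiv c (snd d) p u) (cderiv c (snd d) p v) (cderiv c (snd d) p w)"
  unfolding smooth_tensor3_def by blast

section \<open>Derivatives of tensor components in a chart\<close>

context
  fixes M :: "'m topology" and A :: "('m, 'n::finite) chart set" and c :: "('m, 'n) chart"
  assumes M: "smooth_manifold M A" and c: "c \<in> A"
begin

lemma chart_openin: "openin M (fst c)"
  using M c by (auto simp: smooth_manifold_def)

lemma chart_homeomorphic: "homeomorphic_map (subtopology M (fst c)) (top_of_set (snd c ` fst c)) (snd c)"
  using M c by (auto simp: smooth_manifold_def)

lemma chart_image_open: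
  assumes "openin M W" "W \<subseteq> fst c"
  shows "open (snd c ` W)"
proof -
  have "openin (subtopology M (fst c)) W"
    using assms chart_openin by (auto simp: openin_open_subtopology)
  then have "openin (top_of_set (snd c ` fst c)) (snd c ` W)"
    using chart_homeomorphic homeomorphic_imp_open_map unfolding open_map_def by blast
  moreover have "open (snd c ` fst c)"
    using M c by (auto simp: smooth_manifold_def)
  ultimately show ?thesis
    by (auto simp: openin_open)
qed

lemma cinv_chart: "q \<in> fst c \<Longrightarrow> cinv c (snd c q) = q"
proof -
  have "inj_on (snd c) (topspace (subtopology M (fst c)))"
    using chart_homeomorphic homeomorphic_imp_injective_map by blast
  moreover have "topspace (subtopology M (fst c)) = fst c"
    using chart_openin openin_subset by fastforce
  ultimately show "q \<in> fst c \<Longrightarrow> cinv c (snd c q) = q"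
    by (simp add: cinv_def inv_into_f_f)
qed

lemma has_derivative_chart:
  assumes W: "openin M W" "W \<subseteq> fst c" "p \<in> W"
    and eq: "\<And>q. q \<in> W \<Longrightarrow> f q = h (snd c q)"
    and h: "(h has_derivative h') (at (snd c p))"
  shows "((f \<circ> cinv c) has_derivative h') (at (snd c p))"
  by (rule has_derivative_transform_within_open[OF h chart_image_open[OF W(1,2)]])
    (use W eq cinv_chart in auto)

lemma cderiv_eqI:
  assumes "openin M W" "W \<subseteq> fst c" "p \<in> W" "\<And>q. q \<in> W \<Longrightarrow> f q = h (snd c q)"
    "(h has_derivative h') (at (snd c p))"
  shows "cderiv c f p u = h' u"
  using frechet_derivative_at[OF has_derivative_chart[OF assms]] by (simp add: cderiv_def)

lemma has_derivative_tensor2: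
  assumes "smooth_tensor2 A T" "p \<in> fst c"
  shows "((\<lambda>x. T c (cinv c x) u v) has_derivative cderiv c (\<lambda>q. T c q u v) p) (at (snd c p))"
proof -
  have "smooth_on (snd c ` fst c) (\<lambda>x. T c (cinv c x) u v)"
    using assms(1) c unfolding smooth_tensor2_def by blast
  from smooth_on_has_derivative[OF this, of "snd c p"] show ?thesis
    using assms(2) by (simp add: cderiv_def[abs_def] o_def)
qed

lemma has_derivative_tensor3:
  assumes "smooth_tensor3 A T" "p \<in> fst c"
  shows "((\<lambda>x. T c (cinv c x) u v w) has_derivative cderiv c (\<lambda>q. T c q u v w) p) (at (snd c p))"
proof -
  have "smooth_on (snd c ` fst c) (\<lambda>x. T c (cinv c x) u v w)"
    using assms(1) c unfolding smooth_tensor3_def by blast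
  from smooth_on_has_derivative[OF this, of "snd c p"] show ?thesis
    using assms(2) by (simp add: cderiv_def[abs_def] o_def)
qed

lemma cderiv_tensor2:
  assumes T: "smooth_tensor2 A T" and p: "p \<in> fst c"
  shows "trilinear (\<lambda>w u v. cderiv c (\<lambda>q. T c q u v) p w)"
proof -
  note d = has_derivative_tensor2[OF T p]
  have S: "open (snd c ` fst c)" "snd c p \<in> snd c ` fst c"
    using chart_image_open[OF chart_openin] p by auto
  have "bilinear (T c (cinv c y))" if "y \<in> snd c ` fst c" for y
    using that smooth_tensor2_bilinear[OF T c] cinv_chart by auto
  from bilinear_field_derivative[OF S this d] show ?thesis
    using has_derivative_linear[OF d] by (simp add: trilinear_def bilinear_def)
qed

lemma cderiv_tensor3:
  assumes T: "smooth_tensor3 A T" and p: "p \<in> fst c"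
  shows "trilinear (\<lambda>u v z. cderiv c (\<lambda>q. T c q u v z) p w)"
proof -
  note d = has_derivative_tensor3[OF T p]
  have S: "open (snd c ` fst c)" "snd c p \<in> snd c ` fst c"
    using chart_image_open[OF chart_openin] p by auto
  have "trilinear (T c (cinv c y))" if "y \<in> snd c ` fst c" for y
    using that smooth_tensor3_trilinear[OF T c] cinv_chart by auto
  from trilinear_field_derivative[OF S this d] show ?thesis .
qed

lemma levi_civita:
  assumes g: "riemannian_manifold M A g" and p: "p \<in> fst c"
  shows "inner_form (g c p)" "bilinear (levi_civita g c p)"
    "levi_civita g c p u v = levi_civita g c p v u"
    "cderiv c (\<lambda>q. g c q v w) p u = g c p (levi_civita g c p u v) w + g c p v (levi_civita g c p u w)"
proof -
  have g2: "smooth_tensor2 A g" using g by (simp add: riemannian_manifold_def)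
  have form: "inner_form (g c q)" if "q \<in> fst c" for q
    using g that c unfolding riemannian_manifold_def smooth_tensor2_def everywhere_def inner_form_def by blast
  show "inner_form (g c p)" using form[OF p] .
  interpret inner_form "g c p" using form[OF p] .
  have sym_D: "cderiv c (\<lambda>q. g c q v w) p u = cderiv c (\<lambda>q. g c q w v) p u" for u v w
  proof -
    have "((\<lambda>q. g c q v w) \<circ> cinv c has_derivative cderiv c (\<lambda>q. g c q w v) p) (at (snd c p))"
      by (rule has_derivative_chart[OF chart_openin order_refl p _ has_derivative_tensor2[OF g2 p]])
        (simp add: cinv_chart inner_form.sym[OF form])
    from frechet_derivative_at[OF this] show ?thesis by (simp add: cderiv_def)
  qed
  obtain C where C: "bilinear C" "\<And>u v. C u v = C v u"
    "\<And>u v w. cderiv c (\<lambda>q. g c q v w) p u = g c p (C u v) w + g c p v (C u w)"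
    using metric_connection_exists[OF cderiv_tensor2[OF g2 p]] sym_D by metis
  have "levi_civita g c p = C"
    using form[OF p] C by (intro levi_civita_eqI[of g c p C]) auto
  then show "bilinear (levi_civita g c p)" "levi_civita g c p u v = levi_civita g c p v u"
      "cderiv c (\<lambda>q. g c q v w) p u = g c p (levi_civita g c p u v) w + g c p v (levi_civita g c p u w)"
    using C by auto
qed

end

section \<open>The intrinsic torsion of a G2-structure\<close>

text \<open>\<open>DP\<close> is the derivative of the coordinate expression of
  \<open>P a b\<close>. By the first equation of \<open>DP\<close>, its covariant part has inner
  product T(a, b, z) with \<open>z\<close>. The second is the derivative of the identity
  \<open>cross_cross\<close>, whose right side involves only the parallel metric. Once all terms
  with \<open>C\<close> cancel (those with \<open>C a\<close> by the polarized identity), what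
  remains is T(a, P(a,b), z) + T(a, b, P(z,a)) = 0.\<close>

lemma (in g2_form) parallel_cross:
  assumes dG: "\<And>u v. dG u v = G (C u) v + G u (C v)"
    and df: "\<And>u v z. df u v z = T u v z + f (C u) v z + f u (C v) z + f u v (C z)"
    and T: "\<And>u v z. T u v (- z) = - T u v z"
    and DP: "\<And>z. dG (P a b) z + G DP z = df a b z"
      "\<And>z. df a (P a b) z + f a DP z = dG a b * G a z + G a b * dG a z - dG a a * G b z - G a a * dG b z"
  shows "T a (P a b) z = T a b (P a z)"
proof -
  have fP: "f x (P y b) z = f y b (P z x)" for x y z b
    using f_rot[of x "P y b" z] sym[of "P z x" "P y b"] by (simp add: cross_inner)
  have cc: "f a (P a b) z = G a b * G a z - G a a * G b z" for b z
    unfolding cross_inner[symmetric, of a "P a b"] cross_cross by (simp add: G_simps)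
  have ccp: "f (C a) (P a b) z + f a (P (C a) b) z = G (C a) b * G a z + G a b * G (C a) z - 2 * G (C a) a * G b z"
    using arg_cong[where f="\<lambda>x. G x z", OF cross_cross_polar[of "C a" a b]]
    by (simp add: G_simps cross_inner)
  have 1: "f a DP z = G DP (P z a)"
    using f_rot[of a DP z] sym[of DP "P z a"] by (simp add: cross_inner)
  have 2: "f a (C (P a b)) z = G (C (P a b)) (P z a)"
    using f_rot[of a "C (P a b)" z] sym[of "C (P a b)" "P z a"] by (simp add: cross_inner)
  have 3: "G (P a b) (C (P z a)) = f a b (C (P z a))"
    by (simp add: cross_inner)
  have 4: "T a b (P z a) = - T a b (P a z)"
    by (simp add: T cross_skew[of z a])
  show ?thesis
    using DP(1)[of "P z a"] DP(2)[of z] 1 2 3 4 ccp fP[of a "C a" b z] fP[of a a "C b" z] cc[of "C b" z]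
      cc[of b "C z"] sym[of a "C a"]
    unfolding dG df by (simp add: algebra_simps)
qed

context
  fixes M :: "'m topology" and A :: "('m, 7) chart set" and g \<phi>
  assumes riem: "riemannian_manifold M A g" and g2: "g2_structure M A g \<phi>"
begin

text \<open>A Cayley frame is given only in some chart around each point. It is moved to the chart
  \<open>d\<close> by the inverse of the tangent map of the change of charts, which is injective
  because it preserves a definite form.\<close>

lemma g2_structure_form:
  assumes d: "d \<in> A" "q \<in> fst d"
  shows "g2_form (g d q) (\<phi> d q)"
proof -
  have M: "smooth_manifold M A" and gt: "smooth_tensor2 A g" and pt: "smooth_tensor3 A \<phi>"
    using riem g2 by (auto simp: riemannian_manifold_def g2_structure_def)
  interpret inner_form "g d q" by (rule levi_civita(1)[OF M d(1) riem d(2)])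
  have "q \<in> topspace M"
    using M d by (auto simp: smooth_manifold_def)
  then obtain c E where c: "c \<in> A" "q \<in> fst c" and E: "cayley_frame (g c q) (\<phi> c q) E"
    using g2 unfolding g2_structure_def by (metis subsetD)
  interpret c: inner_form "g c q" by (rule levi_civita(1)[OF M c(1) riem c(2)])
  define D where "D = cderiv d (snd c) q"
  have g_eq: "g d q u v = g c q (D u) (D v)" for u v
    using smooth_tensor2_change[OF gt d(1) c(1) d(2) c(2)] by (simp add: D_def)
  have phi_eq: "\<phi> d q u v w = \<phi> c q (D u) (D v) (D w)" for u v w
    using smooth_tensor3_change[OF pt d(1) c(1) d(2) c(2)] by (simp add: D_def)
  have "smooth_on (snd d ` (fst d \<inter> fst c)) (snd c \<circ> cinv d)"
    using M c d by (auto simp: smooth_manifold_def)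
  then have "(snd c \<circ> cinv d) differentiable (at (snd d q))"
    using c d by (intro smooth_on_differentiable) auto
  from linear_frechet_derivative[OF this] have lin: "linear D"
    by (simp add: D_def cderiv_def[abs_def])
  have "inj D"
    unfolding linear_injective_0[OF lin]
  proof (intro allI impI)
    fix u assume "D u = 0"
    then have "g d q u u = 0" by (simp add: g_eq c.G_simps)
    then show "u = 0" using pos[of u] by (cases "u = 0") auto
  qed
  then have "surj D"
    using lin linear_injective_imp_surjective by blast
  define E' where "E' = (\<lambda>i. inv D (E i))"
  have E': "D (E' i) = E i" for i
    using \<open>surj D\<close> by (simp add: E'_def surj_f_inv_f)
  have "cayley_frame (g d q) (\<phi> d q) E'"
    using E by (simp add: cayley_frame_def orthonormal_frame_def g_eq phi_eq E' wedge3_def)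
  then show ?thesis
    by unfold_locales blast
qed

text \<open>The derivative of \<phi> satisfies the relation of \<open>cross_variation\<close>, which
  yields \<open>\<rho>\<close>; pairing with the four-form through \<open>star_inner\<close>
  identifies \<open>\<rho>\<close> as the dual of \<open>rbar\<close>.\<close>

lemma g2_torsion:
  assumes c: "c \<in> A" and p: "p \<in> fst c"
  shows "\<exists>\<rho>. (\<forall>x y z. cov3 (levi_civita g c p) \<phi> c p w x y z = star_form (g c p) (\<phi> c p) \<rho> x y z) \<and>
    (\<forall>v. g c p \<rho> v = rbar g \<phi> c p w v)"
proof -
  have M: "smooth_manifold M A" and gt: "smooth_tensor2 A g" and pt: "smooth_tensor3 A \<phi>"
    using riem g2 by (auto simp: riemannian_manifold_def g2_structure_def)
  note form = g2_structure_form[OF c]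
  interpret g2_form "g c p" "\<phi> c p" using form[OF p] .
  let ?g = "\<lambda>x. g c (cinv c x)" and ?f = "\<lambda>x. \<phi> c (cinv c x)"
  let ?g' = "\<lambda>u v. cderiv c (\<lambda>q. g c q u v) p" and ?f' = "\<lambda>u v z. cderiv c (\<lambda>q. \<phi> c q u v z) p"
  define C where "C = levi_civita g c p w"
  define dG where "dG = (\<lambda>u v. ?g' u v w)"
  define df where "df = (\<lambda>u v z. ?f' u v z w)"
  define T where "T = cov3 (levi_civita g c p) \<phi> c p w"
  have T: "T u v z = df u v z - \<phi> c p (C u) v z - \<phi> c p u (C v) z - \<phi> c p u v (C z)" for u v z
    by (simp add: T_def cov3_def df_def C_def)
  note LC = levi_civita[OF M c riem p]
  have C: "linear C" using LC(2) by (simp add: C_def bilinear_def)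
  have dG: "dG u v = g c p (C u) v + g c p u (C v)" for u v
    by (simp add: dG_def C_def LC(4))
  note tri_df = cderiv_tensor3[OF M c pt p, of w, folded df_def]
  note df_simps = trilinear_simps[OF tri_df]
  note C_simps = linear_add[OF C] linear_cmul[OF C] linear_neg[OF C]
  have tri: "trilinear T"
    by (auto simp: trilinear_def T df_simps f_simps C_simps algebra_simps intro!: linearI)
  define x0 where "x0 = snd c p"
  define S where "S = snd c ` fst c"
  have S: "open S" "x0 \<in> S"
    using chart_image_open[OF M c chart_openin[OF M c]] p by (auto simp: S_def x0_def)
  have dg: "((\<lambda>x. ?g x u v) has_derivative (\<lambda>w. ?g' u v w)) (at x0)" for u v
    unfolding x0_def by (rule has_derivative_tensor2[OF M c gt p])
  have dphi: "((\<lambda>x. ?f x u v z) has_derivative (\<lambda>w. ?f' u v z w)) (at x0)" for u v z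
    unfolding x0_def by (rule has_derivative_tensor3[OF M c pt p])
  have formS: "g2_form (?g x) (?f x)" if "x \<in> S" for x
    using that form cinv_chart[OF M c] by (auto simp: S_def)
  have cx0: "cinv c x0 = p"
    using cinv_chart[OF M c] p by (simp add: x0_def)
  have skew_df: "df v u z = - df u v z" "df u z v = - df u v z" for u v z
  proof -
    have "((\<lambda>x. ?f x v u z) has_derivative (\<lambda>w. - ?f' u v z w)) (at x0)"
      by (rule has_derivative_transform_within_open[OF has_derivative_minus[OF dphi] S])
        (metis formS g2_form.f_skew(1))
    from has_derivative_unique[OF this dphi] show "df v u z = - df u v z"
      unfolding df_def by metis
    have "((\<lambda>x. ?f x u z v) has_derivative (\<lambda>w. - ?f' u v z w)) (at x0)"
      by (rule has_derivative_transform_within_open[OF has_derivative_minus[OF dphi] S])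
        (metis formS g2_form.f_skew(2))
    from has_derivative_unique[OF this dphi] show "df u z v = - df u v z"
      unfolding df_def by metis
  qed
  have skew: "T v u z = - T u v z" "T u z v = - T u v z" for u v z
    using skew_df[of v u z] f_skew(1)[of v "C u" z] f_skew(1)[of "C v" u z] f_skew(1)[of v u "C z"]
      skew_df(2)[of u z v] f_skew(2)[of "C u" z v] f_skew(2)[of u z "C v"] f_skew(2)[of u "C z" v]
    unfolding T by linarith+
  have rel: "T a (P a b) z = T a b (P a z)" for a b z
  proof -
    define v where "v = (\<lambda>x. cross (?g x) (?f x) a b)"
    have v0: "v x0 = P a b" by (simp add: v_def cx0)
    have v_eq: "?g x (v x) z = ?f x a b z" if "x \<in> S" for x z
      using g2_form.cross_inner[OF formS[OF that]] by (simp add: v_def)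
    have inner: "inner_form (?g x)" if "x \<in> S" for x
      using formS[OF that] by (simp add: g2_form_def)
    \<comment> \<open>The cross product of two constant fields solves a linear system whose matrix
      is the metric and whose right side is a component of \<phi>.\<close>
    have "v differentiable (at x0)"
      by (rule differentiable_riesz[OF S inner differentiableI[OF dg] differentiableI[OF dphi] v_eq])
    then have dv: "(v has_derivative frechet_derivative v (at x0)) (at x0)"
      by (simp add: frechet_derivative_works)
    define DP where "DP = frechet_derivative v (at x0) w"
    have lin_g: "linear (\<lambda>u. ?g x u z)" if "x \<in> S" for x z
      using inner[OF that] by (simp add: inner_form_def bilinear_def)
    have lin_f: "linear (\<lambda>u. ?f x a u z)" if "x \<in> S" for x z
      using trilinear_linear(2)[OF g2_form.trilinear_f[OF formS[OF that]]] .
    have "((\<lambda>x. ?g x (v x) z) has_derivative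
        (\<lambda>w. ?g' (v x0) z w + g c (cinv c x0) (frechet_derivative v (at x0) w) z)) (at x0)" for z
      by (rule has_derivative_linear_field[OF S lin_g dg dv])
    then have "((\<lambda>x. ?f x a b z) has_derivative
        (\<lambda>w. ?g' (v x0) z w + g c (cinv c x0) (frechet_derivative v (at x0) w) z)) (at x0)" for z
      by (rule has_derivative_transform_within_open[OF _ S]) (rule v_eq)
    from has_derivative_unique_at[OF this dphi]
    have "?g' (v x0) z w + g c (cinv c x0) DP z = ?f' a b z w" for z
      unfolding DP_def by this
    then have 1: "dG (P a b) z + g c p DP z = df a b z" for z
      by (simp add: dG_def df_def v0 cx0)
    have "((\<lambda>x. ?f x a (v x) z) has_derivative
        (\<lambda>w. ?f' a (v x0) z w + \<phi> c (cinv c x0) a (frechet_derivative v (at x0) w) z)) (at x0)" for z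
      by (rule has_derivative_linear_field[OF S lin_f dphi dv])
    moreover have "?f x a (v x) z = ?g x a b * ?g x a z - ?g x a a * ?g x b z"
      if "x \<in> S" for x z
    proof -
      interpret x: g2_form "?g x" "?f x" using formS[OF that] .
      show ?thesis
        unfolding v_def x.cross_inner[symmetric, of a "x.P a b"] x.cross_cross by (simp add: x.G_simps)
    qed
    ultimately have 3: "((\<lambda>x. ?g x a b * ?g x a z - ?g x a a * ?g x b z) has_derivative
        (\<lambda>w. ?f' a (v x0) z w + \<phi> c (cinv c x0) a (frechet_derivative v (at x0) w) z)) (at x0)" for z
      by (rule has_derivative_transform_within_open[OF _ S])
    have 4: "((\<lambda>x. ?g x a b * ?g x a z - ?g x a a * ?g x b z) has_derivative
        (\<lambda>w. (g c p a b * ?g' a z w + ?g' a b w * g c p a z)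
          - (g c p a a * ?g' b z w + ?g' a a w * g c p b z))) (at x0)" for z
      using has_derivative_diff[OF has_derivative_mult[OF dg dg] has_derivative_mult[OF dg dg]]
      by (simp add: cx0)
    from has_derivative_unique_at[OF 3 4]
    have "?f' a (v x0) z w + \<phi> c (cinv c x0) a DP z =
        (g c p a b * ?g' a z w + ?g' a b w * g c p a z)
          - (g c p a a * ?g' b z w + ?g' a a w * g c p b z)" for z
      unfolding DP_def by this
    then have 2: "df a (P a b) z + \<phi> c p a DP z =
        dG a b * g c p a z + g c p a b * dG a z - dG a a * g c p b z - g c p a a * dG b z" for z
      by (simp add: dG_def df_def v0 cx0)
    show ?thesis
      by (rule parallel_cross[of dG C df T a b DP z, OF dG _ trilinear_simps(9)[OF tri] 1 2]) (simp add: T)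
  qed
  obtain \<rho> where \<rho>: "\<And>x y z. T x y z = Q \<rho> x y z"
    using cross_variation[OF tri skew rel] by blast
  have T_eq: "T = Q \<rho>" by (intro ext) (rule \<rho>)
  have "g c p \<rho> v = rbar g \<phi> c p w v" for v
    using star_inner[of \<rho> v] unfolding T_eq[symmetric] by (simp add: rbar_def T_def)
  then show ?thesis
    using \<rho> by (auto simp: T_def)
qed

end

section \<open>Hypersurfaces\<close>

text \<open>The image of \<open>i\<close> and \<open>n\<close> together span a space of dimension 6
  + 1 = 7, and orthogonality to \<open>n\<close> kills the normal coefficient.\<close>

lemma normal_complement:
  fixes i :: "real ^ 6 \<Rightarrow> real ^ 7"
  assumes G: "inner_form G" and i: "linear i" "inj i"
    and n: "\<And>u. G (i u) n = 0" "G n n = 1" and v: "G v n = 0"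
  shows "\<exists>u. i u = v"
proof -
  interpret inner_form G by (rule G)
  have "dim (range i) = 6"
    using dim_image_eq[of i UNIV] i by simp
  moreover have span: "span (range i) = range i"
    using i(1) by (simp add: linear_subspace_image span_eq_iff)
  moreover have "n \<notin> span (range i)"
    unfolding span using n by auto
  ultimately have "dim (insert n (range i)) = 7"
    by (simp only: dim_insert if_False)
  moreover have "dim (insert v (insert n (range i))) \<le> 7"
    using dim_subset_UNIV[of "insert v (insert n (range i))"] by simp
  ultimately have "v \<in> span (insert n (range i))"
    by (auto simp: dim_insert split: if_splits)
  then obtain k where "v - k *\<^sub>R n \<in> range i"
    using span by (auto simp: span_insert)
  then obtain u where u: "i u = v - k *\<^sub>R n" by (metis imageE)
  have "G (i u) n = - k"
    unfolding u by (simp add: G_simps v n)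
  then have "k = 0" using n by simp
  then show ?thesis using u by auto
qed

locale g2_hypersurface =
  fixes Mb :: "'b topology" and Ab :: "('b, 7) chart set"
    and g :: "('b, 7) tensor2" and \<phi> :: "('b, 7) tensor3"
    and M :: "'a topology" and A :: "('a, 6) chart set"
    and \<iota> :: "'a \<Rightarrow> 'b" and n :: "('b, 7) chart \<Rightarrow> 'a \<Rightarrow> real ^ 7"
  assumes riem: "riemannian_manifold Mb Ab g" and g2: "g2_structure Mb Ab g \<phi>"
    and hyp: "hypersurface Mb Ab M A \<iota>" and nor: "unit_normal Ab g A \<iota> n"
begin

abbreviation "J \<equiv> induced_I Ab g \<phi> \<iota> n"
abbreviation "gM \<equiv> pull2 Ab \<iota> g"
abbreviation "Phi \<equiv> pull3 Ab \<iota> \<phi>"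
abbreviation "II \<equiv> second_form Ab g \<iota> n"
abbreviation "r\<^sub>M \<equiv> pull2 Ab \<iota> (rbar g \<phi>)"
abbreviation "r\<^sub>n \<equiv> normal_part Ab \<iota> n (rbar g \<phi>)"
abbreviation "psi_p \<theta> \<equiv> induced_psi_plus Ab g \<phi> \<iota> n \<theta>"
abbreviation "psi_m \<theta> \<equiv> induced_psi_minus Ab g \<phi> \<iota> n \<theta>"

lemma manifold: "smooth_manifold M A" "smooth_manifold Mb Ab" "smooth_tensor2 Ab g" "smooth_tensor3 Ab \<phi>"
  using riem g2 hyp by (auto simp: riemannian_manifold_def g2_structure_def hypersurface_def)

lemma chart_at:
  assumes "a \<in> A" "q \<in> fst a"
  shows "chart_at Ab (\<iota> q) \<in> Ab" "\<iota> q \<in> fst (chart_at Ab (\<iota> q))"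
proof -
  have "q \<in> topspace M"
    using manifold(1) assms by (auto simp: smooth_manifold_def)
  then have "\<iota> q \<in> topspace Mb"
    using hyp by (auto simp: hypersurface_def continuous_map_def)
  moreover have "(\<Union>c\<in>Ab. fst c) = topspace Mb"
    using manifold(2) by (simp add: smooth_manifold_def)
  ultimately have "\<exists>c. c \<in> Ab \<and> \<iota> q \<in> fst c"
    by blast
  from someI_ex[OF this] show "chart_at Ab (\<iota> q) \<in> Ab" "\<iota> q \<in> fst (chart_at Ab (\<iota> q))"
    by (simp_all add: chart_at_def)
qed

lemma preimage_openin:
  assumes "a \<in> A" "c \<in> Ab"
  shows "openin M (fst a \<inter> \<iota> -` fst c)"
proof -
  have "openin M {x \<in> topspace M. \<iota> x \<in> fst c}"
    using hyp chart_openin[OF manifold(2) assms(2)] by (auto simp: hypersurface_def continuous_map_def)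
  then have "openin M (fst a \<inter> {x \<in> topspace M. \<iota> x \<in> fst c})"
    using chart_openin[OF manifold(1) assms(1)] by blast
  moreover have "fst a \<inter> {x \<in> topspace M. \<iota> x \<in> fst c} = fst a \<inter> \<iota> -` fst c"
    using openin_subset[OF chart_openin[OF manifold(1) assms(1)]] by auto
  ultimately show ?thesis by simp
qed

context
  fixes a c q
  assumes a: "a \<in> A" and c: "c \<in> Ab" and q: "q \<in> fst a" "\<iota> q \<in> fst c"
begin

lemma has_derivative_immersion:
  "((\<lambda>y. snd c (\<iota> (cinv a y))) has_derivative push (snd c) \<iota> a q) (at (snd a q))"
proof -
  have "smooth_on (snd a ` (fst a \<inter> \<iota> -` fst c)) (snd c \<circ> \<iota> \<circ> cinv a)"
    using hyp a c by (auto simp: hypersurface_def)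
  from smooth_on_has_derivative[OF this, of "snd a q"] q show ?thesis
    by (auto simp: push_def[abs_def] cderiv_def[abs_def] o_def)
qed

lemma linear_push: "linear (push (snd c) \<iota> a q)"
  using has_derivative_linear[OF has_derivative_immersion] .

lemma inj_push: "inj (push (snd c) \<iota> a q)"
  using hyp a c q by (auto simp: hypersurface_def)

lemma normal: "g c (\<iota> q) (n c q) (n c q) = 1" "g c (\<iota> q) (push (snd c) \<iota> a q u) (n c q) = 0"
  using nor a c q unfolding unit_normal_def by blast+

lemma ambient_form: "g2_form (g c (\<iota> q)) (\<phi> c (\<iota> q))"
  by (rule g2_structure_form[OF riem g2 c q(2)])

lemma push_change:
  assumes d: "d \<in> Ab" "\<iota> q \<in> fst d"
  shows "push (snd d) \<iota> a q u = cderiv c (snd d) (\<iota> q) (push (snd c) \<iota> a q u)"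
proof -
  let ?W = "fst a \<inter> \<iota> -` fst c \<inter> (fst a \<inter> \<iota> -` fst d)"
  let ?h = "\<lambda>y. (snd d \<circ> cinv c) (snd c (\<iota> (cinv a y)))"
  note ia = cinv_chart[OF manifold(1) a] and ic = cinv_chart[OF manifold(2) c]
  have W: "openin M ?W"
    by (intro openin_Int preimage_openin a c d)
  have "smooth_on (snd c ` (fst c \<inter> fst d)) (snd d \<circ> cinv c)"
    using manifold(2) c d by (auto simp: smooth_manifold_def)
  then have "((snd d \<circ> cinv c) has_derivative cderiv c (snd d) (\<iota> q)) (at (snd c (\<iota> q)))"
    using q d unfolding cderiv_def[abs_def] by (intro smooth_on_has_derivative) auto
  then have "(?h has_derivative (\<lambda>u. cderiv c (snd d) (\<iota> q) (push (snd c) \<iota> a q u))) (at (snd a q))"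
    by (intro has_derivative_compose[OF has_derivative_immersion]) (simp add: ia q o_def)
  then have "cderiv a (snd d \<circ> \<iota>) q u = cderiv c (snd d) (\<iota> q) (push (snd c) \<iota> a q u)"
    by (rule cderiv_eqI[OF manifold(1) a W, rotated 3]) (use q d in \<open>auto simp: ia ic\<close>)
  then show ?thesis by (simp add: push_def)
qed

text \<open>The chart \<open>chart_at Ab (\<iota> q)\<close> may jump as \<open>q\<close> moves. In
  a fixed chart \<open>c\<close> the pull-back becomes an expression that can be
  differentiated.\<close>

lemma pull2_eq:
  assumes T: "smooth_tensor2 Ab T"
  shows "pull2 Ab \<iota> T a q u v = T c (\<iota> q) (push (snd c) \<iota> a q u) (push (snd c) \<iota> a q v)"
  using smooth_tensor2_change[OF T c chart_at(1)[OF a q(1)] q(2) chart_at(2)[OF a q(1)]]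
    push_change[OF chart_at[OF a q(1)]]
  by (simp add: pull2_def Let_def)

lemma pull3_eq:
  assumes T: "smooth_tensor3 Ab T"
  shows "pull3 Ab \<iota> T a q u v w =
    T c (\<iota> q) (push (snd c) \<iota> a q u) (push (snd c) \<iota> a q v) (push (snd c) \<iota> a q w)"
  using smooth_tensor3_change[OF T c chart_at(1)[OF a q(1)] q(2) chart_at(2)[OF a q(1)]]
    push_change[OF chart_at[OF a q(1)]]
  by (simp add: pull3_def Let_def)

lemma normal_change:
  "d \<in> Ab \<Longrightarrow> \<iota> q \<in> fst d \<Longrightarrow> n d q = cderiv c (snd d) (\<iota> q) (n c q)"
  using nor a c q unfolding unit_normal_def by blast

end

context
  fixes a q
  assumes a: "a \<in> A" and q: "q \<in> fst a"
begin

text \<open>The description of \<open>I\<close> is proper: the cross product of \<open>n\<close>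
  with a tangent vector is orthogonal to \<open>n\<close>, hence tangent, and the immersion is
  injective on tangent vectors.\<close>

lemma push_induced_I:
  fixes c defines "c \<equiv> chart_at Ab (\<iota> q)"
  shows "push (snd c) \<iota> a q (J a q u) = cross (g c (\<iota> q)) (\<phi> c (\<iota> q)) (n c q) (push (snd c) \<iota> a q u)"
proof -
  have c: "c \<in> Ab" "\<iota> q \<in> fst c" using chart_at[OF a q] by (simp_all add: c_def)
  interpret g2_form "g c (\<iota> q)" "\<phi> c (\<iota> q)" by (rule ambient_form[OF a c(1) q c(2)])
  let ?i = "push (snd c) \<iota> a q"
  have "\<exists>v. ?i v = P (n c q) (?i u)"
    by (rule normal_complement[OF inner_form_axioms linear_push[OF a c(1) q c(2)] inj_push[OF a c(1) q c(2)]
          normal(2)[OF a c(1) q c(2)] normal(1)[OF a c(1) q c(2)]])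
      (simp add: cross_inner f_same)
  then have "\<exists>!v. ?i v = P (n c q) (?i u)"
    using inj_push[OF a c(1) q c(2)] by (metis injD)
  from theI'[OF this] show ?thesis
    by (simp add: induced_I_def c_def Let_def)
qed

text \<open>A form of the definition of \<open>I\<close> that is valid in any ambient chart. It is a
  linear system for \<open>J a q u\<close> with differentiable coefficients, from which
  \<open>I\<close> will be differentiated.\<close>

lemma induced_I_metric:
  assumes c: "c \<in> Ab" "\<iota> q \<in> fst c"
  shows "g c (\<iota> q) (push (snd c) \<iota> a q (J a q u)) (push (snd c) \<iota> a q v) =
    \<phi> c (\<iota> q) (n c q) (push (snd c) \<iota> a q u) (push (snd c) \<iota> a q v)"
proof -
  define d where "d = chart_at Ab (\<iota> q)"
  have d: "d \<in> Ab" "\<iota> q \<in> fst d" using chart_at[OF a q] by (simp_all add: d_def)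
  interpret g2_form "g d (\<iota> q)" "\<phi> d (\<iota> q)" by (rule ambient_form[OF a d(1) q d(2)])
  have "g d (\<iota> q) (push (snd d) \<iota> a q (J a q u)) (push (snd d) \<iota> a q v) =
      \<phi> d (\<iota> q) (n d q) (push (snd d) \<iota> a q u) (push (snd d) \<iota> a q v)"
    using push_induced_I[of u] by (simp add: d_def[symmetric] cross_inner)
  then show ?thesis
    using smooth_tensor2_change[OF manifold(3) c(1) d(1) c(2) d(2)]
      smooth_tensor3_change[OF manifold(4) c(1) d(1) c(2) d(2)]
      push_change[OF a c(1) q c(2) d] normal_change[OF a c(1) q c(2) d]
    by simp
qed

text \<open>In \<open>star_eq\<close> the metric terms vanish because \<open>n\<close> is orthogonal
  to tangent vectors. What remains involves only \<phi> and \<open>I\<close>, so derivatives of the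
  four-form are avoided.\<close>

lemma pull_n_star_eq: "pull_n_star Ab g \<phi> \<iota> n a q u v w = - Phi a q (J a q u) v w"
proof -
  define c where "c = chart_at Ab (\<iota> q)"
  have c: "c \<in> Ab" "\<iota> q \<in> fst c" using chart_at[OF a q] by (simp_all add: c_def)
  interpret g2_form "g c (\<iota> q)" "\<phi> c (\<iota> q)" by (rule ambient_form[OF a c(1) q c(2)])
  let ?i = "push (snd c) \<iota> a q"
  have "g c (\<iota> q) (P (n c q) (?i u)) (P (?i v) (?i w)) = \<phi> c (\<iota> q) (?i (J a q u)) (?i v) (?i w)"
    using push_induced_I[of u] sym[of "?i (J a q u)" "P (?i v) (?i w)"] f_rot[of "?i v" "?i w" "?i (J a q u)"]
    by (simp add: c_def[symmetric] cross_inner)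
  then show ?thesis
    using normal(2)[OF a c(1) q c(2)] sym[of "n c q"]
    by (simp add: pull_n_star_def pull3_def Let_def c_def[symmetric] star_eq)
qed

end

end

section \<open>Gauss and Weingarten formulas at a fixed point\<close>

locale g2_hypersurface_point = g2_hypersurface Mb Ab g \<phi> M A \<iota> n
  for Mb :: "'b topology" and Ab g \<phi> and M :: "'a topology" and A \<iota> n +
  fixes a p
  assumes a: "a \<in> A" and p: "p \<in> fst a"
begin

definition "c = chart_at Ab (\<iota> p)"
definition "U = fst a \<inter> \<iota> -` fst c"
abbreviation "i \<equiv> push (snd c) \<iota> a"
abbreviation "gp \<equiv> g c (\<iota> p)"
abbreviation "fp \<equiv> \<phi> c (\<iota> p)"
abbreviation "gx x \<equiv> g c (\<iota> (cinv a x))"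
abbreviation "fx x \<equiv> \<phi> c (\<iota> (cinv a x))"
abbreviation "nn \<equiv> n c p"
abbreviation "Cb \<equiv> levi_civita g c (\<iota> p)"
abbreviation "Gp \<equiv> gM a p"
abbreviation "Jp \<equiv> J a p"
abbreviation "T \<equiv> cov3 Cb \<phi> c (\<iota> p)"
abbreviation "B \<equiv> II a p"
abbreviation "C \<equiv> levi_civita gM a p"

text \<open>Plain derivatives of components at \<open>p\<close>, with the ambient chart
  \<open>c\<close> held fixed. Since \<open>i q u\<close> is a first derivative of the immersion,
  \<open>H\<close> is its Hessian in coordinates.\<close>

definition "H w u = cderiv a (\<lambda>q. i q u) p w"
definition "N w = cderiv a (n c) p w"
definition "J' w u = cderiv a (\<lambda>q. J a q u) p w"

text \<open>Covariant derivatives along \<open>\<iota>\<close> of the coordinate fields of \<open>a\<close> and of the unit normal.\<close>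

definition "K w u = H w u + Cb (i p w) (i p u)"
definition "W w = N w + Cb (i p w) nn"

lemma c: "c \<in> Ab" "\<iota> p \<in> fst c"
  using chart_at[OF a p] by (simp_all add: c_def)

lemma U: "openin M U" "U \<subseteq> fst a" "p \<in> U"
  using preimage_openin[OF a c(1)] p c(2) by (auto simp: U_def)

lemma Uq: "q \<in> U \<Longrightarrow> q \<in> fst a" "q \<in> U \<Longrightarrow> \<iota> q \<in> fst c"
  by (auto simp: U_def)

definition "S = snd a ` U"
definition "x0 = snd a p"

lemma S: "open S" "x0 \<in> S"
  using chart_image_open[OF manifold(1) a U(1,2)] U(3) by (auto simp: S_def x0_def)

lemma cinv_S: "x \<in> S \<Longrightarrow> cinv a x \<in> U" "x \<in> S \<Longrightarrow> snd a (cinv a x) = x" "cinv a x0 = p"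
  using cinv_chart[OF manifold(1) a] Uq(1) U(3) by (auto simp: S_def x0_def)

sublocale g2_form gp fp
  by (rule ambient_form[OF a c(1) p c(2)])

lemmas i_linear = linear_push[OF a c(1) p c(2)]
lemmas i_simps = linear_add[OF i_linear] linear_cmul[OF i_linear] linear_neg[OF i_linear]
  linear_diff[OF i_linear] linear_0[OF i_linear]
lemmas i_inj = injD[OF inj_push[OF a c(1) p c(2)]]
lemmas LC = levi_civita[OF manifold(2) c(1) riem c(2)]
lemmas Cb_simps = bilinear_simps[OF LC(2)]

lemma n_normal: "gp nn nn = 1" "gp (i p u) nn = 0" "gp nn (i p u) = 0"
  using normal[OF a c(1) p c(2)] sym[of nn "i p u"] by simp_all

lemma tangent: "gp v nn = 0 \<Longrightarrow> \<exists>u. i p u = v"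
  by (rule normal_complement[OF inner_form_axioms i_linear inj_push[OF a c(1) p c(2)] n_normal(2,1)])

lemma Gp_eq: "Gp u v = gp (i p u) (i p v)"
  by (rule pull2_eq[OF a c(1) p c(2) manifold(3)])

lemma Phi_eq: "Phi a p u v w = fp (i p u) (i p v) (i p w)"
  by (rule pull3_eq[OF a c(1) p c(2) manifold(4)])

lemma Jp_eq: "i p (Jp u) = P nn (i p u)"
  using push_induced_I[OF a p] by (simp add: c_def)

lemma B_eq: "B w u = gp (K w u) nn"
  by (simp add: second_form_def Let_def K_def H_def flip: c_def)

lemma cderiv_U: "\<lbrakk>\<And>x. x \<in> S \<Longrightarrow> f (cinv a x) = h x; (h has_derivative h') (at x0)\<rbrakk> \<Longrightarrow> cderiv a f p w = h' w"
  using cinv_chart[OF manifold(1) a] Uq(1)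
  by (intro cderiv_eqI[OF manifold(1) a U, of f h]) (force simp: S_def x0_def)+

text \<open>Symmetry of the Hessian of the immersion; together with that of the ambient connection
  coefficients it makes \<open>K\<close> and \<open>B\<close> symmetric.\<close>

lemma has_derivative_H: "((\<lambda>x. i (cinv a x) u) has_derivative (\<lambda>w. H w u)) (at x0)"
  and H_sym: "H w u = H u w"
proof -
  define F where "F = snd c \<circ> \<iota> \<circ> cinv a"
  have F: "smooth_on S F"
    using hyp a c(1) by (auto simp: hypersurface_def S_def U_def F_def)
  have i_F: "frechet_derivative F (at x) u = i (cinv a x) u" if "x \<in> S" for x u
    using cinv_S(2)[OF that] by (simp add: push_def cderiv_def F_def o_assoc)
  have d: "((\<lambda>x. i (cinv a x) u) has_derivative frechet_derivative (\<lambda>x. frechet_derivative F (at x) u) (at x0)) (at x0)"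
    for u
    by (rule has_derivative_transform_within_open[OF
          smooth_on_has_derivative[OF smooth_on_derivative[OF F] S(2)] S i_F])
  have H: "H w u = frechet_derivative (\<lambda>x. frechet_derivative F (at x) u) (at x0) w" for w u
    unfolding H_def by (rule cderiv_U[OF _ d]) simp
  show "((\<lambda>x. i (cinv a x) u) has_derivative (\<lambda>w. H w u)) (at x0)"
    using d unfolding H by simp
  show "H w u = H u w"
    unfolding H by (rule second_derivative_symmetric[OF S F])
qed

lemma has_derivative_N: "((\<lambda>x. n c (cinv a x)) has_derivative N) (at x0)"
proof -
  have "smooth_on S (n c \<circ> cinv a)"
    using nor a c(1) unfolding unit_normal_def S_def U_def by blast
  from smooth_on_has_derivative[OF this S(2)] show ?thesis
    by (simp add: N_def[abs_def] cderiv_def[abs_def] o_def x0_def)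
qed

lemma cinv_c: "x \<in> S \<Longrightarrow> cinv c (snd c (\<iota> (cinv a x))) = \<iota> (cinv a x)"
  using cinv_chart[OF manifold(2) c(1)] Uq(2)[OF cinv_S(1)] by simp

lemma has_derivative_F: "((\<lambda>x. snd c (\<iota> (cinv a x))) has_derivative i p) (at x0)"
  using has_derivative_immersion[OF a c(1) p c(2)] by (simp add: x0_def)

lemma has_derivative_g:
  "((\<lambda>x. gx x u v) has_derivative (\<lambda>w. gp (Cb (i p w) u) v + gp u (Cb (i p w) v))) (at x0)"
proof -
  have "((\<lambda>x. g c (cinv c (snd c (\<iota> (cinv a x)))) u v) has_derivative
      (\<lambda>w. cderiv c (\<lambda>q. g c q u v) (\<iota> p) (i p w))) (at x0)"
    using has_derivative_tensor2[OF manifold(2) c(1) manifold(3) c(2)]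
    by (intro has_derivative_compose[OF has_derivative_F]) (simp add: cinv_S(3))
  then show ?thesis
    unfolding LC(4) by (rule has_derivative_transform_within_open[OF _ S]) (simp add: cinv_c)
qed

lemma has_derivative_phi:
  "((\<lambda>x. fx x u v z) has_derivative
    (\<lambda>w. T (i p w) u v z + fp (Cb (i p w) u) v z + fp u (Cb (i p w) v) z + fp u v (Cb (i p w) z))) (at x0)"
proof -
  have "((\<lambda>x. \<phi> c (cinv c (snd c (\<iota> (cinv a x)))) u v z) has_derivative
      (\<lambda>w. cderiv c (\<lambda>q. \<phi> c q u v z) (\<iota> p) (i p w))) (at x0)"
    using has_derivative_tensor3[OF manifold(2) c(1) manifold(4) c(2)]
    by (intro has_derivative_compose[OF has_derivative_F]) (simp add: cinv_S(3))
  then have "((\<lambda>x. fx x u v z) has_derivative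
      (\<lambda>w. cderiv c (\<lambda>q. \<phi> c q u v z) (\<iota> p) (i p w))) (at x0)"
    by (rule has_derivative_transform_within_open[OF _ S]) (simp add: cinv_c)
  then show ?thesis
    by (simp add: cov3_def)
qed

lemma ambient_S: "x \<in> S \<Longrightarrow> g2_form (gx x) (fx x)"
  using ambient_form[OF a c(1)] Uq cinv_S(1) by blast

lemma bilinear_S: "x \<in> S \<Longrightarrow> bilinear (gx x)"
  using ambient_S by (simp add: g2_form_def inner_form_def)

lemma trilinear_S: "x \<in> S \<Longrightarrow> trilinear (fx x)"
  using ambient_S g2_form.trilinear_f by blast

text \<open>The derivative of the metric supplies exactly the connection terms that complete the
  plain derivatives of both arguments to covariant ones. For \<phi> the same bookkeeping leaves the
  additional term \<open>T\<close>.\<close>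

lemma g_product:
  assumes X: "(X has_derivative X') (at x0)" and Y: "(Y has_derivative Y') (at x0)"
  shows "((\<lambda>x. gx x (X x) (Y x)) has_derivative
    (\<lambda>w. gp (X' w + Cb (i p w) (X x0)) (Y x0) + gp (X x0) (Y' w + Cb (i p w) (Y x0)))) (at x0)"
  using has_derivative_bilinear_field[OF S bilinear_S has_derivative_g X Y]
  by (simp add: cinv_S(3) G_simps algebra_simps)

lemma phi_product:
  assumes X: "(X has_derivative X') (at x0)" and Y: "(Y has_derivative Y') (at x0)"
    and Z: "(Z has_derivative Z') (at x0)"
  shows "((\<lambda>x. fx x (X x) (Y x) (Z x)) has_derivative
    (\<lambda>w. T (i p w) (X x0) (Y x0) (Z x0) + fp (X' w + Cb (i p w) (X x0)) (Y x0) (Z x0)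
      + fp (X x0) (Y' w + Cb (i p w) (Y x0)) (Z x0) + fp (X x0) (Y x0) (Z' w + Cb (i p w) (Z x0)))) (at x0)"
  using has_derivative_trilinear_field[OF S trilinear_S has_derivative_phi X Y Z]
  by (simp add: cinv_S(3) f_simps algebra_simps)

text \<open>Both claims come from differentiating constants: the length of \<open>n\<close>, and the
  inner product of \<open>n\<close> with an image of a coordinate field.\<close>

lemma W_normal: "gp (W w) nn = 0" and W_tangent: "gp (W w) (i p u) = - B w u"
proof -
  have const: "((\<lambda>x. k) has_derivative (\<lambda>w. 0)) (at x0)" for k :: real
    by simp
  have "((\<lambda>x. gx x (n c (cinv a x)) (n c (cinv a x))) has_derivative (\<lambda>w. 0)) (at x0)"
    by (rule has_derivative_transform_within_open[OF const[of 1] S])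
      (use normal(1)[OF a c(1)] Uq cinv_S(1) in simp)
  from has_derivative_unique_at[OF g_product[OF has_derivative_N has_derivative_N] this]
  have "gp (W w) nn + gp nn (W w) = 0"
    by (simp add: cinv_S(3) W_def)
  then show "gp (W w) nn = 0"
    using sym[of nn "W w"] by simp
  have "((\<lambda>x. gx x (n c (cinv a x)) (i (cinv a x) u)) has_derivative (\<lambda>w. 0)) (at x0)"
  proof (rule has_derivative_transform_within_open[OF const[of 0] S])
    fix x assume x: "x \<in> S"
    interpret x: g2_form "gx x" "fx x" by (rule ambient_S[OF x])
    show "0 = gx x (n c (cinv a x)) (i (cinv a x) u)"
      using normal(2)[OF a c(1) Uq[OF cinv_S(1)[OF x]]] x.sym by metis
  qed
  from has_derivative_unique_at[OF g_product[OF has_derivative_N has_derivative_H] this]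
  have "gp (W w) (i p u) + gp nn (K w u) = 0"
    by (simp add: cinv_S(3) W_def K_def)
  then show "gp (W w) (i p u) = - B w u"
    using sym[of nn "K w u"] by (simp add: B_eq)
qed

lemma inner_form_Gp: "inner_form Gp"
proof
  show "bilinear Gp"
    by (auto simp: bilinear_def Gp_eq i_simps G_simps intro!: linearI)
  show "Gp u v = Gp v u" for u v
    by (simp add: Gp_eq sym)
  show "0 < Gp u u" if "u \<noteq> 0" for u
    using pos[of "i p u"] i_inj[of u 0] that by (auto simp: Gp_eq i_simps)
qed

lemma H_linear: "linear (H w)" "linear (\<lambda>w. H w u)"
proof -
  have "linear (i (cinv a x))" if "x \<in> S" for x
    using linear_push[OF a c(1)] Uq cinv_S(1)[OF that] by blast
  then show "linear (H w)"
    by (rule linear_field_derivative[OF S _ has_derivative_H])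
  then show "linear (\<lambda>w. H w u)"
    using has_derivative_linear[OF has_derivative_H] by blast
qed

lemma bilinear_K: "bilinear K" and K_sym: "K w u = K u w"
proof -
  have "bilinear H"
    using H_linear by (simp add: bilinear_def)
  from bilinear_simps[OF this] show "bilinear K"
    by (auto simp: bilinear_def K_def i_simps Cb_simps algebra_simps intro!: linearI)
  show "K w u = K u w"
    using H_sym[of w u] LC(3)[of "i p w"] by (simp add: K_def)
qed

lemmas K_simps = bilinear_simps[OF bilinear_K]

lemma bilinear_B: "bilinear B"
  by (auto simp: bilinear_def B_eq K_simps G_simps intro!: linearI)

lemma B_sym: "B u v = B v u"
  using K_sym[of u v] by (simp add: B_eq)

lemma has_derivative_gM_K:
  "((\<lambda>x. gM a (cinv a x) u v) has_derivative (\<lambda>w. gp (K w u) (i p v) + gp (i p u) (K w v))) (at x0)"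
proof (rule has_derivative_transform_within_open[OF _ S])
  show "((\<lambda>x. gx x (i (cinv a x) u) (i (cinv a x) v)) has_derivative
      (\<lambda>w. gp (K w u) (i p v) + gp (i p u) (K w v))) (at x0)"
    using g_product[OF has_derivative_H has_derivative_H, of u v] by (simp add: cinv_S(3) K_def)
  show "gx x (i (cinv a x) u) (i (cinv a x) v) = gM a (cinv a x) u v" if "x \<in> S" for x
    by (rule pull2_eq[symmetric, OF a c(1) Uq[OF cinv_S(1)[OF that]] manifold(3)])
qed

lemma deriv_gM: "cderiv a (\<lambda>q. gM a q u v) p w = gp (K w u) (i p v) + gp (i p u) (K w v)"
  by (rule cderiv_U[OF _ has_derivative_gM_K]) simp

text \<open>The tangential part of \<open>K\<close> is symmetric, and it differentiates the induced
  metric correctly since normal components have no inner product with tangent vectors. These two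
  properties characterize the Levi-Civita connection.\<close>

lemma levi_civita_gM: "i p (C w u) = K w u - B w u *\<^sub>R nn"
proof -
  define D where "D = (\<lambda>w u. inv (i p) (K w u - B w u *\<^sub>R nn))"
  have D: "i p (D w u) = K w u - B w u *\<^sub>R nn" for w u
  proof -
    have "gp (K w u - B w u *\<^sub>R nn) nn = 0"
      by (simp add: G_simps n_normal B_eq)
    then have "\<exists>v. i p v = K w u - B w u *\<^sub>R nn"
      by (rule tangent)
    then show ?thesis
      unfolding D_def by (metis f_inv_into_f rangeI)
  qed
  have bil: "bilinear D"
    by (auto simp: bilinear_def D i_simps K_simps bilinear_simps[OF bilinear_B] algebra_simps
        intro!: linearI i_inj)
  have sym_D: "D w u = D u w" for w u
    by (rule i_inj) (simp add: D K_sym[of w u] B_sym[of w u])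
  have met: "cderiv a (\<lambda>q. gM a q u v) p w = Gp (D w u) v + Gp u (D w v)" for u v w
    by (simp add: deriv_gM Gp_eq D G_simps n_normal)
  have "C = D"
    using inner_form_Gp bil sym_D met by (intro levi_civita_eqI[of gM a p D]) auto
  then show ?thesis
    using D by simp
qed

text \<open>Near \<open>p\<close> the Kaehler form of \<open>u\<close> and \<open>v\<close> is
  \<phi>(n, v, u), whence the reversed arguments. The terms with \<open>K\<close> cancel against the
  induced connection, because the difference is a multiple of \<open>n\<close> and \<phi> vanishes
  on a repeated \<open>n\<close>.\<close>

lemma nabla_omega_eq:
  "nabla_omega gM J a p w u v = T (i p w) nn (i p v) (i p u) + fp (W w) (i p v) (i p u)"
proof -
  have "kaehler_form gM J a q u v = \<phi> c (\<iota> q) (n c q) (i q v) (i q u)" if "q \<in> U" for q u v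
  proof -
    interpret q: inner_form "g c (\<iota> q)"
      using ambient_form[OF a c(1) Uq[OF that]] by (simp add: g2_form_def)
    show ?thesis
      using induced_I_metric[OF a Uq(1)[OF that] c(1) Uq(2)[OF that], of v u] q.sym[of "i q u"]
      by (simp add: kaehler_form_def pull2_eq[OF a c(1) Uq[OF that] manifold(3)])
  qed
  note omega_eq = this
  have omega: "cderiv a (\<lambda>q. kaehler_form gM J a q u v) p w =
      T (i p w) nn (i p v) (i p u) + fp (W w) (i p v) (i p u) + fp nn (K w v) (i p u) + fp nn (i p v) (K w u)"
  proof (rule cderiv_U)
    show "((\<lambda>x. fx x (n c (cinv a x)) (i (cinv a x) v) (i (cinv a x) u)) has_derivative
        (\<lambda>w. T (i p w) nn (i p v) (i p u) + fp (W w) (i p v) (i p u) + fp nn (K w v) (i p u)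
          + fp nn (i p v) (K w u))) (at x0)"
      using phi_product[OF has_derivative_N has_derivative_H has_derivative_H, of v u]
      by (simp add: cinv_S(3) K_def W_def)
  qed (rule omega_eq[OF cinv_S(1)])
  show ?thesis
    unfolding nabla_omega_def cov2_def omega omega_eq[OF U(3)] levi_civita_gM
    by (simp add: f_simps f_same)
qed

lemma has_derivative_Phi:
  "((\<lambda>x. Phi a (cinv a x) u v z) has_derivative
    (\<lambda>w. T (i p w) (i p u) (i p v) (i p z) + fp (K w u) (i p v) (i p z)
      + fp (i p u) (K w v) (i p z) + fp (i p u) (i p v) (K w z))) (at x0)"
proof (rule has_derivative_transform_within_open[OF _ S])
  show "((\<lambda>x. fx x (i (cinv a x) u) (i (cinv a x) v) (i (cinv a x) z)) has_derivative
    (\<lambda>w. T (i p w) (i p u) (i p v) (i p z) + fp (K w u) (i p v) (i p z)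
      + fp (i p u) (K w v) (i p z) + fp (i p u) (i p v) (K w z))) (at x0)"
    using phi_product[OF has_derivative_H has_derivative_H has_derivative_H, of u v z]
    by (simp add: cinv_S(3) K_def)
  show "fx x (i (cinv a x) u) (i (cinv a x) v) (i (cinv a x) z) = Phi a (cinv a x) u v z"
    if "x \<in> S" for x
    by (rule pull3_eq[symmetric, OF a c(1) Uq[OF cinv_S(1)[OF that]] manifold(4)])
qed

lemma deriv_Phi:
  "cderiv a (\<lambda>q. Phi a q u v z) p w = T (i p w) (i p u) (i p v) (i p z) + fp (K w u) (i p v) (i p z)
      + fp (i p u) (K w v) (i p z) + fp (i p u) (i p v) (K w z)"
  by (rule cderiv_U[OF _ has_derivative_Phi]) simp

text \<open>The induced connection removes the tangential parts of \<open>K\<close>; the normal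
  parts survive with coefficients \<open>B\<close>.\<close>

lemma cov_Phi:
  "cov3 C Phi a p w u v z = T (i p w) (i p u) (i p v) (i p z)
    + B w u * fp nn (i p v) (i p z) + B w v * fp nn (i p z) (i p u) + B w z * fp nn (i p u) (i p v)"
  using f_rot[of nn "i p z" "i p u"] f_rot[of "i p u" "i p v" nn]
  unfolding cov3_def deriv_Phi Phi_eq levi_civita_gM by (simp add: f_simps)

lemma inner_form_S: "x \<in> S \<Longrightarrow> inner_form (gM a (cinv a x))"
  using g2_hypersurface_point.inner_form_Gp[OF g2_hypersurface_point.intro[OF g2_hypersurface_axioms
      g2_hypersurface_point_axioms.intro[OF a]]] Uq(1) cinv_S(1) by blast

lemma has_derivative_J: "((\<lambda>x. J a (cinv a x) u) has_derivative (\<lambda>w. J' w u)) (at x0)"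
proof -
  have eq: "gM a (cinv a x) (J a (cinv a x) u) v =
      fx x (n c (cinv a x)) (i (cinv a x) u) (i (cinv a x) v)" if "x \<in> S" for x v
    unfolding pull2_eq[OF a c(1) Uq[OF cinv_S(1)[OF that]] manifold(3)]
    by (rule induced_I_metric[OF a Uq(1)[OF cinv_S(1)[OF that]] c(1) Uq(2)[OF cinv_S(1)[OF that]]])
  have "(\<lambda>x. J a (cinv a x) u) differentiable (at x0)"
    by (rule differentiable_riesz[OF S inner_form_S differentiableI[OF has_derivative_gM_K] differentiableI[OF
          phi_product[OF has_derivative_N has_derivative_H has_derivative_H]] eq])
  then show ?thesis
    by (simp add: J'_def[abs_def] cderiv_def[abs_def] frechet_derivative_works o_def x0_def)
qed

lemma linear_J: "q \<in> fst a \<Longrightarrow> linear (J a q)"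
proof -
  assume q: "q \<in> fst a"
  define d where "d = chart_at Ab (\<iota> q)"
  have d: "d \<in> Ab" "\<iota> q \<in> fst d" using chart_at[OF a q] by (simp_all add: d_def)
  interpret q: g2_form "g d (\<iota> q)" "\<phi> d (\<iota> q)" by (rule ambient_form[OF a d(1) q d(2)])
  note lin = linear_push[OF a d(1) q d(2)]
  show "linear (J a q)"
    by (rule linearI; rule injD[OF inj_push[OF a d(1) q d(2)]])
      (simp_all add: push_induced_I[OF a q, folded d_def] linear_add[OF lin] linear_cmul[OF lin] q.P_simps)
qed

lemma cov_J: "nabla_omega gM J a p w u v = Gp u (cov_endo C J a p w v)"
proof -
  have G: "((\<lambda>x. gM a (cinv a x) u z) has_derivative (\<lambda>w. Gp (C w u) z + Gp u (C w z))) (at x0)" for z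
    using has_derivative_gM_K[of u z] by (simp add: Gp_eq levi_civita_gM G_simps n_normal)
  have "linear (gM a (cinv a x) u)" if "x \<in> S" for x
    using inner_form_S[OF that] by (simp add: inner_form_def bilinear_def)
  from has_derivative_linear_field[OF S this G has_derivative_J[of v]]
  have "cderiv a (\<lambda>q. kaehler_form gM J a q u v) p w = Gp (C w u) (Jp v) + Gp u (C w (Jp v)) + Gp u (J' w v)"
    by (intro cderiv_U) (simp_all add: kaehler_form_def cinv_S(3))
  then show ?thesis
    by (simp add: nabla_omega_def cov2_def cov_endo_def kaehler_form_def J'_def
        bilinear_simps[OF inner_form.bil[OF inner_form_Gp]])
qed

lemma trilinear_Phi: "trilinear (Phi a p)"
  by (auto simp: trilinear_def Phi_eq i_simps f_simps intro!: linearI)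

context
  fixes \<theta> :: "'a \<Rightarrow> real"
  assumes \<theta>: "smooth_function A \<theta>"
begin

lemma psi_eq:
  assumes "q \<in> fst a"
  shows "psi_p \<theta> a q u v w = cos (\<theta> q) * Phi a q u v w + sin (\<theta> q) * Phi a q (J a q u) v w"
    "psi_m \<theta> a q u v w = sin (\<theta> q) * Phi a q u v w - cos (\<theta> q) * Phi a q (J a q u) v w"
  by (simp_all add: induced_psi_plus_def induced_psi_minus_def pull_n_star_eq[OF a assms])

lemma has_derivative_\<theta>: "((\<lambda>x. \<theta> (cinv a x)) has_derivative (\<lambda>w. cderiv a \<theta> p w)) (at x0)"
proof -
  have "smooth_on (snd a ` fst a) (\<theta> \<circ> cinv a)"
    using \<theta> a by (simp add: smooth_function_def)
  from smooth_on_has_derivative[OF this, of x0] p show ?thesis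
    by (simp add: x0_def cderiv_def[abs_def] o_def)
qed

lemma has_derivative_Phi_J:
  "((\<lambda>x. Phi a (cinv a x) (J a (cinv a x) u) v z) has_derivative
    (\<lambda>w. cderiv a (\<lambda>q. Phi a q (Jp u) v z) p w + Phi a p (J' w u) v z)) (at x0)"
proof -
  have d: "((\<lambda>x. Phi a (cinv a x) u v z) has_derivative (\<lambda>w. cderiv a (\<lambda>q. Phi a q u v z) p w)) (at x0)" for u
    unfolding deriv_Phi by (rule has_derivative_Phi)
  have "linear (\<lambda>u. Phi a (cinv a x) u v z)" if "x \<in> S" for x
    by (rule trilinear_linear(1)[OF g2_hypersurface_point.trilinear_Phi[OF g2_hypersurface_point.intro[OF
            g2_hypersurface_axioms g2_hypersurface_point_axioms.intro[OF a Uq(1)[OF cinv_S(1)[OF that]]]]]])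
  from has_derivative_linear_field[OF S this d has_derivative_J[of u]] show ?thesis
    by (simp add: cinv_S(3))
qed

text \<open>\<open>E\<close> is the difference of the connections in the single direction
  \<open>w\<close>. Differentiating cosine and sine gives the terms with d\<theta>, and the factor
  \<open>J\<close> in the first slot of \<open>Phi\<close> gives the one with
  \<open>cov_endo\<close>.\<close>

lemma cov_psi:
  assumes D: "\<And>u. D w u = C w u + E u"
  shows "cov3 D (psi_p \<theta>) a p w u v z = cos (\<theta> p) * (cov3 C Phi a p w u v z + cderiv a \<theta> p w * Phi a p (Jp u) v z)
      + sin (\<theta> p) * (cov3 C Phi a p w (Jp u) v z + Phi a p (cov_endo C J a p w u) v z - cderiv a \<theta> p w * Phi a p u v z)
      - psi_p \<theta> a p (E u) v z - psi_p \<theta> a p u (E v) z - psi_p \<theta> a p u v (E z)" (is ?p)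
    and "cov3 D (psi_m \<theta>) a p w u v z = sin (\<theta> p) * (cov3 C Phi a p w u v z + cderiv a \<theta> p w * Phi a p (Jp u) v z)
      - cos (\<theta> p) * (cov3 C Phi a p w (Jp u) v z + Phi a p (cov_endo C J a p w u) v z - cderiv a \<theta> p w * Phi a p u v z)
      - psi_m \<theta> a p (E u) v z - psi_m \<theta> a p u (E v) z - psi_m \<theta> a p u v (E z)" (is ?m)
proof -
  have d: "((\<lambda>x. Phi a (cinv a x) u v z) has_derivative (\<lambda>w. cderiv a (\<lambda>q. Phi a q u v z) p w)) (at x0)" for u
    unfolding deriv_Phi by (rule has_derivative_Phi)
  note Phi_simps = trilinear_simps[OF trilinear_Phi] linear_add[OF linear_J[OF p]]
  note cs = has_derivative_cos[OF has_derivative_\<theta>] has_derivative_sin[OF has_derivative_\<theta>]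
  have fst_a: "cinv a x \<in> fst a" if "x \<in> S" for x
    using Uq(1) cinv_S(1)[OF that] by blast
  have "cderiv a (\<lambda>q. psi_p \<theta> a q u v z) p w =
      cos (\<theta> p) * cderiv a (\<lambda>q. Phi a q u v z) p w - sin (\<theta> p) * cderiv a \<theta> p w * Phi a p u v z
      + (sin (\<theta> p) * (cderiv a (\<lambda>q. Phi a q (Jp u) v z) p w + Phi a p (J' w u) v z)
      + cos (\<theta> p) * cderiv a \<theta> p w * Phi a p (Jp u) v z)"
    using has_derivative_add[OF has_derivative_mult[OF cs(1) d[of u]] has_derivative_mult[OF cs(2) has_derivative_Phi_J[of u v z]]]
    by (intro cderiv_U) (simp_all add: psi_eq fst_a cinv_S(3) mult_ac)
  then show ?p
    unfolding cov3_def cov_endo_def D by (simp add: psi_eq[OF p] Phi_simps J'_def algebra_simps)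
  have "cderiv a (\<lambda>q. psi_m \<theta> a q u v z) p w =
      sin (\<theta> p) * cderiv a (\<lambda>q. Phi a q u v z) p w + cos (\<theta> p) * cderiv a \<theta> p w * Phi a p u v z
      - (cos (\<theta> p) * (cderiv a (\<lambda>q. Phi a q (Jp u) v z) p w + Phi a p (J' w u) v z)
      - sin (\<theta> p) * cderiv a \<theta> p w * Phi a p (Jp u) v z)"
    using has_derivative_diff[OF has_derivative_mult[OF cs(2) d[of u]] has_derivative_mult[OF cs(1) has_derivative_Phi_J[of u v z]]]
    by (intro cderiv_U) (simp_all add: psi_eq fst_a cinv_S(3) mult_ac)
  then show ?m
    unfolding cov3_def cov_endo_def D by (simp add: psi_eq[OF p] Phi_simps J'_def algebra_simps)
qed

end

end

section \<open>SU(3)-structures on a six-dimensional space\<close>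

lemma UNIV_6: "UNIV = {0, 1, 2, 3, 4, 5 :: 6}"
proof (rule sym, rule card_subset_eq)
  show "card {0, 1, 2, 3, 4, 5 :: 6} = card (UNIV :: 6 set)" by simp
qed auto

lemma sum_6: "sum f (UNIV :: 6 set) = f 0 + f 1 + f 2 + f 3 + f 4 + f 5"
  unfolding UNIV_6 by (simp add: add.assoc)

lemma forall_6: "(\<forall>i :: 6. P i) \<longleftrightarrow> P 0 \<and> P 1 \<and> P 2 \<and> P 3 \<and> P 4 \<and> P 5"
proof -
  have "(\<forall>i. P i) \<longleftrightarrow> (\<forall>i\<in>UNIV. P i)" by simp
  then show ?thesis unfolding UNIV_6 by simp
qed

text \<open>The coordinates with respect to \<open>f\<close> identify the space with \<open>\<complex>\<^sup>3\<close>, and \<open>Phi\<close> with the real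
  part of the complex determinant.\<close>

locale su3_frame = inner_form G for G :: "real ^ 6 \<Rightarrow> real ^ 6 \<Rightarrow> real" +
  fixes J :: "real ^ 6 \<Rightarrow> real ^ 6" and Phi :: "real ^ 6 \<Rightarrow> real ^ 6 \<Rightarrow> real ^ 6 \<Rightarrow> real"
    and f :: "6 \<Rightarrow> real ^ 6"
  assumes frame: "orthonormal_frame G f"
    and J_coord: "G (J x) (f 0) = - G x (f 1)" "G (J x) (f 1) = G x (f 0)"
      "G (J x) (f 2) = - G x (f 3)" "G (J x) (f 3) = G x (f 2)"
      "G (J x) (f 4) = - G x (f 5)" "G (J x) (f 5) = G x (f 4)"
    and Phi_det: "Phi x y z = (let a = \<lambda>v. Complex (G v (f 0)) (G v (f 1));
        b = \<lambda>v. Complex (G v (f 2)) (G v (f 3)); c = \<lambda>v. Complex (G v (f 4)) (G v (f 5))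
      in Re (a x * (b y * c z - c y * b z) - b x * (a y * c z - c y * a z) + c x * (a y * b z - b y * a z)))"
begin

lemma Phi_coord: "Phi x y z =
    G x (f 0) * (G y (f 2) * G z (f 4) - G y (f 3) * G z (f 5) - G y (f 4) * G z (f 2) + G y (f 5) * G z (f 3))
  - G x (f 1) * (G y (f 2) * G z (f 5) + G y (f 3) * G z (f 4) - G y (f 4) * G z (f 3) - G y (f 5) * G z (f 2))
  - G x (f 2) * (G y (f 0) * G z (f 4) - G y (f 1) * G z (f 5) - G y (f 4) * G z (f 0) + G y (f 5) * G z (f 1))
  + G x (f 3) * (G y (f 0) * G z (f 5) + G y (f 1) * G z (f 4) - G y (f 4) * G z (f 1) - G y (f 5) * G z (f 0))
  + G x (f 4) * (G y (f 0) * G z (f 2) - G y (f 1) * G z (f 3) - G y (f 2) * G z (f 0) + G y (f 3) * G z (f 1))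
  - G x (f 5) * (G y (f 0) * G z (f 3) + G y (f 1) * G z (f 2) - G y (f 2) * G z (f 1) - G y (f 3) * G z (f 0))"
  unfolding Phi_det Let_def plus_complex.sel minus_complex.sel times_complex.sel complex.sel by algebra

lemma G_coord: "G x y = G x (f 0) * G y (f 0) + G x (f 1) * G y (f 1) + G x (f 2) * G y (f 2)
    + G x (f 3) * G y (f 3) + G x (f 4) * G y (f 4) + G x (f 5) * G y (f 5)"
  by (subst frame_inner[OF frame]) (simp add: sum_6)

lemma J_skew: "G (J x) y = - G x (J y)"
  unfolding G_coord[of "J x" y] G_coord[of x "J y"] J_coord by algebra

lemma J_isometry: "G (J x) (J y) = G x y"
  unfolding G_coord[of "J x" "J y"] G_coord[of x y] J_coord by algebra

lemma J_J: "J (J x) = - x"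
  by (rule nondegenerate) (simp only: J_skew[of "J x"] J_isometry G_simps)

lemma J_linear: "linear J"
  by (rule linearI; rule nondegenerate) (simp_all add: J_skew G_simps)

lemmas J_simps = linear_add[OF J_linear] linear_cmul[OF J_linear] linear_neg[OF J_linear]
  linear_diff[OF J_linear] linear_0[OF J_linear]

lemma J_frame: "J (f 0) = f 1" "J (f 2) = f 3" "J (f 4) = f 5"
proof -
  show "J (f 0) = f 1" "J (f 2) = f 3" "J (f 4) = f 5"
    by (rule nondegenerate; subst (1 2) G_coord; simp add: J_coord frame_orthonormal[OF frame])+
qed

lemma trilinear_Phi: "trilinear Phi"
proof -
  have "Phi (x + x') y z = Phi x y z + Phi x' y z" "Phi x (y + y') z = Phi x y z + Phi x y' z"
      "Phi x y (z + z') = Phi x y z + Phi x y z'" for x x' y y' z z'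
    unfolding Phi_coord G_simps by algebra+
  moreover have "Phi (c *\<^sub>R x) y z = c *\<^sub>R Phi x y z" "Phi x (c *\<^sub>R y) z = c *\<^sub>R Phi x y z"
      "Phi x y (c *\<^sub>R z) = c *\<^sub>R Phi x y z" for c x y z
    unfolding Phi_coord G_simps real_scaleR_def by algebra+
  ultimately show ?thesis
    by (auto simp: trilinear_def intro!: linearI)
qed

lemmas Phi_simps = trilinear_simps[OF trilinear_Phi]

lemma Phi_skew: "Phi y x z = - Phi x y z" "Phi x z y = - Phi x y z"
  unfolding Phi_coord by algebra+

lemma Phi_rot: "Phi y z x = Phi x y z"
  unfolding Phi_coord by algebra

lemma Phi_J: "Phi x (J y) z = Phi (J x) y z" "Phi x y (J z) = Phi (J x) y z"
  unfolding Phi_coord J_coord by algebra+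

lemma Phi_JJ: "Phi x (J y) (J z) = - Phi x y z"
  unfolding Phi_coord J_coord by algebra

text \<open>The cross product that \<open>Phi\<close> defines on the six-dimensional space; on the
  hypersurface it is the tangential part of the ambient cross product.\<close>

definition "V x y = (\<Sum>k\<in>UNIV. Phi x y (f k) *\<^sub>R f k)"

lemma V_coord: "G (V x y) (f k) = Phi x y (f k)"
  by (simp add: V_def G_simps frame_orthonormal[OF frame] if_distrib cong: if_cong)

lemma V_inner: "G (V x y) z = Phi x y z"
proof -
  have "Phi x y z = (\<Sum>k\<in>UNIV. Phi x y (f k) * G z (f k))"
    by (subst frame_expansion[OF frame, of z]) (simp add: Phi_simps mult.commute)
  then show ?thesis
    by (subst frame_inner[OF frame]) (simp add: V_coord)
qed

lemma Phi_frame: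
  "Phi x y (f 0) = G x (f 2) * G y (f 4) - G x (f 3) * G y (f 5) - G x (f 4) * G y (f 2) + G x (f 5) * G y (f 3)"
  "Phi x y (f 1) = - (G x (f 2) * G y (f 5) + G x (f 3) * G y (f 4) - G x (f 4) * G y (f 3) - G x (f 5) * G y (f 2))"
  "Phi x y (f 2) = - (G x (f 0) * G y (f 4) - G x (f 1) * G y (f 5) - G x (f 4) * G y (f 0) + G x (f 5) * G y (f 1))"
  "Phi x y (f 3) = G x (f 0) * G y (f 5) + G x (f 1) * G y (f 4) - G x (f 4) * G y (f 1) - G x (f 5) * G y (f 0)"
  "Phi x y (f 4) = G x (f 0) * G y (f 2) - G x (f 1) * G y (f 3) - G x (f 2) * G y (f 0) + G x (f 3) * G y (f 1)"
  "Phi x y (f 5) = - (G x (f 0) * G y (f 3) + G x (f 1) * G y (f 2) - G x (f 2) * G y (f 1) - G x (f 3) * G y (f 0))"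
  by (simp_all add: Phi_coord frame_orthonormal[OF frame] algebra_simps)

text \<open>This is the real part of the Lagrange identity for the Hermitian form <x, z> + i <J x,
  z>.\<close>

lemma Phi_V: "Phi (V x y) z w = G x z * G y w - G (J x) z * G (J y) w - G x w * G y z + G (J x) w * G (J y) z"
  unfolding Phi_coord[of "V x y"] V_coord Phi_frame
    G_coord[of x z] G_coord[of y w] G_coord[of "J x" z] G_coord[of "J y" w] G_coord[of x w] G_coord[of y z]
    G_coord[of "J x" w] G_coord[of "J y" z] J_coord
  by algebra

lemma Phi_frame2:
  "Phi x (f 2) (f 4) = G x (f 0)" "Phi x (f 2) (f 5) = - G x (f 1)" "Phi x (f 0) (f 4) = - G x (f 2)"
  "Phi x (f 0) (f 5) = G x (f 3)" "Phi x (f 0) (f 2) = G x (f 4)" "Phi x (f 0) (f 3) = - G x (f 5)"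
  by (simp_all add: Phi_frame frame_orthonormal[OF frame])

lemma Phi_eq_0:
  assumes "\<And>y z. Phi x y z = 0"
  shows "x = 0"
  using Phi_frame2[of x, unfolded assms] by (subst frame_expansion[OF frame, of x]) (simp add: sum_6)

lemma Phi_inner: "inner_form2 G (Phi x) (Phi y) = 2 * G x y"
proof -
  have bil: "bilinear (Phi x)" for x
    using trilinear_Phi by (simp add: trilinear_def bilinear_def)
  have "inner_form2 G (Phi x) (Phi y) = 1 / 2 * (\<Sum>j\<in>UNIV. \<Sum>k\<in>UNIV. Phi x (f j) (f k) * Phi y (f j) (f k))"
    by (rule inner_form2_frame[OF frame bil bil])
  also have "(\<Sum>j\<in>UNIV. \<Sum>k\<in>UNIV. Phi x (f j) (f k) * Phi y (f j) (f k)) = 4 * G x y"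
    unfolding sum_6 Phi_frame
    by (simp add: frame_orthonormal[OF frame] G_coord[of x y])
  finally show ?thesis by simp
qed

text \<open>Such \<open>b\<close> are the real two-forms of type (2,0) + (0,2). The condition on
  \<open>J\<close> leaves six free components, as many as a vector has.\<close>

lemma Phi_form:
  assumes b: "bilinear b" and skew: "\<And>y z. b z y = - b y z" and bJ: "\<And>y z. b y z = - b (J y) (J z)"
  obtains x where "\<And>y z. b y z = Phi x y z"
proof -
  note b_simps = bilinear_simps[OF b]
  have J_move: "b (J y) z = b y (J z)" for y z
    using bJ[of "J y" z] by (simp add: J_J b_simps)
  have zero: "b y y = 0" for y
    using skew[of y y] by simp
  have zeroJ: "b y (J y) = 0" for y
    using skew[of y "J y"] J_move[of y y] by simp
  have v: "b (f 1) (f 2) = b (f 0) (f 3)" "b (f 1) (f 3) = - b (f 0) (f 2)"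
      "b (f 1) (f 4) = b (f 0) (f 5)" "b (f 1) (f 5) = - b (f 0) (f 4)"
      "b (f 3) (f 4) = b (f 2) (f 5)" "b (f 3) (f 5) = - b (f 2) (f 4)"
      "b (f 0) (f 1) = 0" "b (f 2) (f 3) = 0" "b (f 4) (f 5) = 0"
    using J_move[of "f 0" "f 2"] bJ[of "f 0" "f 2"] J_move[of "f 0" "f 4"] bJ[of "f 0" "f 4"]
      J_move[of "f 2" "f 4"] bJ[of "f 2" "f 4"] zeroJ[of "f 0"] zeroJ[of "f 2"] zeroJ[of "f 4"]
    by (simp_all add: J_frame)
  have s: "b (f 1) (f 0) = - b (f 0) (f 1)" "b (f 2) (f 0) = - b (f 0) (f 2)" "b (f 3) (f 0) = - b (f 0) (f 3)"
      "b (f 4) (f 0) = - b (f 0) (f 4)" "b (f 5) (f 0) = - b (f 0) (f 5)" "b (f 2) (f 1) = - b (f 1) (f 2)"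
      "b (f 3) (f 1) = - b (f 1) (f 3)" "b (f 4) (f 1) = - b (f 1) (f 4)" "b (f 5) (f 1) = - b (f 1) (f 5)"
      "b (f 3) (f 2) = - b (f 2) (f 3)" "b (f 4) (f 2) = - b (f 2) (f 4)" "b (f 5) (f 2) = - b (f 2) (f 5)"
      "b (f 4) (f 3) = - b (f 3) (f 4)" "b (f 5) (f 3) = - b (f 3) (f 5)" "b (f 5) (f 4) = - b (f 4) (f 5)"
    by (rule skew)+
  define x where "x = b (f 2) (f 4) *\<^sub>R f 0 - b (f 2) (f 5) *\<^sub>R f 1 - b (f 0) (f 4) *\<^sub>R f 2
    + b (f 0) (f 5) *\<^sub>R f 3 + b (f 0) (f 2) *\<^sub>R f 4 - b (f 0) (f 3) *\<^sub>R f 5"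
  have x: "G x (f 0) = b (f 2) (f 4)" "G x (f 1) = - b (f 2) (f 5)" "G x (f 2) = - b (f 0) (f 4)"
      "G x (f 3) = b (f 0) (f 5)" "G x (f 4) = b (f 0) (f 2)" "G x (f 5) = - b (f 0) (f 3)"
    by (simp_all add: x_def G_simps frame_orthonormal[OF frame])
  have "b y z = Phi x y z" for y z
  proof -
    have "b y z = (\<Sum>j\<in>UNIV. \<Sum>k\<in>UNIV. G y (f j) * G z (f k) * b (f j) (f k))"
      by (subst frame_expansion[OF frame, of y], subst frame_expansion[OF frame, of z])
        (simp add: b_simps sum_distrib_left mult_ac, subst sum.swap, simp)
    also have "\<dots> = Phi x y z"
      unfolding sum_6 s v zero Phi_coord x by algebra
    finally show ?thesis .
  qed
  then show ?thesis by (rule that)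
qed

text \<open>The derivative of the determinant at the identity is the trace.\<close>

lemma Phi_traceless:
  assumes L: "linear L" and LJ: "\<And>x. L (J x) = J (L x)"
    and tr: "(\<Sum>k\<in>UNIV. G (L (f k)) (f k)) = 0" "(\<Sum>k\<in>UNIV. G (L (f k)) (J (f k))) = 0"
  shows "Phi (L x) y z + Phi (L y) z x + Phi (L z) x y = 0"
proof -
  have Lf: "L (f 1) = J (L (f 0))" "L (f 3) = J (L (f 2))" "L (f 5) = J (L (f 4))"
    using LJ[of "f 0"] LJ[of "f 2"] LJ[of "f 4"] by (simp_all add: J_frame)
  have Lx: "G (L x) (f k) = G x (f 0) * G (L (f 0)) (f k) + G x (f 1) * G (J (L (f 0))) (f k)
      + G x (f 2) * G (L (f 2)) (f k) + G x (f 3) * G (J (L (f 2))) (f k)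
      + G x (f 4) * G (L (f 4)) (f k) + G x (f 5) * G (J (L (f 4))) (f k)" for x k
    by (subst frame_expansion[OF frame, of x])
      (simp add: linear_sum[OF L] linear_cmul[OF L] G_simps sum_6 Lf linear_add[OF L])
  define a b c where "a = (\<lambda>v. Complex (G v (f 0)) (G v (f 1)))"
    and "b = (\<lambda>v. Complex (G v (f 2)) (G v (f 3)))" and "c = (\<lambda>v. Complex (G v (f 4)) (G v (f 5)))"
  note abc = a_def b_def c_def
  have lin: "a (L x) = a x * a (L (f 0)) + b x * a (L (f 2)) + c x * a (L (f 4))"
      "b (L x) = a x * b (L (f 0)) + b x * b (L (f 2)) + c x * b (L (f 4))"
      "c (L x) = a x * c (L (f 0)) + b x * c (L (f 2)) + c x * c (L (f 4))" for x
    by (simp_all add: complex_eq_iff abc Lx[of x] J_coord)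
  \<comment> \<open>The real and the imaginary part of the complex trace of \<open>L\<close>; the
    last diagonal entry is then eliminated.\<close>
  have "G (L (f 0)) (f 0) + G (L (f 2)) (f 2) + G (L (f 4)) (f 4) = 0"
      "G (L (f 0)) (f 1) + G (L (f 2)) (f 3) + G (L (f 4)) (f 5) = 0"
    using tr by (simp_all add: sum_6 Lf J_coord J_frame J_isometry flip: J_skew)
  then have t: "c (L (f 4)) = - a (L (f 0)) - b (L (f 2))"
    by (simp add: complex_eq_iff abc)
  define D where "D = (\<lambda>x y z. a x * (b y * c z - c y * b z) - b x * (a y * c z - c y * a z)
      + c x * (a y * b z - b y * a z))"
  have Phi: "Phi x y z = Re (D x y z)" for x y z
    by (simp add: Phi_det D_def abc Let_def)
  have "D (L x) y z + D (L y) z x + D (L z) x y = 0"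
    unfolding D_def lin[of x] lin[of y] lin[of z] t by algebra
  from arg_cong[OF this, of Re] show ?thesis
    unfolding Phi by simp
qed

end

section \<open>Gray-Hervella classes in a unitary frame\<close>

context su3_frame
begin

lemma tr_eq: "bilinear b \<Longrightarrow> tr G b = (\<Sum>k\<in>UNIV. b (f k) (f k))"
  by (rule tr_frame[OF frame])

definition "dual b x = (\<Sum>k\<in>UNIV. b x (f k) *\<^sub>R f k)"

lemma dual_inner:
  assumes "bilinear b"
  shows "G (dual b x) y = b x y"
  by (subst (2) frame_expansion[OF frame, of y])
    (simp add: dual_def G_simps bilinear_simps[OF assms] sym[of y] mult.commute)

lemma linear_dual: "bilinear b \<Longrightarrow> linear (dual b)"
  by (rule linearI; rule nondegenerate) (simp_all add: dual_inner G_simps bilinear_simps)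

text \<open>Multiplication by the complex number c + i s, with \<open>J\<close> as i.\<close>

definition "rot c s x = c *\<^sub>R x + s *\<^sub>R J x"

lemma rot_inner: "G (rot c s x) y = c * G x y + s * G (J x) y"
  by (simp add: rot_def G_simps)

lemma Phi_rot_J: "Phi (rot c s x) y z = c * Phi x y z + s * Phi (J x) y z"
  by (simp add: rot_def Phi_simps)

lemma rot_linear: "linear (rot c s)"
  by (rule linearI) (simp_all add: rot_def J_simps algebra_simps)

lemma rot_rot: "rot c s (rot d t x) = rot (c * d - s * t) (c * t + s * d) x"
  by (simp add: rot_def J_simps J_J algebra_simps)

lemma rot_adjoint: "G (rot c s x) y = G x (rot c (- s) y)"
  by (simp add: rot_def G_simps J_skew)

lemma rot_1: "rot 1 0 x = x"
  by (simp add: rot_def)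

lemma rot_J: "rot c s (J x) = J (rot c s x)"
  by (simp add: rot_def J_simps)

lemma gray_hervella_Phi:
  assumes L: "linear L"
  shows "(\<lambda>x y z. Phi (L x) y z) \<in> gray_hervella J"
  unfolding gray_hervella_def
proof (intro CollectI conjI allI)
  show "trilinear (\<lambda>x y z. Phi (L x) y z)"
    by (auto simp: trilinear_def Phi_simps linear_add[OF L] linear_cmul[OF L] intro!: linearI)
  show "Phi (L x) y z = - Phi (L x) z y" for x y z
    by (rule Phi_skew(2))
  show "Phi (L x) y z = - Phi (L x) (J y) (J z)" for x y z
    by (simp only: Phi_JJ minus_minus)
qed

lemma gray_hervellaD:
  assumes "\<alpha> \<in> gray_hervella J"
  shows "trilinear \<alpha>" "\<alpha> x y z = - \<alpha> x z y" "\<alpha> x y z = - \<alpha> x (J y) (J z)"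
  using assms unfolding gray_hervella_def by blast+

lemma class_gray_hervella:
  "\<alpha> \<in> class_W1 J \<Longrightarrow> \<alpha> \<in> gray_hervella J" "\<alpha> \<in> class_W2 J \<Longrightarrow> \<alpha> \<in> gray_hervella J"
  "\<alpha> \<in> class_W3 G J \<Longrightarrow> \<alpha> \<in> gray_hervella J" "\<alpha> \<in> class_W4 G J \<Longrightarrow> \<alpha> \<in> gray_hervella J"
  unfolding class_W1_def class_W2_def class_W3_def class_W4_def by blast+

lemma class_W1_J:
  assumes "\<alpha> \<in> class_W1 J"
  shows "\<alpha> (J x) (J y) z = - \<alpha> x y z" "\<alpha> y z x = \<alpha> x y z"
proof -
  have gh: "\<alpha> \<in> gray_hervella J" and sk: "\<alpha> x y z = - \<alpha> y x z" for x y z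
    using assms unfolding class_W1_def by blast+
  note g = gray_hervellaD[OF gh]
  show "\<alpha> (J x) (J y) z = - \<alpha> x y z"
    using g(2)[of "J x" "J y" z] sk[of "J x" z "J y"] g(3)[of z x y] g(2)[of x y z] sk[of x z y]
    by linarith
  show "\<alpha> y z x = \<alpha> x y z"
    using g(2)[of y z x] sk[of y x z] by linarith
qed

text \<open>The cyclic identity at (x, J y, J z) and its rotations gives three linear equations for
  the values with \<open>J\<close> in two slots. Classes 1 and 2 thus acquire a minus sign under
  \<open>J\<close> in the first two slots, whereas classes 3 and 4 acquire a plus sign.\<close>

lemma class_W2_J:
  assumes "\<alpha> \<in> class_W2 J"
  shows "\<alpha> (J x) (J y) z = - \<alpha> x y z" "\<alpha> x y z + \<alpha> y z x + \<alpha> z x y = 0"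
proof -
  have gh: "\<alpha> \<in> gray_hervella J" and cyc: "\<alpha> x y z + \<alpha> y z x + \<alpha> z x y = 0" for x y z
    using assms unfolding class_W2_def by blast+
  show "\<alpha> x y z + \<alpha> y z x + \<alpha> z x y = 0" by (rule cyc)
  note g = gray_hervellaD[OF gh]
  have move: "\<alpha> x (J y) z = \<alpha> x y (J z)" for x y z
    using g(3)[of x y "J z"] by (simp add: J_J trilinear_simps[OF g(1)])
  have *: "\<alpha> (J y) (J z) x + \<alpha> (J z) (J x) y = \<alpha> x y z" for x y z
    using cyc[of x "J y" "J z"] g(3)[of x y z] move[of "J z" x y] by linarith
  show "\<alpha> (J x) (J y) z = - \<alpha> x y z"
    using *[of x y z] *[of y z x] *[of z x y] cyc[of x y z] by linarith
qed

text \<open>The factor is 6 - 1 - 1: the first term contributes the dimension, the second and the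
  fourth remove one each, and the third contains the trace of \<open>J\<close>, which is
  zero.\<close>

lemma class_W4_tr:
  assumes \<tau>: "linear \<tau>" "\<And>x y z. \<alpha> x y z =
    G x y * \<tau> z - G x z * \<tau> y - G x (J y) * \<tau> (J z) + G x (J z) * \<tau> (J y)"
  shows "(\<Sum>k\<in>UNIV. \<alpha> (f k) (f k) z) = 4 * \<tau> z" "\<alpha> (J x) (J y) z = \<alpha> x y z"
proof -
  have exp: "(\<Sum>k\<in>UNIV. G (f k) u * \<mu> (f k)) = \<mu> u" if "linear \<mu>" for \<mu> :: "real ^ 6 \<Rightarrow> real" and u
    by (subst (2) frame_expansion[OF frame, of u])
      (simp add: linear_sum[OF that] linear_cmul[OF that] sym[of u])
  have lin: "linear (\<lambda>x. \<tau> (J x))"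
    using linear_compose[OF J_linear \<tau>(1)] by (simp add: o_def)
  have "(\<Sum>k\<in>UNIV. \<alpha> (f k) (f k) z) = 6 * \<tau> z - (\<Sum>k\<in>UNIV. G (f k) z * \<tau> (f k))
      - (\<Sum>k\<in>UNIV. G (f k) (J (f k))) * \<tau> (J z) + (\<Sum>k\<in>UNIV. G (f k) (J z) * \<tau> (J (f k)))"
    by (simp add: \<tau>(2) sum.distrib sum_subtractf frame_orthonormal[OF frame] sum_distrib_right)
  moreover have "G x (J x) = 0" for x
    using J_skew[of x x] sym[of x "J x"] by simp
  ultimately show "(\<Sum>k\<in>UNIV. \<alpha> (f k) (f k) z) = 4 * \<tau> z"
    using exp[OF \<tau>(1), of z] exp[OF lin, of "J z"] by (simp add: J_J linear_neg[OF \<tau>(1)])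
  show "\<alpha> (J x) (J y) z = \<alpha> x y z"
    by (simp add: \<tau>(2) J_isometry J_skew J_J linear_neg[OF \<tau>(1)] G_simps)
qed

lemma gray_hervella_diff:
  assumes "\<alpha> \<in> gray_hervella J" "\<beta> \<in> gray_hervella J"
  shows "(\<lambda>x y z. \<alpha> x y z - \<beta> x y z) \<in> gray_hervella J"
  unfolding gray_hervella_def
proof (intro CollectI conjI allI)
  note a = gray_hervellaD[OF assms(1)] and b = gray_hervellaD[OF assms(2)]
  show "trilinear (\<lambda>x y z. \<alpha> x y z - \<beta> x y z)"
    using a(1) b(1) unfolding trilinear_def by (auto intro: linear_compose_sub)
  show "\<alpha> x y z - \<beta> x y z = - (\<alpha> x z y - \<beta> x z y)" for x y z
    using a(2)[of x y z] b(2)[of x y z] by simp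
  show "\<alpha> x y z - \<beta> x y z = - (\<alpha> x (J y) (J z) - \<beta> x (J y) (J z))" for x y z
    using a(3)[of x y z] b(3)[of x y z] by simp
qed

lemma r_map_diff: "r_map G psi (\<lambda>x y z. \<alpha> x y z - \<beta> x y z) x y = r_map G psi \<alpha> x y - r_map G psi \<beta> x y"
  by (simp add: r_map_def inner_form2_def Let_def sum_subtractf algebra_simps)

lemma class_diff:
  shows "\<alpha> \<in> class_W1 J \<Longrightarrow> \<beta> \<in> class_W1 J \<Longrightarrow> (\<lambda>x y z. \<alpha> x y z - \<beta> x y z) \<in> class_W1 J"
    and "\<alpha> \<in> class_W2 J \<Longrightarrow> \<beta> \<in> class_W2 J \<Longrightarrow> (\<lambda>x y z. \<alpha> x y z - \<beta> x y z) \<in> class_W2 J"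
    and "\<alpha> \<in> class_W3 G J \<Longrightarrow> \<beta> \<in> class_W3 G J \<Longrightarrow> (\<lambda>x y z. \<alpha> x y z - \<beta> x y z) \<in> class_W3 G J"
    and "\<alpha> \<in> class_W4 G J \<Longrightarrow> \<beta> \<in> class_W4 G J \<Longrightarrow> (\<lambda>x y z. \<alpha> x y z - \<beta> x y z) \<in> class_W4 G J"
proof -
  let ?d = "\<lambda>x y z. \<alpha> x y z - \<beta> x y z"
  show "?d \<in> class_W1 J" if "\<alpha> \<in> class_W1 J" "\<beta> \<in> class_W1 J"
  proof -
    have "\<alpha> x y z = - \<alpha> y x z" "\<beta> x y z = - \<beta> y x z" for x y z
      using that unfolding class_W1_def by blast+
    then have "?d x y z = - ?d y x z" for x y z by (smt (verit))
    moreover have "?d \<in> gray_hervella J"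
      using that by (intro gray_hervella_diff class_gray_hervella(1))
    ultimately show ?thesis unfolding class_W1_def by blast
  qed
  show "?d \<in> class_W2 J" if "\<alpha> \<in> class_W2 J" "\<beta> \<in> class_W2 J"
  proof -
    have "?d x y z + ?d y z x + ?d z x y = 0" for x y z
      using class_W2_J(2)[OF that(1), of x y z] class_W2_J(2)[OF that(2), of x y z] by simp
    moreover have "?d \<in> gray_hervella J"
      using that by (intro gray_hervella_diff class_gray_hervella(2))
    ultimately show ?thesis unfolding class_W2_def by blast
  qed
  show "?d \<in> class_W3 G J" if "\<alpha> \<in> class_W3 G J" "\<beta> \<in> class_W3 G J"
  proof -
    have "?d (J x) (J y) z = ?d x y z" for x y z
      using that by (simp add: class_W3_def)
    moreover have "tr G (\<lambda>x y. ?d x y z) = 0" for z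
      using that by (simp add: class_W3_def tr_def sum_subtractf)
    moreover have "?d \<in> gray_hervella J"
      using that by (intro gray_hervella_diff class_gray_hervella(3))
    ultimately show ?thesis unfolding class_W3_def by blast
  qed
  show "?d \<in> class_W4 G J" if \<alpha>\<beta>: "\<alpha> \<in> class_W4 G J" "\<beta> \<in> class_W4 G J"
  proof -
    obtain \<sigma> where \<sigma>: "linear \<sigma>"
      "\<And>x y z. \<alpha> x y z = G x y * \<sigma> z - G x z * \<sigma> y - G x (J y) * \<sigma> (J z) + G x (J z) * \<sigma> (J y)"
      using \<alpha>\<beta>(1) unfolding class_W4_def by blast
    obtain \<tau> where \<tau>: "linear \<tau>"
      "\<And>x y z. \<beta> x y z = G x y * \<tau> z - G x z * \<tau> y - G x (J y) * \<tau> (J z) + G x (J z) * \<tau> (J y)"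
      using \<alpha>\<beta>(2) unfolding class_W4_def by blast
    have "linear (\<lambda>z. \<sigma> z - \<tau> z) \<and> (\<forall>x y z. ?d x y z = G x y * (\<sigma> z - \<tau> z) - G x z * (\<sigma> y - \<tau> y)
        - G x (J y) * (\<sigma> (J z) - \<tau> (J z)) + G x (J z) * (\<sigma> (J y) - \<tau> (J y)))"
      unfolding \<sigma>(2) \<tau>(2) using \<sigma>(1) \<tau>(1) by (simp add: linear_compose_sub algebra_simps)
    moreover have "?d \<in> gray_hervella J"
      using that by (intro gray_hervella_diff class_gray_hervella(4))
    ultimately show ?thesis unfolding class_W4_def by blast
  qed
qed

lemma UNIV_su3_class: "UNIV = {W1p, W1m, W2p, W2m, W3, W4, W5}"
  using su3_class.exhaust by auto

lemma Phi_skew_13: "Phi z y x = - Phi x y z"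
  using Phi_rot[of y x z] Phi_skew(1)[of y x z] by linarith

lemma J_type_tr:
  assumes "\<And>x y. b (J x) (J y) = - b x (y :: real ^ 6)"
  shows "(\<Sum>k\<in>UNIV. b (f k) (f k)) = (0 :: real)"
  using assms[of "f 0" "f 0"] assms[of "f 2" "f 2"] assms[of "f 4" "f 4"] by (simp add: sum_6 J_frame)

text \<open>The components of \<open>Phi\<close> with \<open>z\<close> in the middle are skew in the
  outer indices, so contraction with a symmetric form gives zero. Hence the second fundamental form
  does not enter d*\<omega>, and the W3 part is trace-free.\<close>

lemma sym_tr:
  assumes b: "bilinear b" and sy: "\<And>x y. b x y = b y x"
  shows "(\<Sum>k\<in>UNIV. b (f k) (V (f k) z)) = (0 :: real)"
proof -
  have anti: "Phi (f k) z (f l) * b (f k) (f l) = - (Phi (f l) z (f k) * b (f l) (f k))" for k l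
    by (simp only: Phi_skew_13[of "f k" z "f l"] sy[of "f k" "f l"] mult_minus_left)
  have "(\<Sum>k\<in>UNIV. b (f k) (V (f k) z)) = (\<Sum>k\<in>UNIV. \<Sum>l\<in>UNIV. Phi (f k) z (f l) * b (f k) (f l))"
    by (simp add: V_def bilinear_simps[OF b])
  also have "\<dots> = - (\<Sum>k\<in>UNIV. \<Sum>l\<in>UNIV. Phi (f l) z (f k) * b (f l) (f k))"
    by (subst anti) (simp only: sum_negf)
  also have "\<dots> = - (\<Sum>k\<in>UNIV. \<Sum>l\<in>UNIV. Phi (f k) z (f l) * b (f k) (f l))"
    by (subst sum.swap) (rule refl)
  also have "\<dots> = - (\<Sum>k\<in>UNIV. b (f k) (V (f k) z))"
    by (simp add: V_def bilinear_simps[OF b])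
  finally show ?thesis by simp
qed

section \<open>Decomposition of the torsion into signed classes\<close>

context
  fixes c s :: real and psi
  assumes cs: "c\<^sup>2 + s\<^sup>2 = 1" and psi: "psi = (\<lambda>x y z. Phi (rot c s x) y z)"
begin

text \<open>The 1/2 in \<open>r_map\<close> cancels the 2 in \<open>Phi_inner\<close>, so
  \<open>r_map\<close> recovers the endomorphism up to the rotation in \<open>psi\<close>.\<close>

lemma r_map_Phi: "r_map G psi (\<lambda>x y z. Phi (L x) y z) x y = G (L x) (rot c s y)"
  by (simp add: r_map_def psi Phi_inner)

text \<open>By \<open>Phi_form\<close> each slice of \<alpha> is \<open>Phi v\<close> for some
  \<open>v\<close>, and the rotation is invertible. This injectivity separates the plus from the
  minus classes.\<close>

lemma r_map_eq_0:
  assumes \<alpha>: "\<alpha> \<in> gray_hervella J" and r: "\<And>x y. r_map G psi \<alpha> x y = 0"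
  shows "\<alpha> x y z = 0"
proof -
  note g = gray_hervellaD[OF \<alpha>]
  have "bilinear (\<alpha> x)"
    using g(1) by (simp add: trilinear_def bilinear_def)
  then obtain v where v: "\<And>y z. \<alpha> x y z = Phi v y z"
    by (rule Phi_form[of "\<alpha> x"]) (rule g(2), rule g(3), blast)
  have eq: "\<alpha> x = Phi v" by (intro ext) (rule v)
  have "G v (rot c s u) = 0" for u
    using r[of x u] by (simp add: r_map_def psi eq Phi_inner)
  from this[of "rot c (- s) _"] have "G v u = 0" for u
    using cs by (simp add: rot_rot rot_1 power2_eq_square)
  then have "v = 0"
    by (intro nondegenerate) (simp add: G_simps)
  then show ?thesis by (simp add: v Phi_simps)
qed

lemma torsion_class_diff:
  "\<alpha> \<in> torsion_class G J psi k \<Longrightarrow> \<beta> \<in> torsion_class G J psi k \<Longrightarrow>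
    (\<lambda>x y z. \<alpha> x y z - \<beta> x y z) \<in> torsion_class G J psi k"
proof -
  assume a: "\<alpha> \<in> torsion_class G J psi k" and b: "\<beta> \<in> torsion_class G J psi k"
  have eq: "r_map G psi (\<lambda>x y z. \<alpha> x y z - \<beta> x y z) = (\<lambda>x y. r_map G psi \<alpha> x y - r_map G psi \<beta> x y)"
    by (intro ext) (rule r_map_diff)
  have sym_d: "sym_form (\<lambda>x y. u x y - v x y)" if "sym_form u" "sym_form v"
    for u v :: "real ^ 6 \<Rightarrow> real ^ 6 \<Rightarrow> real"
    using that unfolding sym_form_def by metis
  have skew_d: "skew_form (\<lambda>x y. u x y - v x y)" if "skew_form u" "skew_form v"
    for u v :: "real ^ 6 \<Rightarrow> real ^ 6 \<Rightarrow> real"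
    using that unfolding skew_form_def by (smt (verit))
  show ?thesis
    using a b by (cases k) (simp_all add: class_diff eq sym_d skew_d)
qed

lemma torsion_class_0: "(\<lambda>x y z. 0) \<in> torsion_class G J psi k"
proof -
  have gh: "(\<lambda>x y z. 0) \<in> gray_hervella J"
    by (simp add: gray_hervella_def trilinear_def linear_zero)
  have "r_map G psi (\<lambda>x y z. 0) = (\<lambda>x y. 0)"
    by (simp add: r_map_def inner_form2_def Let_def fun_eq_iff)
  moreover have "\<exists>\<tau>. linear \<tau> \<and> (\<forall>x y z. (0::real) =
     G x y * \<tau> z - G x z * \<tau> y - G x (J y) * \<tau> (J z) + G x (J z) * \<tau> (J y))"
    by (rule exI[of _ "\<lambda>_. 0"]) (simp add: linear_zero)
  ultimately show ?thesis
    using gh by (cases k) (auto simp: class_W1_def class_W2_def class_W3_def class_W4_def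
        sym_form_def skew_form_def tr_def)
qed

text \<open>Directness of the sum. Inserting \<open>J\<close> into two slots separates classes 1 and
  2 from 3 and 4; the trace separates 3 from 4; the cyclic sum separates 1 from 2; symmetry against
  skew-symmetry of \<open>r_map\<close> separates the signs.\<close>

lemma class_sum_0:
  assumes cl: "\<And>k. \<delta> k \<in> torsion_class G J psi k"
    and sum: "\<And>x y z. (\<Sum>k\<in>UNIV. \<delta> k x y z) = 0"
  shows "\<delta> k x y z = 0"
proof -
  have cl1: "\<delta> W1p \<in> class_W1 J" "\<delta> W1m \<in> class_W1 J" "\<delta> W2p \<in> class_W2 J" "\<delta> W2m \<in> class_W2 J"
      "\<delta> W3 \<in> class_W3 G J" "\<delta> W4 \<in> class_W4 G J" "\<delta> W5 = (\<lambda>x y z. 0)"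
    using cl[of W1p] cl[of W1m] cl[of W2p] cl[of W2m] cl[of W3] cl[of W4] cl[of W5] by auto
  have sum': "\<delta> W1p x y z + \<delta> W1m x y z + \<delta> W2p x y z + \<delta> W2m x y z + \<delta> W3 x y z + \<delta> W4 x y z = 0" for x y z
    using sum[of x y z] by (simp add: UNIV_su3_class cl1(7) add_ac)
  obtain \<tau> where \<tau>: "linear \<tau>" "\<And>x y z. \<delta> W4 x y z =
     G x y * \<tau> z - G x z * \<tau> y - G x (J y) * \<tau> (J z) + G x (J z) * \<tau> (J y)"
    using cl1(6) unfolding class_W4_def by blast
  have J3: "\<delta> W3 (J x) (J y) z = \<delta> W3 x y z" and gh3: "\<delta> W3 \<in> gray_hervella J"
    and tr3: "tr G (\<lambda>x y. \<delta> W3 x y z) = 0" for x y z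
    using cl1(5) unfolding class_W3_def by blast+
  have 34: "\<delta> W3 x y z + \<delta> W4 x y z = 0" for x y z
    using sum'[of x y z] sum'[of "J x" "J y" z] class_W1_J(1)[OF cl1(1), of x y z]
      class_W1_J(1)[OF cl1(2), of x y z] class_W2_J(1)[OF cl1(3), of x y z] class_W2_J(1)[OF cl1(4), of x y z]
      J3[of x y z] class_W4_tr(2)[OF \<tau>, of x y z] by linarith
  have "(\<Sum>k\<in>UNIV. \<delta> W3 (f k) (f k) z) = 0" for z
    using tr3[of z] gray_hervellaD(1)[OF gh3] by (simp add: tr_eq trilinear_def bilinear_def)
  moreover have "(\<Sum>k\<in>UNIV. \<delta> W3 (f k) (f k) z) + (\<Sum>k\<in>UNIV. \<delta> W4 (f k) (f k) z) = 0" for z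
    by (simp add: 34 flip: sum.distrib)
  ultimately have "\<tau> z = 0" for z
    using class_W4_tr(1)[OF \<tau>, of z] by simp
  then have 4: "\<delta> W4 x y z = 0" for x y z
    by (simp add: \<tau>(2))
  then have 3: "\<delta> W3 x y z = 0" for x y z
    using 34[of x y z] by simp
  have 1: "\<delta> W1p x y z + \<delta> W1m x y z = 0" for x y z
    using sum'[of x y z] sum'[of y z x] sum'[of z x y] class_W1_J(2)[OF cl1(1), of y z x]
      class_W1_J(2)[OF cl1(1), of x y z] class_W1_J(2)[OF cl1(2), of x y z] class_W1_J(2)[OF cl1(2), of y z x]
      class_W2_J(2)[OF cl1(3), of x y z] class_W2_J(2)[OF cl1(4), of x y z]
      class_W1_J(2)[OF cl1(1), of z x y] class_W1_J(2)[OF cl1(2), of z x y]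
    unfolding 3 4 by linarith
  have 2: "\<delta> W2p x y z + \<delta> W2m x y z = 0" for x y z
    using sum'[of x y z] 1[of x y z] unfolding 3 4 by linarith
  have pm: "\<alpha> x y z = 0 \<and> \<beta> x y z = 0"
    if gh: "\<alpha> \<in> gray_hervella J" and s: "\<And>x y z. \<alpha> x y z + \<beta> x y z = 0"
      and sy: "sym_form (r_map G psi \<alpha>)" and sk: "skew_form (r_map G psi \<beta>)"
    for \<alpha> \<beta> :: "real ^ 6 \<Rightarrow> real ^ 6 \<Rightarrow> real ^ 6 \<Rightarrow> real" and x y z
  proof -
    have b: "\<beta> = (\<lambda>x y z. 0 - \<alpha> x y z)"
      using s by (simp add: fun_eq_iff eq_neg_iff_add_eq_0 add.commute)
    have "r_map G psi \<beta> u v = - r_map G psi \<alpha> u v" for u v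
      unfolding b r_map_diff by (simp add: r_map_def inner_form2_def Let_def)
    then have "r_map G psi \<alpha> u v = 0" for u v
      using sy sk unfolding sym_form_def skew_form_def by (metis equal_neg_zero minus_minus)
    from r_map_eq_0[OF gh this] show ?thesis by (simp add: b)
  qed
  have "\<delta> W1p x y z = 0 \<and> \<delta> W1m x y z = 0"
    using cl[of W1p] cl[of W1m] 1 by (intro pm) (auto intro: class_gray_hervella(1))
  moreover have "\<delta> W2p x y z = 0 \<and> \<delta> W2m x y z = 0"
    using cl[of W2p] cl[of W2m] 2 by (intro pm) (auto intro: class_gray_hervella(2))
  ultimately show ?thesis
    using 3 4 cl1(7) by (cases k) auto
qed

text \<open>By directness any other decomposition, extended by zero outside \<open>U\<close>,
  coincides with \<open>\<beta>\<close>. Membership can therefore be tested on one explicit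
  decomposition.\<close>

lemma in_classes_iff:
  assumes \<beta>: "\<And>k. \<beta> k \<in> torsion_class G J psi k" and \<alpha>: "\<And>x y z. \<alpha> x y z = (\<Sum>k\<in>UNIV. \<beta> k x y z)"
  shows "in_classes G J psi U \<alpha> \<longleftrightarrow> (\<forall>k. k \<notin> U \<longrightarrow> (\<forall>x y z. \<beta> k x y z = 0))"
proof
  have fin: "finite (UNIV :: su3_class set)"
    unfolding UNIV_su3_class by simp
  {
    assume "in_classes G J psi U \<alpha>"
    then obtain \<gamma> where \<gamma>: "\<And>k. k \<in> U \<Longrightarrow> \<gamma> k \<in> torsion_class G J psi k"
      "\<And>x y z. \<alpha> x y z = (\<Sum>k\<in>U. \<gamma> k x y z)"
      unfolding in_classes_def by blast
    define \<gamma>' where "\<gamma>' = (\<lambda>k. if k \<in> U then \<gamma> k else (\<lambda>x y z. 0))"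
    have "\<gamma>' k \<in> torsion_class G J psi k" for k
      using \<gamma>(1) torsion_class_0 by (simp add: \<gamma>'_def)
    from torsion_class_diff[OF \<beta> this]
    have cl: "(\<lambda>x y z. \<beta> k x y z - \<gamma>' k x y z) \<in> torsion_class G J psi k" for k .
    have "(\<Sum>k\<in>UNIV. \<gamma>' k x y z) = (\<Sum>k\<in>U. \<gamma> k x y z)" for x y z
      by (rule sum.mono_neutral_cong_right[OF fin]) (auto simp: \<gamma>'_def)
    then have "(\<Sum>k\<in>UNIV. \<beta> k x y z - \<gamma>' k x y z) = 0" for x y z
      using \<alpha> \<gamma>(2) by (simp add: sum_subtractf)
    from class_sum_0[OF cl this] show "\<forall>k. k \<notin> U \<longrightarrow> (\<forall>x y z. \<beta> k x y z = 0)"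
      by (simp add: \<gamma>'_def)
  }
  {
    assume z: "\<forall>k. k \<notin> U \<longrightarrow> (\<forall>x y z. \<beta> k x y z = 0)"
    have "(\<Sum>k\<in>UNIV. \<beta> k x y z) = (\<Sum>k\<in>U. \<beta> k x y z)" for x y z
      by (rule sum.mono_neutral_right[OF fin]) (use z in auto)
    then show "in_classes G J psi U \<alpha>"
      unfolding in_classes_def using \<beta> \<alpha> by (intro exI[of _ \<beta>]) simp
  }
qed

text \<open>Each part of \<open>A\<close> produces an element of one class, so the vanishing of a
  component becomes a condition on that part. The two consequences of the g2 condition enter
  separately: \<open>r_omega\<close> makes the part for W2 traceless, and \<open>r_Phi\<close> turns
  the trace of \<alpha> into \<open>rn\<close>.\<close>

lemma torsion_classes:
  assumes B: "bilinear B" "\<And>x y. B x y = B y x" and r: "bilinear r" "\<And>x y. r x y = - r y x"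
    and r_omega: "(\<Sum>k\<in>UNIV. r (f k) (J (f k))) = 0"
    and r_Phi: "\<And>z. (\<Sum>k\<in>UNIV. \<Sum>l\<in>UNIV. Phi (J z) (f k) (f l) * r (f k) (f l)) = 2 * rn z"
    and A: "\<And>x y. G (A x) y = B x y + r x (J y)"
    and S: "\<And>x y. S x y = act1 J r x y - act2 J r x y + (B x y + act J B x y)"
    and h: "h = 1 / 6 * tr G B"
    and \<alpha>: "\<And>x y z. \<alpha> x y z = Phi (A x) y z"
  shows "tr G (\<lambda>x y. \<alpha> x y z) = 2 * rn z"
    and "in_classes G J psi U \<alpha> \<longleftrightarrow> (W1p \<in> U \<or> h * c = 0) \<and> (W1m \<in> U \<or> h * s = 0) \<and>
      (W2p \<in> U \<or> (\<forall>x y. c * S x y = 2 * h * c * G x y)) \<and>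
      (W2m \<in> U \<or> (\<forall>x y. s * S x y = 2 * h * s * G x y)) \<and>
      (W3 \<in> U \<or> (\<forall>x y. act J B x y = B x y)) \<and> (W4 \<in> U \<or> (\<forall>x. rn x = 0))" (is ?classes)
proof -
  note B_simps = bilinear_simps[OF B(1)] and r_simps = bilinear_simps[OF r(1)]
  have S': "S x y = r x (J y) - r (J x) y + (B x y + B (J x) (J y))" for x y
    by (simp add: S act1_def act2_def act_def)
  \<comment> \<open>The form \<open>B x y + r x (J y)\<close> of \<open>A\<close> equals
    \<open>h * G x y + b0 x y + b3 x y + b4 x y\<close>. Half of \<open>S\<close> is its part
    commuting with \<open>J\<close>, which is symmetric since \<open>r\<close> is skew;
    \<open>b3\<close> and \<open>b4\<close> are the symmetric and the skew part of the rest.\<close>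
  define b0 where "b0 = (\<lambda>x y. 1 / 2 * S x y - h * G x y)"
  define b3 where "b3 = (\<lambda>x y. 1 / 2 * (B x y - B (J x) (J y)))"
  define b4 where "b4 = (\<lambda>x y. 1 / 2 * (r x (J y) + r (J x) y))"
  have bil: "bilinear b0" "bilinear b3" "bilinear b4"
    by (auto simp: bilinear_def b0_def b3_def b4_def S' B_simps r_simps G_simps J_simps algebra_simps
        add_divide_distrib diff_divide_distrib intro!: linearI)
  note d = bil[THEN dual_inner]
  \<comment> \<open>Adding the plus and minus versions gives back the part itself, because
    \<open>c * c + s * s = 1\<close>. Under \<open>r_map\<close> the rotation by \<open>c\<close>,
    \<open>s\<close> cancels that of \<open>psi\<close>, while the one by \<open>s\<close>,
    \<open>- c\<close> leaves a factor \<open>J\<close>, which turns symmetric into skew.\<close>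
  define L where "L = (\<lambda>k x. case k of W1p \<Rightarrow> (h * c) *\<^sub>R rot c s x | W1m \<Rightarrow> (h * s) *\<^sub>R rot s (- c) x
    | W2p \<Rightarrow> c *\<^sub>R rot c s (dual b0 x) | W2m \<Rightarrow> s *\<^sub>R rot s (- c) (dual b0 x)
    | W3 \<Rightarrow> dual b3 x | W4 \<Rightarrow> dual b4 x | W5 \<Rightarrow> 0)"
  have lin: "linear (L k)" for k
    using linear_dual[OF bil(1)] linear_dual[OF bil(2)] linear_dual[OF bil(3)] rot_linear
    by (cases k) (auto simp: L_def intro!: linear_compose_scale_right linear_zero
        linear_compose[of "dual b0" "rot _ _", unfolded o_def])
  define \<beta> where "\<beta> = (\<lambda>k x y z. Phi (L k x) y z)"
  have gh: "\<beta> k \<in> gray_hervella J" for k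
    unfolding \<beta>_def by (rule gray_hervella_Phi[OF lin])
  have r_map: "r_map G psi (\<beta> k) x y = G (L k x) (rot c s y)" for k x y
    unfolding \<beta>_def by (rule r_map_Phi)
  have cs': "c * c + s * s = 1"
    using cs by (simp add: power2_eq_square)
  have b0_sym: "b0 x y = b0 y x" for x y
    using B(2)[of x y] B(2)[of "J x" "J y"] r(2)[of x "J y"] r(2)[of "J x" y] sym[of x y]
    by (simp add: b0_def S')
  have b0_J: "b0 (J x) y = - b0 x (J y)" for x y
    by (simp add: b0_def S' J_J B_simps r_simps J_skew field_simps)
  have dual_b0_J: "dual b0 (J x) = J (dual b0 x)" for x
    by (rule nondegenerate) (simp add: d b0_J J_skew)
  have A_lin: "linear A"
    by (rule linearI; rule nondegenerate) (simp_all add: A B_simps r_simps G_simps algebra_simps)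
  have bil_\<alpha>: "bilinear (\<lambda>x y. \<alpha> x y z)" for z
    by (auto simp: bilinear_def \<alpha> Phi_simps linear_add[OF A_lin] linear_cmul[OF A_lin] intro!: linearI)
  have Phi_G: "Phi x y z = G x (V y z)" for x y z
    by (simp add: sym[of x] V_inner Phi_rot)
  show tr: "tr G (\<lambda>x y. \<alpha> x y z) = 2 * rn z" for z
  proof -
    have "r (f k) (J (V (f k) z)) = (\<Sum>l\<in>UNIV. Phi (J z) (f k) (f l) * r (f k) (f l))" for k
    proof -
      have "G (J (V (f k) z)) (f l) = Phi (J z) (f k) (f l)" for l
        using Phi_J[of "f k" z "f l"] Phi_skew(1)[of "J z" "f k" "f l"]
        by (simp add: J_skew V_inner)
      then show ?thesis
        by (subst frame_expansion[OF frame, of "J (V (f k) z)"]) (simp add: r_simps)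
    qed
    then have "Phi (A (f k)) (f k) z = B (f k) (V (f k) z) + (\<Sum>l\<in>UNIV. Phi (J z) (f k) (f l) * r (f k) (f l))" for k
      by (subst Phi_G) (simp only: A)
    then have "(\<Sum>k\<in>UNIV. Phi (A (f k)) (f k) z) = 2 * rn z"
      by (simp add: sum.distrib sym_tr[OF B] r_Phi)
    then show ?thesis
      by (simp add: tr_eq[OF bil_\<alpha>]) (simp add: \<alpha>)
  qed
  have rot_rot': "G (rot c s x) (rot c s y) = G x y" "G (rot s (- c) x) (rot c s y) = G x (J y)" for x y
    using cs' by (simp_all add: rot_adjoint rot_rot rot_1 mult.commute) (simp add: rot_def G_simps)
  have b0_xJx: "b0 x (J x) = 0" for x
    using b0_J[of x x] b0_sym[of x "J x"] by simp
  have trB: "(\<Sum>k\<in>UNIV. B (J (f k)) (J (f k))) = 6 * h" "(\<Sum>k\<in>UNIV. B (f k) (f k)) = 6 * h"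
    by (simp_all add: h tr_eq[OF B(1)] sum_6 J_frame[symmetric] J_J B_simps)
  \<comment> \<open>Half of \<open>S\<close> has trace 6 h, as \<open>B\<close> and its
    \<open>J\<close>-conjugate contribute 6 h each and the terms with \<open>r\<close> vanish;
    \<open>h * G\<close> has the same trace.\<close>
  have tr_b0: "(\<Sum>k\<in>UNIV. b0 (f k) (f k)) = 0"
    using r(2)[of "J _" "_"] trB r_omega
    by (simp add: b0_def S' sum.distrib sum_subtractf frame_orthonormal[OF frame] flip: sum_divide_distrib sum_distrib_left)
  have mem: "\<beta> k \<in> torsion_class G J psi k" for k
  proof (cases k)
    case W1p
    have "\<beta> W1p x y z = - \<beta> W1p y x z" for x y z
      using Phi_skew(1)[of y x z] Phi_skew(1)[of "J y" x z]
      by (simp add: \<beta>_def L_def Phi_simps Phi_rot_J Phi_J algebra_simps)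
    moreover have "sym_form (r_map G psi (\<beta> W1p))"
      by (simp add: sym_form_def r_map L_def G_simps rot_rot' sym)
    ultimately show ?thesis using gh[of W1p] unfolding W1p torsion_class.simps class_W1_def by blast
  next
    case W1m
    have "\<beta> W1m x y z = - \<beta> W1m y x z" for x y z
      using Phi_skew(1)[of y x z] Phi_skew(1)[of "J y" x z]
      by (simp add: \<beta>_def L_def Phi_simps Phi_rot_J Phi_J algebra_simps)
    moreover have "skew_form (r_map G psi (\<beta> W1m))"
      unfolding skew_form_def
    proof (intro allI)
      fix x y
      show "r_map G psi (\<beta> W1m) x y = - r_map G psi (\<beta> W1m) y x"
        using sym[of y "J x"] J_skew[of x y] by (simp add: r_map L_def G_simps rot_rot')
    qed
    ultimately show ?thesis using gh[of W1m] unfolding W1m torsion_class.simps class_W1_def by blast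
  next
    case W2p
    have "\<beta> W2p x y z + \<beta> W2p y z x + \<beta> W2p z x y = 0" for x y z
      unfolding \<beta>_def
    proof (rule Phi_traceless[OF lin])
      show "(\<Sum>k\<in>UNIV. G (L W2p (f k)) (f k)) = 0" "(\<Sum>k\<in>UNIV. G (L W2p (f k)) (J (f k))) = 0"
        using tr_b0 b0_xJx
        by (simp_all add: L_def G_simps rot_inner J_skew J_isometry J_J d sum.distrib flip: sum_distrib_left)
    qed (simp add: L_def dual_b0_J rot_J J_simps)
    moreover have "sym_form (r_map G psi (\<beta> W2p))"
      using b0_sym by (simp add: sym_form_def r_map L_def G_simps rot_rot' d)
    ultimately show ?thesis using gh[of W2p] unfolding W2p torsion_class.simps class_W2_def by blast
  next
    case W2m
    have "\<beta> W2m x y z + \<beta> W2m y z x + \<beta> W2m z x y = 0" for x y z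
      unfolding \<beta>_def
    proof (rule Phi_traceless[OF lin])
      show "(\<Sum>k\<in>UNIV. G (L W2m (f k)) (f k)) = 0" "(\<Sum>k\<in>UNIV. G (L W2m (f k)) (J (f k))) = 0"
        using tr_b0 b0_xJx
        by (simp_all add: L_def G_simps rot_inner J_skew J_isometry J_J d sum.distrib sum_subtractf sum_negf flip: sum_distrib_left)
    qed (simp add: L_def dual_b0_J rot_J J_simps)
    moreover have "skew_form (r_map G psi (\<beta> W2m))"
      unfolding skew_form_def
    proof (intro allI)
      fix x y
      show "r_map G psi (\<beta> W2m) x y = - r_map G psi (\<beta> W2m) y x"
        using b0_sym[of y "J x"] b0_J[of x y] by (simp add: r_map L_def G_simps rot_rot' d)
    qed
    ultimately show ?thesis using gh[of W2m] unfolding W2m torsion_class.simps class_W2_def by blast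
  next
    case W3
    have "b3 (J x) y = b3 x (J y)" for x y
      by (simp add: b3_def J_J B_simps)
    then have "dual b3 (J x) = - J (dual b3 x)" for x
      by (intro nondegenerate) (simp add: d J_skew G_simps)
    then have "\<beta> W3 (J x) (J y) z = \<beta> W3 x y z" for x y z
      by (simp add: \<beta>_def L_def Phi_J Phi_simps J_J J_simps)
    moreover have "tr G (\<lambda>x y. \<beta> W3 x y z) = 0" for z
    proof -
      have "bilinear (\<lambda>x y. \<beta> W3 x y z)"
        using gray_hervellaD(1)[OF gh] by (simp add: trilinear_def bilinear_def)
      moreover have "b3 x y = b3 y x" for x y
        using B(2)[of x y] B(2)[of "J x" "J y"] by (simp add: b3_def)
      ultimately show ?thesis
        using sym_tr[OF bil(2)] by (simp add: tr_eq \<beta>_def L_def Phi_G d)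
    qed
    ultimately show ?thesis using gh[of W3] unfolding W3 torsion_class.simps class_W3_def by blast
  next
    case W4
    have b4: "b4 z y = - b4 y z" "b4 y z = - b4 (J y) (J z)" for y z
      using r(2)[of z "J y"] r(2)[of "J z" y] by (simp_all add: b4_def J_J r_simps field_simps)
    obtain t where t: "\<And>y z. b4 y z = Phi t y z"
      by (rule Phi_form[OF bil(3)]) (rule b4(1), rule b4(2), blast)
    \<comment> \<open>With \<open>b4\<close> written as \<open>Phi t\<close>, the double product
      formula \<open>Phi_V\<close> gives literally the normal form of W4, for \<tau> equal to minus
      the dual of \<open>t\<close>.\<close>
    have "dual b4 x = V t x" for x
      by (rule nondegenerate) (simp add: d t V_inner)
    then have eq: "\<beta> W4 x y z = G x y * - G t z - G x z * - G t y - G x (J y) * - G t (J z) + G x (J z) * - G t (J y)"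
      for x y z
      by (simp add: \<beta>_def L_def Phi_V J_skew)
    have "linear (\<lambda>z. - G t z)"
      by (rule linearI) (simp_all add: G_simps)
    with eq show ?thesis using gh[of W4] unfolding W4 torsion_class.simps class_W4_def by blast
  next
    case W5
    then show ?thesis by (simp add: \<beta>_def L_def Phi_simps fun_eq_iff)
  qed
  have sum: "\<alpha> x y z = (\<Sum>k\<in>UNIV. \<beta> k x y z)" for x y z
  proof -
    have "A x = (\<Sum>k\<in>UNIV. L k x)"
    proof (rule nondegenerate)
      fix v
      have "(h * c) * (c * G x v + s * G (J x) v) + (h * s) * (s * G x v + - c * G (J x) v) = h * (c * c + s * s) * G x v"
        by (simp add: algebra_simps)
      moreover have "c * (c * b0 x v + s * G (J (dual b0 x)) v) + s * (s * b0 x v + - c * G (J (dual b0 x)) v) =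
          (c * c + s * s) * b0 x v"
        by (simp add: algebra_simps)
      ultimately show "G (A x) v = G (\<Sum>k\<in>UNIV. L k x) v"
        unfolding UNIV_su3_class
        by (simp add: L_def G_simps rot_inner d A cs') (simp add: b0_def b3_def b4_def S' field_simps)
    qed
    then show ?thesis
      by (simp add: \<alpha> \<beta>_def Phi_simps)
  qed
  have zero: "(\<forall>x y z. \<beta> k x y z = 0) \<longleftrightarrow> (\<forall>x. L k x = 0)" for k
  proof
    assume "\<forall>x y z. \<beta> k x y z = 0"
    then show "\<forall>x. L k x = 0"
      unfolding \<beta>_def using Phi_eq_0 by blast
  qed (simp add: \<beta>_def Phi_simps)
  have rot_0: "rot c s x = 0 \<longleftrightarrow> x = 0" "rot s (- c) x = 0 \<longleftrightarrow> x = 0" for x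
  proof -
    have "rot c (- s) (rot c s x) = x" "rot s c (rot s (- c) x) = x"
      using cs' by (simp_all add: rot_rot rot_1 algebra_simps)
    moreover have "rot a b 0 = 0" for a b
      by (simp add: rot_def J_simps)
    ultimately show "rot c s x = 0 \<longleftrightarrow> x = 0" "rot s (- c) x = 0 \<longleftrightarrow> x = 0"
      by metis+
  qed
  have dual_0: "dual b x = 0 \<longleftrightarrow> (\<forall>y. b x y = 0)" if "bilinear b" for b x
    using nondegenerate[of "dual b x" 0] dual_inner[OF that, of x] by (auto simp: G_simps)
  have f0: "f 0 \<noteq> 0"
    using frame_orthonormal[OF frame, of 0 0] by (auto simp: G_simps)
  have z1: "(\<forall>x. L W1p x = 0) \<longleftrightarrow> h * c = 0" "(\<forall>x. L W1m x = 0) \<longleftrightarrow> h * s = 0"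
    using f0 by (auto simp: L_def rot_0)
  have b0_S: "a * b0 x y = 0 \<longleftrightarrow> a * S x y = 2 * h * a * G x y" for a x y
  proof -
    have "2 * (a * b0 x y) = a * S x y - 2 * h * a * G x y"
      by (simp add: b0_def algebra_simps)
    then show ?thesis by linarith
  qed
  have z2: "(\<forall>x. L W2p x = 0) \<longleftrightarrow> (\<forall>x y. c * S x y = 2 * h * c * G x y)"
      "(\<forall>x. L W2m x = 0) \<longleftrightarrow> (\<forall>x y. s * S x y = 2 * h * s * G x y)"
    unfolding b0_S[symmetric] by (auto simp: L_def rot_0 dual_0[OF bil(1)])
  have b3_B: "b3 x y = 0 \<longleftrightarrow> act J B x y = B x y" for x y
    by (auto simp: b3_def act_def)
  have z3: "(\<forall>x. L W3 x = 0) \<longleftrightarrow> (\<forall>x y. act J B x y = B x y)"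
    unfolding b3_B[symmetric] by (auto simp: L_def dual_0[OF bil(2)])
  \<comment> \<open>All other components are trace-free, so the trace 2 rn of \<alpha> is the trace
    4 \<tau> of the W4 component.\<close>
  have z4: "(\<forall>x. L W4 x = 0) \<longleftrightarrow> (\<forall>x. rn x = 0)"
  proof -
    obtain \<tau> where \<tau>: "linear \<tau>" "\<And>x y z. \<beta> W4 x y z =
        G x y * \<tau> z - G x z * \<tau> y - G x (J y) * \<tau> (J z) + G x (J z) * \<tau> (J y)"
      using mem[of W4] unfolding torsion_class.simps class_W4_def by blast
    have cl: "\<beta> W1p \<in> class_W1 J" "\<beta> W1m \<in> class_W1 J" "\<beta> W2p \<in> class_W2 J" "\<beta> W2m \<in> class_W2 J"
        "\<beta> W3 \<in> class_W3 G J"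
      using mem[of W1p] mem[of W1m] mem[of W2p] mem[of W2m] mem[of W3] by auto
    have "(\<Sum>k\<in>UNIV. \<beta> W3 (f k) (f k) z) = 0" for z
      using cl(5) gray_hervellaD(1)[OF gh[of W3]] by (simp add: class_W3_def tr_eq trilinear_def bilinear_def)
    moreover have "(\<Sum>k\<in>UNIV. \<beta> W1p (f k) (f k) z) = 0" for z
      by (rule J_type_tr) (rule class_W1_J(1)[OF cl(1)])
    moreover have "(\<Sum>k\<in>UNIV. \<beta> W1m (f k) (f k) z) = 0" for z
      by (rule J_type_tr) (rule class_W1_J(1)[OF cl(2)])
    moreover have "(\<Sum>k\<in>UNIV. \<beta> W2p (f k) (f k) z) = 0" for z
      by (rule J_type_tr) (rule class_W2_J(1)[OF cl(3)])
    moreover have "(\<Sum>k\<in>UNIV. \<beta> W2m (f k) (f k) z) = 0" for z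
      by (rule J_type_tr) (rule class_W2_J(1)[OF cl(4)])
    moreover have "\<beta> W5 x y z = 0" for x y z
      by (simp add: \<beta>_def L_def Phi_simps)
    moreover have "(\<Sum>k\<in>UNIV. \<alpha> (f k) (f k) z) = 2 * rn z" for z
      using tr[of z] tr_eq[OF bil_\<alpha>] by simp
    ultimately have rn2: "2 * rn z = (\<Sum>k\<in>UNIV. \<beta> W4 (f k) (f k) z)" for z
      unfolding sum UNIV_su3_class by (simp add: sum.distrib)
    have rn: "rn z = 2 * \<tau> z" for z
      using rn2[of z] class_W4_tr(1)[OF \<tau>, of z] by linarith
    have "(\<forall>x y z. \<beta> W4 x y z = 0) \<longleftrightarrow> (\<forall>x. rn x = 0)"
    proof
      assume "\<forall>x y z. \<beta> W4 x y z = 0"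
      then show "\<forall>x. rn x = 0"
        using class_W4_tr(1)[OF \<tau>] rn by simp
    next
      assume "\<forall>x. rn x = 0"
      then show "\<forall>x y z. \<beta> W4 x y z = 0"
        using rn by (simp add: \<tau>(2))
    qed
    then show ?thesis by (simp only: zero)
  qed
  have z5: "\<forall>x. L W5 x = 0"
    by (simp add: L_def)
  have all: "(\<forall>k. k \<notin> U \<longrightarrow> Q k) \<longleftrightarrow> (W1p \<in> U \<or> Q W1p) \<and> (W1m \<in> U \<or> Q W1m) \<and> (W2p \<in> U \<or> Q W2p)
      \<and> (W2m \<in> U \<or> Q W2m) \<and> (W3 \<in> U \<or> Q W3) \<and> (W4 \<in> U \<or> Q W4) \<and> (W5 \<in> U \<or> Q W5)" for Q
  proof -
    have "(\<forall>k. k \<notin> U \<longrightarrow> Q k) \<longleftrightarrow> (\<forall>k\<in>UNIV. k \<in> U \<or> Q k)" by blast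
    then show ?thesis unfolding UNIV_su3_class by simp
  qed
  show ?classes
    unfolding in_classes_iff[OF mem sum, of U] zero all z1 z2 z3 z4 using z5 by simp
qed

end

end

section \<open>Torsion identities and unitary frames adapted to a three-form\<close>

context su3_frame
begin

lemma J_anti: "G x (J y) = - G y (J x)"
  using J_skew[of y x] sym[of x "J y"] by simp

text \<open>For \<open>a\<close> the image of a direction under \<open>A\<close>, this says that
  \<xi> compensates the terms with \<open>A\<close> in the derivative of \<open>Phi\<close>. Once
  every \<open>V\<close> stands in the first slot, \<open>Phi_V\<close> leaves a polynomial in inner
  products.\<close>

lemma torsion_identity_1:
  "G a u * G (J v) z - G a v * G (J u) z + G a z * G (J u) v
    + 1 / 2 * (Phi (J (V u a)) v z + Phi u (J (V v a)) z + Phi u v (J (V z a))) = 0"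
proof -
  have e: "Phi (J (V u a)) v z = Phi (V u a) (J v) z" "Phi u (J (V v a)) z = - Phi (V v a) (J u) z"
      "Phi u v (J (V z a)) = Phi (V z a) (J u) v"
    using Phi_J(1)[of "V u a" v z] Phi_skew(1)[of u "J (V v a)" z] Phi_J(1)[of "V v a" u z]
      Phi_rot[of u v "J (V z a)"] Phi_J(1)[of "V z a" u v] by linarith+
  show ?thesis
    unfolding e Phi_V J_isometry J_skew J_J G_simps J_anti[of z v] J_anti[of z u] J_anti[of v u]
      J_anti[of u a] J_anti[of v a] J_anti[of z a]
      sym[of u a] sym[of v a] sym[of z a] sym[of z u] sym[of v u] sym[of z v]
    by algebra
qed

text \<open>The analogue for \<open>Phi\<close> with \<open>J\<close> in its first slot; the single
  term \<open>Phi (V u a) v z\<close> comes from the derivative of that \<open>J\<close>.\<close>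

lemma torsion_identity_2:
  "G a (J u) * G (J v) z + G a v * G u z - G a z * G u v + Phi (V u a) v z
    - 1 / 2 * (Phi (V u a) v z + Phi u (V v a) z + Phi u v (V z a)) = 0"
proof -
  have e: "Phi u (V v a) z = - Phi (V v a) u z" "Phi u v (V z a) = Phi (V z a) u v"
    using Phi_skew(1)[of u "V v a" z] Phi_rot[of u v "V z a"] by linarith+
  show ?thesis
    unfolding e Phi_V J_isometry J_skew J_J G_simps J_anti[of z v] J_anti[of z u] J_anti[of v u]
      J_anti[of u a] J_anti[of v a] J_anti[of z a]
      sym[of u a] sym[of v a] sym[of z a] sym[of z u] sym[of v u] sym[of z v]
    by algebra
qed

end

lemma (in inner_form) unit_vector: "x \<noteq> 0 \<Longrightarrow> \<exists>c. G (c *\<^sub>R x) (c *\<^sub>R x) = 1"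
  by (rule exI[of _ "1 / sqrt (G x x)"]) (use pos[of x] in \<open>simp add: G_simps real_sqrt_mult_self field_simps\<close>)

text \<open>Two Hermitian-orthonormal vectors can be chosen freely; the third is their cross product
  with respect to \<open>F\<close>, of length one by the last hypothesis. A complex alternating
  trilinear form in dimension three is fixed by its value on a basis, which identifies
  \<open>F\<close> with the real part of the determinant.\<close>

lemma su3_frame_exists:
  fixes G :: "real ^ 6 \<Rightarrow> real ^ 6 \<Rightarrow> real"
  assumes G: "inner_form G" and F: "trilinear F"
    and F_skew: "\<And>x y z. F y x z = - F x y z" "\<And>x y z. F x z y = - F x y z"
    and J: "linear J" "\<And>x. J (J x) = - x" "\<And>x y. G (J x) y = - G x (J y)"
    and FJ: "\<And>x y z. F x (J y) z = F (J x) y z"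
    and unit: "\<And>x y z. G x x = 1 \<Longrightarrow> G y y = 1 \<Longrightarrow> G x y = 0 \<Longrightarrow> G (J x) y = 0 \<Longrightarrow>
      (\<And>v. G z v = F x y v) \<Longrightarrow> G z z = 1"
  obtains f where "su3_frame G J F f"
proof -
  interpret inner_form G by (rule G)
  note F_simps = trilinear_simps[OF F]
  note J_simps = linear_add[OF J(1)] linear_cmul[OF J(1)] linear_neg[OF J(1)]
  have F_rot: "F y z x = F x y z" for x y z
    using F_skew(1)[of x y z] F_skew(2)[of y x z] by linarith
  have F_same: "F x x z = 0" "F x z z = 0" "F x z x = 0" for x z
    using F_skew(1)[of x x z] F_skew(2)[of x z z] F_skew(1)[of x z x] F_skew(2)[of z x x] by linarith+
  have FJ': "F x y (J z) = F (J x) y z" for x y z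
    using F_rot[of x y "J z"] F_rot[of "J x" y z] FJ[of z x y] by simp
  have J_iso: "G (J x) (J y) = G x y" for x y
    by (simp add: J G_simps)
  have J_orth: "G x (J x) = 0" "G (J x) x = 0" for x
    using J(3)[of x x] sym[of x "J x"] by simp_all
  have "axis 0 1 \<noteq> (0 :: real ^ 6)" by simp
  then obtain x0 where x0: "G x0 x0 = 1"
    using unit_vector by blast
  \<comment> \<open>A nonzero vector in the kernel of this map to the plane is orthogonal to
    \<open>x0\<close> and \<open>J x0\<close>.\<close>
  define L where "L = (\<lambda>y. (G x0 y, G (J x0) y))"
  have L: "linear L"
    by (rule linearI) (simp_all add: L_def G_simps)
  have "\<not> inj L"
  proof
    assume "inj L"
    then have "dim (range L) = 6"
      using dim_image_eq[OF L, of UNIV] by (simp add: inj_on_subset)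
    then show False
      using dim_subset_UNIV[of "range L"] by simp
  qed
  then obtain y where "L y = 0" "y \<noteq> 0"
    using linear_injective_0[OF L] by blast
  then obtain k where "G (k *\<^sub>R y) (k *\<^sub>R y) = 1"
    using unit_vector by blast
  then obtain x1 where x1: "G x1 x1 = 1" "G x0 x1 = 0" "G (J x0) x1 = 0"
    using \<open>L y = 0\<close> by (intro that[of "k *\<^sub>R y"]) (simp_all add: L_def G_simps zero_prod_def)
  obtain x2 where x2: "\<And>v. G x2 v = F x0 x1 v"
    using riesz[of "F x0 x1"] trilinear_linear(3)[OF F] by blast
  have x22: "G x2 x2 = 1"
    by (rule unit[OF x0 x1 x2])
  have o2: "G x2 x0 = 0" "G x2 x1 = 0" "G x2 (J x0) = 0" "G x2 (J x1) = 0"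
    by (simp_all only: x2 F_same FJ') (simp_all only: F_same flip: FJ)
  have o1: "G x1 x0 = 0" "G x0 (J x1) = 0" "G x1 (J x0) = 0" "G x0 x2 = 0" "G x1 x2 = 0"
      "G x0 (J x2) = 0" "G x1 (J x2) = 0"
    using x1(2) x1(3) o2 J(3)[of x0 x1] J(3)[of x2 x0] J(3)[of x2 x1]
      sym[of x1 x0] sym[of x1 "J x0"] sym[of x0 x2] sym[of x1 x2] sym[of x0 "J x2"] sym[of x1 "J x2"]
    by linarith+
  define f :: "6 \<Rightarrow> real ^ 6" where "f = (\<lambda>k. if k = 0 then x0 else if k = 1 then J x0 else if k = 2 then x1
    else if k = 3 then J x1 else if k = 4 then x2 else J x2)"
  have fk: "f 0 = x0" "f 1 = J x0" "f 2 = x1" "f 3 = J x1" "f 4 = x2" "f 5 = J x2"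
    by (simp_all add: f_def)
  have frame: "orthonormal_frame G f"
    unfolding orthonormal_frame_def forall_6 fk
    by (simp add: x0 x1(1,2) x22 o1 o2 J J_orth(1) G_simps)
  \<comment> \<open>The imaginary part is the one that makes \<open>D\<close> complex-linear for
    \<open>J\<close>.\<close>
  define D where "D = (\<lambda>x y z. Complex (F x y z) (- F (J x) y z))"
  have D_add: "D (x + x') y z = D x y z + D x' y z" and D_scale: "D (c *\<^sub>R x) y z = of_real c * D x y z"
    and D_J: "D (J x) y z = \<i> * D x y z" for x x' y z c
    by (simp_all add: D_def complex_eq_iff F_simps J_simps J)
  have D_skew1: "D y x z = - D x y z" for x y z
  proof -
    have "F y x z = - F x y z" "F (J y) x z = - F (J x) y z"
      using F_skew(1)[of x y z] F_skew(1)[of y x z] F_skew(1)[of x "J y" z] F_skew(1)[of "J y" x z] FJ[of x y z]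
      by linarith+
    then show ?thesis
      unfolding D_def complex_eq_iff by simp
  qed
  have D_skew2: "D x z y = - D x y z" for x y z
  proof -
    have "F x z y = - F x y z" "F (J x) z y = - F (J x) y z"
      by (rule F_skew(2))+
    then show ?thesis
      unfolding D_def complex_eq_iff by simp
  qed
  note D_skew = D_skew1 D_skew2
  define a b c where "a = (\<lambda>v. Complex (G v (f 0)) (G v (f 1)))"
    and "b = (\<lambda>v. Complex (G v (f 2)) (G v (f 3)))" and "c = (\<lambda>v. Complex (G v (f 4)) (G v (f 5)))"
  have D1: "D v y z = a v * D x0 y z + b v * D x1 y z + c v * D x2 y z" for v y z
  proof -
    have "v = G v x0 *\<^sub>R x0 + G v (J x0) *\<^sub>R J x0 + G v x1 *\<^sub>R x1 + G v (J x1) *\<^sub>R J x1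
        + G v x2 *\<^sub>R x2 + G v (J x2) *\<^sub>R J x2"
      using frame_expansion[OF frame, of v] by (simp add: sum_6 fk)
    from arg_cong[OF this, of "\<lambda>v. D v y z"]
    have "D v y z = of_real (G v x0) * D x0 y z + of_real (G v (J x0)) * (\<i> * D x0 y z)
        + of_real (G v x1) * D x1 y z + of_real (G v (J x1)) * (\<i> * D x1 y z)
        + of_real (G v x2) * D x2 y z + of_real (G v (J x2)) * (\<i> * D x2 y z)"
      by (simp only: D_add D_scale D_J)
    then show ?thesis
      by (simp add: a_def b_def c_def fk complex_eq_iff algebra_simps)
  qed
  have D2: "D y v z = a v * D y x0 z + b v * D y x1 z + c v * D y x2 z" for v y z
    unfolding D_skew1[of y v z] D_skew1[of y x0 z] D_skew1[of y x1 z] D_skew1[of y x2 z] D1[of v y z]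
    by (simp add: algebra_simps)
  have D3: "D y z v = a v * D y z x0 + b v * D y z x1 + c v * D y z x2" for v y z
    unfolding D_skew2[of y z v] D_skew2[of y z x0] D_skew2[of y z x1] D_skew2[of y z x2] D2[of y v z]
    by (simp add: algebra_simps)
  have D012: "D x0 x1 x2 = 1"
    using x2[of x2] x2[of "J x2"] x22 FJ'[of x0 x1 x2] J_orth[of x2] by (simp add: D_def complex_eq_iff)
  have D_same: "D x x z = 0" "D x z z = 0" "D x z x = 0" for x z
  proof -
    have 0: "d = 0" if "d = - d" for d :: complex
      using that by (metis add.right_inverse mult_2 mult_eq_0_iff zero_neq_numeral)
    show "D x x z = 0" "D x z z = 0"
      by (rule 0, rule D_skew1, rule 0, rule D_skew2)
    then show "D x z x = 0"
      using D_skew2[of x z x] by simp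
  qed
  have perm: "D x0 x2 x1 = - 1" "D x1 x0 x2 = - 1" "D x1 x2 x0 = 1" "D x2 x0 x1 = 1" "D x2 x1 x0 = - 1"
    by (simp_all add: D_skew2[of x0 x2 x1] D_skew1[of x1 x0 x2] D_skew2[of x1 x2 x0] D_skew1[of x2 x0 x1]
        D_skew1[of x2 x1 x0] D012)
  have D: "D x y z = a x * (b y * c z - c y * b z) - b x * (a y * c z - c y * a z) + c x * (a y * b z - b y * a z)"
    for x y z
    unfolding D1[of x] D2[of _ y] D3[of _ _ z] D_same perm D012 by (simp add: algebra_simps)
  have "F x y z = Re (D x y z)" for x y z
    by (simp add: D_def)
  then have det: "F x y z = Re (a x * (b y * c z - c y * b z) - b x * (a y * c z - c y * a z) + c x * (a y * b z - b y * a z))"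
    for x y z unfolding D .
  have "su3_frame G J F f"
    by unfold_locales (simp_all add: frame fk J J_iso G_simps det a_def b_def c_def Let_def)
  then show ?thesis by (rule that)
qed

section \<open>The torsion of the induced SU(3)-structure\<close>

context g2_hypersurface_point
begin

lemma Q_normal: "Q nn (i p u) (i p v) (i p w) = - Phi a p (Jp u) v w"
  using n_normal f_rot[of "i p v" "i p w" "i p (Jp u)"] sym[of "P nn (i p u)" "P (i p v) (i p w)"]
  by (simp add: star_eq Phi_eq Jp_eq cross_inner)

lemma Phi_skew: "Phi a p v u w = - Phi a p u v w" "Phi a p u w v = - Phi a p u v w"
  unfolding Phi_eq by (rule f_skew)+

lemma Gp_J: "Gp (Jp u) v = fp nn (i p u) (i p v)"
  by (simp add: Gp_eq Jp_eq cross_inner)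

lemma Jp_Jp: "Jp (Jp u) = - u"
  by (rule i_inj) (simp add: Jp_eq cross_cross n_normal i_simps)

lemma Gp_J_skew: "Gp (Jp u) v = - Gp u (Jp v)"
  using f_skew(2)[of nn "i p u" "i p v"] sym[of "i p u" "i p (Jp v)"]
  by (simp add: Gp_J) (simp add: Gp_eq Jp_eq cross_inner)

text \<open>By \<open>Q_normal\<close> both sides are values of the four-form contracted with
  \<open>n\<close>, and the middle skew-symmetry of the four-form equates them.\<close>

lemma Phi_Jp: "Phi a p u (Jp v) w = Phi a p (Jp u) v w"
  using Q_normal[of u v w] Q_normal[of v u w] star_skew(2)[of nn "i p v" "i p u" "i p w"]
    Phi_skew(1)[of u "Jp v" w] by linarith

lemma ex_su3_frame: "\<exists>f. su3_frame Gp Jp (Phi a p) f"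
proof (rule su3_frame_exists[of Gp "Phi a p" Jp, OF inner_form_Gp trilinear_Phi Phi_skew
      linear_J[OF p] Jp_Jp Gp_J_skew Phi_Jp])
  fix x y z
  assume xy: "Gp x x = 1" "Gp y y = 1" "Gp x y = 0" "Gp (Jp x) y = 0" and z: "\<And>v. Gp z v = Phi a p x y v"
  \<comment> \<open>The normal component of the cross product is \<open>Gp (Jp x) y\<close>, which
    vanishes by assumption; the product is thus tangent and represents \<open>z\<close>.\<close>
  have "gp (P (i p x) (i p y)) nn = 0"
    using f_rot[of "i p x" "i p y" nn] xy(4) by (simp add: cross_inner Gp_J)
  then obtain u where u: "i p u = P (i p x) (i p y)"
    using tangent by blast
  have "Gp u v = Gp z v" for v
    unfolding z by (simp add: Phi_eq Gp_eq u cross_inner)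
  then have "u = z"
    by (rule inner_form.nondegenerate[OF inner_form_Gp])
  moreover have "gp (P (i p x) (i p y)) (P (i p x) (i p y)) = 1"
    using star_eq[of "i p x" "i p y" "i p x" "i p y"] star_skew(2)[of "i p x" "i p x" "i p y" "i p y"]
      star_skew(1)[of "i p x" "i p x" "i p y" "i p y"] xy(1-3) sym[of "i p y" "i p x"]
    by (simp add: Gp_eq)
  ultimately show "Gp z z = 1"
    by (simp add: Gp_eq flip: u)
next
  show "\<exists>f. su3_frame Gp Jp (Phi a p) f" if "su3_frame Gp Jp (Phi a p) f" for f
    using that by blast
qed

definition "frm = (SOME f. su3_frame Gp Jp (Phi a p) f)"

sublocale su3: su3_frame Gp Jp "Phi a p" frm
  unfolding frm_def using ex_su3_frame by (rule someI_ex)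

abbreviation "rb \<equiv> rbar g \<phi> c (\<iota> p)"
definition "r u v = rb (i p u) (i p v)"
definition "rn u = rb (i p u) nn"

lemma torsion: "\<exists>\<rho>. (\<forall>x y z. T w x y z = Q \<rho> x y z) \<and> (\<forall>v. gp \<rho> v = rb w v)"
  by (rule g2_torsion[OF riem g2 c])

lemma pull2_r: "r\<^sub>M a p = r"
  by (intro ext) (simp add: pull2_def r_def c_def Let_def)

lemma normal_part_rn: "r\<^sub>n a p = rn"
  by (intro ext) (simp add: normal_part_def rn_def c_def Let_def)

section \<open>Consequences of type X2 on the hypersurface\<close>

context
  assumes X2: "g2_type_X2 Ab g \<phi>"
begin

lemma rb_skew: "rb x y = - rb y x"
  using X2 c unfolding g2_type_X2_def everywhere_def by blast

text \<open>In the second argument \<open>rb\<close> is an inner product with a fixed vector;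
  skew-symmetry transfers linearity to the first.\<close>

lemma bilinear_rb: "bilinear rb"
proof -
  have lin: "linear (rb x)" for x
  proof -
    obtain \<rho> where "\<And>v. gp \<rho> v = rb x v" using torsion by blast
    then have "rb x = gp \<rho>" by (simp add: fun_eq_iff)
    then show ?thesis using bil by (simp add: bilinear_def)
  qed
  moreover have "linear (\<lambda>x. rb x y)" for y
  proof -
    have "linear (\<lambda>x. - rb y x)"
      using lin by (rule linear_compose_neg)
    moreover have "(\<lambda>x. rb x y) = (\<lambda>x. - rb y x)"
      by (intro ext) (rule rb_skew)
    ultimately show ?thesis by (simp only:)
  qed
  ultimately show ?thesis by (simp add: bilinear_def)
qed

lemmas rb_simps = bilinear_simps[OF bilinear_rb]

lemma bilinear_r: "bilinear r"
  by (auto simp: bilinear_def r_def i_simps rb_simps intro!: linearI)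

lemma r_skew: "r u v = - r v u"
  unfolding r_def by (rule rb_skew)

lemma linear_rn: "linear rn"
  by (rule linearI) (simp_all add: rn_def i_simps rb_simps)

text \<open>The condition on the torsion, evaluated in the frame that consists of the unit normal and a
  tangent frame.\<close>

lemma X2_frame:
  "2 * (\<Sum>l\<in>UNIV. fp x nn (i p (frm l)) * rb nn (i p (frm l))) +
    (\<Sum>k\<in>UNIV. \<Sum>l\<in>UNIV. fp x (i p (frm k)) (i p (frm l)) * r (frm k) (frm l)) = 0"
proof -
  define E :: "7 \<Rightarrow> real ^ 7" where "E = (\<lambda>k. if k = 0 then nn else if k = 1 then i p (frm 0)
    else if k = 2 then i p (frm 1) else if k = 3 then i p (frm 2) else if k = 4 then i p (frm 3)
    else if k = 5 then i p (frm 4) else i p (frm 5))"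
  have Ek: "E 0 = nn" "E 1 = i p (frm 0)" "E 2 = i p (frm 1)" "E 3 = i p (frm 2)" "E 4 = i p (frm 3)"
      "E 5 = i p (frm 4)" "E 6 = i p (frm 5)"
    by (simp_all add: E_def)
  have on: "orthonormal_frame gp E"
    unfolding orthonormal_frame_def forall_7 Ek
    by (simp add: n_normal su3.frame_orthonormal[OF su3.frame] flip: Gp_eq)
  define b where "b = (\<lambda>x. \<Sum>j\<in>UNIV. \<Sum>k\<in>UNIV. fp x (E j) (E k) * rb (E j) (E k))"
  have "b (E m) = 0" for m
    using X2 c on unfolding g2_type_X2_def everywhere_def b_def by blast
  moreover have "linear b"
    by (rule linearI) (simp_all add: b_def f_simps algebra_simps sum.distrib sum_distrib_left)
  ultimately have "b x = 0"
    by (subst frame_expansion[OF on, of x]) (simp add: linear_sum linear_cmul)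
  moreover have "fp x (i p u) nn * rb (i p u) nn = fp x nn (i p u) * rb nn (i p u)" for u
    using f_skew(2)[of x "i p u" nn] rb_skew[of "i p u" nn] by simp
  moreover have "fp x nn nn = 0" by (rule f_same)
  ultimately show ?thesis
    unfolding b_def sum_7 sum_6 Ek r_def by simp
qed

text \<open>The normal component of the g2 condition: contracting \<phi> with \<open>n\<close> gives
  the Kaehler form up to sign.\<close>

lemma r_omega: "(\<Sum>k\<in>UNIV. r (frm k) (Jp (frm k))) = 0"
proof -
  have "(\<Sum>l\<in>UNIV. fp nn (i p (frm k)) (i p (frm l)) * r (frm k) (frm l)) = r (frm k) (Jp (frm k))" for k
    using arg_cong[OF su3.frame_expansion[OF su3.frame, of "Jp (frm k)"], of "r (frm k)"]
    by (simp add: bilinear_simps[OF bilinear_r] Gp_J)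
  then show ?thesis
    using X2_frame[of nn] by (simp add: f_same)
qed

text \<open>The tangential component of the g2 condition. Pairs of indices containing
  \<open>n\<close> occur in both orders, whence the factor 2.\<close>

lemma r_Phi: "(\<Sum>k\<in>UNIV. \<Sum>l\<in>UNIV. Phi a p (Jp z) (frm k) (frm l) * r (frm k) (frm l)) = 2 * rn z"
proof -
  have "fp (i p (Jp z)) nn (i p u) = Gp z u" for u
    using f_skew(1)[of "i p (Jp z)" nn "i p u"] Gp_J[of "Jp z" u]
    by (simp add: Jp_Jp su3.G_simps)
  moreover have "rb nn (i p u) = - rn u" for u
    unfolding rn_def by (rule rb_skew)
  moreover have "(\<Sum>l\<in>UNIV. Gp z (frm l) * rn (frm l)) = rn z"
    by (subst (2) su3.frame_expansion[OF su3.frame, of z])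
      (simp add: linear_sum[OF linear_rn] linear_cmul[OF linear_rn])
  ultimately show ?thesis
    using X2_frame[of "i p (Jp z)"] by (simp add: Phi_eq sum_negf)
qed

text \<open>The endomorphism A that carries the whole torsion of \<omega>; the letter itself denotes
  the atlas.\<close>

definition "tens w = su3.dual (\<lambda>u v. B u v + r u (Jp v)) w"

lemma A_eq: "Gp (tens w) v = B w v + r w (Jp v)"
proof -
  have "bilinear (\<lambda>u v. B u v + r u (Jp v))"
    by (auto simp: bilinear_def bilinear_simps[OF bilinear_B] bilinear_simps[OF bilinear_r] su3.J_simps
        algebra_simps intro!: linearI)
  from su3.dual_inner[OF this] show ?thesis by (simp add: tens_def)
qed

text \<open>The dual vector of \<open>rb\<close> in direction \<open>w\<close> is split into its
  tangential part \<open>\<rho>\<close> and its normal part, whose coefficient is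
  \<open>rn w\<close>.\<close>

lemma torsion_split:
  "\<exists>\<rho>. (\<forall>x y z. T (i p w) x y z = Q (i p \<rho>) x y z + rn w * Q nn x y z) \<and>
    (\<forall>v. Gp \<rho> v = r w v) \<and> (\<forall>v. Gp (tens w) v = B w v - Gp (Jp \<rho>) v)"
proof -
  obtain R where R: "\<And>x y z. T (i p w) x y z = Q R x y z" "\<And>v. gp R v = rb (i p w) v"
    using torsion by blast
  have "gp (R - rn w *\<^sub>R nn) nn = 0"
    by (simp add: G_simps n_normal R(2) rn_def)
  then obtain \<rho> where \<rho>: "i p \<rho> = R - rn w *\<^sub>R nn"
    using tangent by blast
  have "R = i p \<rho> + rn w *\<^sub>R nn" by (simp add: \<rho>)
  then have "T (i p w) x y z = Q (i p \<rho>) x y z + rn w * Q nn x y z" for x y z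
    using linear_add[OF linear_star[of x y z]] linear_cmul[OF linear_star[of x y z]] by (simp add: R(1))
  moreover have r: "Gp \<rho> v = r w v" for v
    by (simp add: Gp_eq \<rho> G_simps n_normal R(2) r_def)
  moreover have "Gp (tens w) v = B w v - Gp (Jp \<rho>) v" for v
    by (simp add: A_eq su3.J_skew r)
  ultimately show ?thesis by blast
qed

text \<open>The normal part of the torsion vector drops out by a repeated \<open>n\<close>. The
  tangential part contributes \<open>Jp \<rho>\<close> and the Weingarten map contributes
  \<open>s\<close>; together they are minus \<open>tens w\<close>.\<close>

lemma nabla_omega_A: "nabla_omega gM J a p w u v = Phi a p (tens w) u v"
proof -
  obtain \<rho> where \<rho>: "\<And>x y z. T (i p w) x y z = Q (i p \<rho>) x y z + rn w * Q nn x y z"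
    "\<And>v. Gp \<rho> v = r w v" "\<And>v. Gp (tens w) v = B w v - Gp (Jp \<rho>) v"
    using torsion_split[of w] by blast
  have "T (i p w) nn (i p v) (i p u) = - Q nn (i p \<rho>) (i p v) (i p u)"
    using star_skew(1)[of nn nn "i p v" "i p u"] star_skew(1)[of "i p \<rho>" nn "i p v" "i p u"]
    by (simp add: \<rho>(1))
  then have 1: "T (i p w) nn (i p v) (i p u) = Phi a p (Jp \<rho>) v u"
    by (simp add: Q_normal)
  obtain s where s: "i p s = W w"
    using tangent[OF W_normal] by blast
  have "tens w = - (Jp \<rho> + s)"
    by (rule su3.nondegenerate) (simp add: \<rho>(3) su3.G_simps Gp_eq[of s] s W_tangent)
  then have "Phi a p (tens w) u v = Phi a p (Jp \<rho>) v u + Phi a p s v u"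
    using Phi_skew(2)[of "Jp \<rho>" v u] Phi_skew(2)[of s v u] by (simp add: su3.Phi_simps)
  then show ?thesis
    by (simp add: nabla_omega_eq 1 Phi_eq[of s] s)
qed

lemma cov_J_A: "cov_endo C J a p w v = su3.V v (tens w)"
proof (rule su3.nondegenerate)
  fix u
  show "Gp (cov_endo C J a p w v) u = Gp (su3.V v (tens w)) u"
    using cov_J[of w u v] su3.sym[of u] su3.Phi_rot[of "tens w" u v]
    by (simp add: nabla_omega_A su3.V_inner)
qed

text \<open>The normal part of the torsion vector gives the rotation term with \<open>rn\<close>.
  The tangential part is expanded by \<open>star_eq\<close>, and \<open>Jp \<rho>\<close> combines
  with \<open>B\<close> from \<open>cov_Phi\<close> into \<open>tens w\<close>.\<close>

lemma cov_Phi_A: "cov3 C Phi a p w u v z = - rn w * Phi a p (Jp u) v z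
    + (Gp (tens w) u * Gp (Jp v) z - Gp (tens w) v * Gp (Jp u) z + Gp (tens w) z * Gp (Jp u) v)"
proof -
  obtain \<rho> where \<rho>: "\<And>x y z. T (i p w) x y z = Q (i p \<rho>) x y z + rn w * Q nn x y z"
    "\<And>v. Gp \<rho> v = r w v" "\<And>v. Gp (tens w) v = B w v - Gp (Jp \<rho>) v"
    using torsion_split[of w] by blast
  have P\<rho>: "P (i p \<rho>) (i p u) = i p (su3.V \<rho> u) + Gp (Jp \<rho>) u *\<^sub>R nn"
  proof -
    have "gp (P (i p \<rho>) (i p u) - Gp (Jp \<rho>) u *\<^sub>R nn) nn = 0"
      using f_rot[of "i p \<rho>" "i p u" nn] by (simp add: G_simps n_normal cross_inner Gp_J)
    then obtain s where s: "i p s = P (i p \<rho>) (i p u) - Gp (Jp \<rho>) u *\<^sub>R nn"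
      using tangent by blast
    have "s = su3.V \<rho> u"
      by (rule su3.nondegenerate) (simp add: su3.V_inner Gp_eq[of s] s G_simps cross_inner n_normal Phi_eq)
    then show ?thesis using s by (simp add: algebra_simps)
  qed
  have "gp (P (i p \<rho>) (i p u)) (P (i p v) (i p z)) = Phi a p (su3.V \<rho> u) v z + Gp (Jp \<rho>) u * Gp (Jp v) z"
    using f_rot[of "i p (su3.V \<rho> u)" "i p v" "i p z"] sym[of "i p (su3.V \<rho> u)" "P (i p v) (i p z)"]
      sym[of nn "P (i p v) (i p z)"] f_rot[of "i p v" "i p z" nn]
      f_rot[of "i p v" "i p z" "i p (su3.V \<rho> u)"]
    by (simp add: P\<rho> G_simps cross_inner Gp_J Phi_eq)
  then have "Q (i p \<rho>) (i p u) (i p v) (i p z) =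
      Gp (Jp \<rho>) v * Gp (Jp u) z - Gp (Jp \<rho>) z * Gp (Jp u) v - Gp (Jp \<rho>) u * Gp (Jp v) z"
    by (simp add: star_eq su3.Phi_V flip: Gp_eq)
  then show ?thesis
    using su3.J_skew[of z u] su3.sym[of z "Jp u"]
    unfolding cov_Phi \<rho>(1) Q_normal by (simp add: \<rho>(3) algebra_simps flip: Gp_J)
qed

section \<open>The connection adapted to the SU(3)-structure and the one-form \<eta>\<close>

context
  fixes \<theta> :: "'a \<Rightarrow> real"
  assumes \<theta>: "smooth_function A \<theta>"
begin

abbreviation "d\<theta> \<equiv> cderiv a \<theta> p"

lemma linear_d\<theta>: "linear d\<theta>"
  using has_derivative_linear[OF has_derivative_\<theta>[OF \<theta>]] .

lemma su3_connection_eq: "su3_connection gM J \<mu> a p w u =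
    C w u + (act_form Jp \<mu> w *\<^sub>R Jp u - (1 / 2) *\<^sub>R Jp (su3.V u (tens w)))"
  by (simp add: su3_connection_def cov_J_A)

text \<open>This holds for every \<open>\<mu>\<close>, as its term acts by a multiple of the skew
  endomorphism \<open>J\<close>. The two slots of \<xi> contribute minus one half of the derivative
  of \<omega> each.\<close>

lemma su3_connection_omega: "cov2 (su3_connection gM J \<mu> a p) (kaehler_form gM J) a p w u v = 0"
proof -
  have "cov2 (su3_connection gM J \<mu> a p) (kaehler_form gM J) a p w u v = nabla_omega gM J a p w u v
      + (1 / 2) * (Gp (Jp (su3.V u (tens w))) (Jp v) + Gp u (Jp (Jp (su3.V v (tens w)))))"
    by (simp add: nabla_omega_def cov2_def su3_connection_eq kaehler_form_def su3.G_simps su3.J_simps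
        su3.J_isometry su3.J_J algebra_simps)
  also have "Gp (Jp (su3.V u (tens w))) (Jp v) = - Phi a p (tens w) u v"
    using su3.Phi_skew(1)[of u "tens w" v] by (simp add: su3.J_isometry su3.V_inner)
  also have "Gp u (Jp (Jp (su3.V v (tens w)))) = - Phi a p (tens w) u v"
    using su3.Phi_rot[of v "tens w" u] su3.Phi_rot[of "tens w" u v] su3.sym[of u "su3.V v (tens w)"]
    by (simp add: su3.J_J su3.G_simps su3.V_inner)
  finally show ?thesis
    by (simp add: nabla_omega_A)
qed

text \<open>After \<xi> has compensated the terms with \<open>tens\<close>, only an infinitesimal
  phase rotation by \<open>k\<close> is left. The factor 3 counts the slots in which
  \<open>J\<close> acts, with equal effect in each.\<close>

lemma su3_connection_psi:
  fixes \<mu> w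
  defines "k \<equiv> d\<theta> w - rn w - 3 * act_form Jp \<mu> w"
  shows "cov3 (su3_connection gM J \<mu> a p) (psi_p \<theta>) a p w u v z =
      k * (cos (\<theta> p) * Phi a p (Jp u) v z - sin (\<theta> p) * Phi a p u v z)" (is ?p)
    and "cov3 (su3_connection gM J \<mu> a p) (psi_m \<theta>) a p w u v z =
      k * (sin (\<theta> p) * Phi a p (Jp u) v z + cos (\<theta> p) * Phi a p u v z)" (is ?m)
proof -
  define t where "t = act_form Jp \<mu> w"
  define V where "V = (\<lambda>u. su3.V u (tens w))"
  define E where "E = (\<lambda>u. t *\<^sub>R Jp u - (1 / 2) *\<^sub>R Jp (V u))"
  have D: "su3_connection gM J \<mu> a p w u = C w u + E u" for u
    by (simp add: su3_connection_eq t_def E_def V_def)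
  have JE: "Jp (E u) = (1 / 2) *\<^sub>R V u - t *\<^sub>R u" for u
    by (simp add: E_def su3.J_simps su3.J_J)
  have e1: "Phi a p (E u) v z + Phi a p u (E v) z + Phi a p u v (E z) = 3 * t * Phi a p (Jp u) v z
      - 1 / 2 * (Phi a p (Jp (V u)) v z + Phi a p u (Jp (V v)) z + Phi a p u v (Jp (V z)))"
    by (simp add: E_def su3.Phi_simps su3.Phi_J algebra_simps)
  have e2: "Phi a p (Jp (E u)) v z + Phi a p (Jp u) (E v) z + Phi a p (Jp u) v (E z) = - 3 * t * Phi a p u v z
      + 1 / 2 * (Phi a p (V u) v z + Phi a p u (V v) z + Phi a p u v (V z))"
    unfolding su3.Phi_J(1)[of u "E v" z, symmetric] su3.Phi_J(2)[of u v "E z", symmetric] JE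
    by (simp add: su3.Phi_simps algebra_simps)
  have x1: "cov3 C Phi a p w u v z = - rn w * Phi a p (Jp u) v z
      - 1 / 2 * (Phi a p (Jp (V u)) v z + Phi a p u (Jp (V v)) z + Phi a p u v (Jp (V z)))"
    using su3.torsion_identity_1[of "tens w" u v z] by (simp add: cov_Phi_A V_def)
  have x2: "cov3 C Phi a p w (Jp u) v z + Phi a p (V u) v z = rn w * Phi a p u v z
      + 1 / 2 * (Phi a p (V u) v z + Phi a p u (V v) z + Phi a p u v (V z))"
    using su3.torsion_identity_2[of "tens w" u v z]
    by (simp add: cov_Phi_A V_def su3.J_J su3.G_simps su3.Phi_simps)
  have VJ: "cov_endo C J a p w u = V u"
    by (simp add: cov_J_A V_def)
  have k: "d\<theta> w = k + rn w + 3 * t" by (simp add: k_def t_def)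
  have s1: "psi_p \<theta> a p (E u) v z + psi_p \<theta> a p u (E v) z + psi_p \<theta> a p u v (E z) =
      cos (\<theta> p) * (Phi a p (E u) v z + Phi a p u (E v) z + Phi a p u v (E z))
      + sin (\<theta> p) * (Phi a p (Jp (E u)) v z + Phi a p (Jp u) (E v) z + Phi a p (Jp u) v (E z))"
    by (simp add: psi_eq[OF \<theta> p] algebra_simps)
  have s2: "psi_m \<theta> a p (E u) v z + psi_m \<theta> a p u (E v) z + psi_m \<theta> a p u v (E z) =
      sin (\<theta> p) * (Phi a p (E u) v z + Phi a p u (E v) z + Phi a p u v (E z))
      - cos (\<theta> p) * (Phi a p (Jp (E u)) v z + Phi a p (Jp u) (E v) z + Phi a p (Jp u) v (E z))"
    by (simp add: psi_eq[OF \<theta> p] algebra_simps)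
  have "cov3 (su3_connection gM J \<mu> a p) (psi_p \<theta>) a p w u v z =
      cos (\<theta> p) * (cov3 C Phi a p w u v z + d\<theta> w * Phi a p (Jp u) v z)
      + sin (\<theta> p) * ((cov3 C Phi a p w (Jp u) v z + Phi a p (V u) v z) - d\<theta> w * Phi a p u v z)
      - (psi_p \<theta> a p (E u) v z + psi_p \<theta> a p u (E v) z + psi_p \<theta> a p u v (E z))"
    unfolding cov_psi(1)[where D = "su3_connection gM J \<mu> a p" and E = E, OF \<theta> D] VJ by simp
  then show ?p
    unfolding s1 e1 e2 x1 x2 k by (simp add: algebra_simps)
  have "cov3 (su3_connection gM J \<mu> a p) (psi_m \<theta>) a p w u v z =
      sin (\<theta> p) * (cov3 C Phi a p w u v z + d\<theta> w * Phi a p (Jp u) v z)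
      - cos (\<theta> p) * ((cov3 C Phi a p w (Jp u) v z + Phi a p (V u) v z) - d\<theta> w * Phi a p u v z)
      - (psi_m \<theta> a p (E u) v z + psi_m \<theta> a p u (E v) z + psi_m \<theta> a p u v (E z))"
    unfolding cov_psi(2)[where D = "su3_connection gM J \<mu> a p" and E = E, OF \<theta> D] VJ by simp
  then show ?m
    unfolding s2 e1 e2 x1 x2 k by (simp add: algebra_simps)
qed

lemma su3_eta_eq: "act_form Jp (su3_eta gM J (psi_p \<theta>) (psi_m \<theta>) a p) w = (d\<theta> w - rn w) / 3"
proof -
  define \<mu>0 where "\<mu>0 = (\<lambda>w. (d\<theta> (Jp w) - rn (Jp w)) / 3)"
  have lin: "linear \<mu>0"
    by (rule linearI) (simp_all add: \<mu>0_def su3.J_simps linear_add[OF linear_d\<theta>] linear_add[OF linear_rn]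
        linear_cmul[OF linear_d\<theta>] linear_cmul[OF linear_rn] field_simps)
  have \<mu>0: "act_form Jp \<mu>0 w = (d\<theta> w - rn w) / 3" for w
    by (simp add: act_form_def \<mu>0_def Jp_Jp linear_neg[OF linear_d\<theta>] linear_neg[OF linear_rn] field_simps)
  have "su3_eta gM J (psi_p \<theta>) (psi_m \<theta>) a p = \<mu>0"
    unfolding su3_eta_def Let_def
  proof (rule the_equality)
    show "linear \<mu>0 \<and> (\<forall>u x y. cov2 (su3_connection gM J \<mu>0 a p) (kaehler_form gM J) a p u x y = 0) \<and>
        (\<forall>u x y z. cov3 (su3_connection gM J \<mu>0 a p) (psi_p \<theta>) a p u x y z = 0) \<and>
        (\<forall>u x y z. cov3 (su3_connection gM J \<mu>0 a p) (psi_m \<theta>) a p u x y z = 0)"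
      by (simp add: lin su3_connection_omega su3_connection_psi \<mu>0)
  next
    fix \<mu>
    assume "linear \<mu> \<and> (\<forall>u x y. cov2 (su3_connection gM J \<mu> a p) (kaehler_form gM J) a p u x y = 0) \<and>
        (\<forall>u x y z. cov3 (su3_connection gM J \<mu> a p) (psi_p \<theta>) a p u x y z = 0) \<and>
        (\<forall>u x y z. cov3 (su3_connection gM J \<mu> a p) (psi_m \<theta>) a p u x y z = 0)"
    then have \<mu>: "linear \<mu>" and par: "\<And>u x y z. cov3 (su3_connection gM J \<mu> a p) (psi_p \<theta>) a p u x y z = 0"
      by blast+
    have act: "act_form Jp \<mu> w = (d\<theta> w - rn w) / 3" for w
    proof -
      define k where "k = d\<theta> w - rn w - 3 * act_form Jp \<mu> w"
      have *: "k * (cos (\<theta> p) * Gp (Jp u) (frm 0) - sin (\<theta> p) * Gp u (frm 0)) = 0" for u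
        using par[of w u "frm 2" "frm 4"] by (simp add: su3_connection_psi k_def su3.Phi_frame2)
      \<comment> \<open>The vector \<open>frm 0\<close> isolates the sine and \<open>frm 1\<close>,
        its image under \<open>Jp\<close>, the cosine.\<close>
      have "k * sin (\<theta> p) = 0" "k * cos (\<theta> p) = 0"
        using *[of "frm 0"] *[of "frm 1"]
        by (simp_all add: su3.J_coord su3.frame_orthonormal[OF su3.frame])
      then have "k = 0"
        using sin_zero_abs_cos_one[of "\<theta> p"] by auto
      then show ?thesis by (simp add: k_def)
    qed
    show "\<mu> = \<mu>0"
    proof
      fix w
      show "\<mu> w = \<mu>0 w"
        using act[of "Jp w"] \<mu>0[of "Jp w"] by (simp add: act_form_def Jp_Jp linear_neg[OF \<mu>] linear_neg[OF lin])
    qed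
  qed
  then show ?thesis by (simp add: \<mu>0)
qed

lemma su3_eta_0: "(\<forall>w. su3_eta gM J (psi_p \<theta>) (psi_m \<theta>) a p w = 0) \<longleftrightarrow> (\<forall>w. d\<theta> w = rn w)"
proof
  assume "\<forall>w. su3_eta gM J (psi_p \<theta>) (psi_m \<theta>) a p w = 0"
  then show "\<forall>w. d\<theta> w = rn w"
    using su3_eta_eq by (simp add: act_form_def)
next
  assume *: "\<forall>w. d\<theta> w = rn w"
  show "\<forall>w. su3_eta gM J (psi_p \<theta>) (psi_m \<theta>) a p w = 0"
  proof
    fix w
    have "act_form Jp (su3_eta gM J (psi_p \<theta>) (psi_m \<theta>) a p) (- Jp w) = 0"
      unfolding su3_eta_eq using * by simp
    then show "su3_eta gM J (psi_p \<theta>) (psi_m \<theta>) a p w = 0"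
      by (simp add: act_form_def su3.J_simps Jp_Jp)
  qed
qed

lemma psi_p_rot: "psi_p \<theta> a p = (\<lambda>x y z. Phi a p (su3.rot (cos (\<theta> p)) (sin (\<theta> p)) x) y z)"
  by (intro ext) (simp add: psi_eq[OF \<theta> p] su3.Phi_rot_J)

lemma classes:
  fixes h
  defines "h \<equiv> 1 / 6 * tr Gp B"
    and "S' \<equiv> \<lambda>x y. act1 Jp r x y - act2 Jp r x y + (B x y + act Jp B x y)"
  shows "tr Gp (\<lambda>x y. nabla_omega gM J a p x y z) = 2 * rn z" (is ?tr)
    and "in_classes Gp Jp (psi_p \<theta> a p) Z (nabla_omega gM J a p) \<longleftrightarrow>
      (W1p \<in> Z \<or> h * cos (\<theta> p) = 0) \<and> (W1m \<in> Z \<or> h * sin (\<theta> p) = 0) \<and>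
      (W2p \<in> Z \<or> (\<forall>x y. cos (\<theta> p) * S' x y = 2 * h * cos (\<theta> p) * Gp x y)) \<and>
      (W2m \<in> Z \<or> (\<forall>x y. sin (\<theta> p) * S' x y = 2 * h * sin (\<theta> p) * Gp x y)) \<and>
      (W3 \<in> Z \<or> (\<forall>x y. act Jp B x y = B x y)) \<and> (W4 \<in> Z \<or> (\<forall>x. rn x = 0))" (is ?classes)
proof -
  have S: "S' x y = act1 Jp r x y - act2 Jp r x y + (B x y + act Jp B x y)" for x y
    by (simp only: S'_def)
  have h: "h = 1 / 6 * tr Gp B" by (simp only: h_def)
  note * = su3.torsion_classes[where c = "cos (\<theta> p)" and s = "sin (\<theta> p)" and psi = "psi_p \<theta> a p"
      and B = B and r = r and rn = rn and A = tens and S = S' and h = h and \<alpha> = "nabla_omega gM J a p",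
      OF sin_cos_squared_add2 psi_p_rot bilinear_B B_sym bilinear_r r_skew r_omega r_Phi A_eq S h nabla_omega_A]
  show ?tr by (rule *(1))
  show ?classes by (rule *(2))
qed

lemma dstar_omega_eq: "dstar_omega gM J a p z = - 2 * rn z"
  using classes(1) by (simp add: dstar_omega_def)

end

end

end

section \<open>From the pointwise criteria to the ten types\<close>

context g2_hypersurface
begin

lemma everywhere_pointD:
  assumes "\<And>a p. g2_hypersurface_point Mb Ab g \<phi> M A \<iota> n a p \<Longrightarrow> P a p"
  shows "everywhere A P"
  using assms g2_hypersurface_axioms
  by (simp add: everywhere_def g2_hypersurface_point_def g2_hypersurface_point_axioms_def)

lemma everywhere_cong:
  assumes "\<And>a p. g2_hypersurface_point Mb Ab g \<phi> M A \<iota> n a p \<Longrightarrow> P a p \<longleftrightarrow> Q a p"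
  shows "everywhere A P \<longleftrightarrow> everywhere A Q"
  using everywhere_pointD[of "\<lambda>a p. P a p \<longleftrightarrow> Q a p"] assms by (auto simp: everywhere_def)

context
  fixes \<theta> :: "'a \<Rightarrow> real"
  assumes X2: "g2_type_X2 Ab g \<phi>" and \<theta>: "smooth_function A \<theta>"
begin

lemma dstar_omega_everywhere:
  "everywhere A (\<lambda>a p. \<forall>x. dstar_omega gM J a p x =
      6 * act_form (J a p) (su3_eta gM J (psi_p \<theta>) (psi_m \<theta>) a p) x - 2 * cderiv a \<theta> p x \<and>
    6 * act_form (J a p) (su3_eta gM J (psi_p \<theta>) (psi_m \<theta>) a p) x - 2 * cderiv a \<theta> p x = - 2 * r\<^sub>n a p x)"
  (is "everywhere A ?P")
proof (rule everywhere_pointD)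
  fix a p
  assume "g2_hypersurface_point Mb Ab g \<phi> M A \<iota> n a p"
  then interpret g2_hypersurface_point Mb Ab g \<phi> M A \<iota> n a p .
  show "?P a p"
    by (simp add: su3_eta_eq[OF X2 \<theta>] dstar_omega_eq[OF X2 \<theta>] normal_part_rn field_simps)
qed

lemma su3_type_iff:
  "su3_type A gM J (psi_p \<theta>) (psi_m \<theta>) Z \<longleftrightarrow>
    everywhere A (\<lambda>a p.
      (W1p \<in> Z \<or> 1 / 6 * tr (gM a p) (II a p) * cos (\<theta> p) = 0) \<and>
      (W1m \<in> Z \<or> 1 / 6 * tr (gM a p) (II a p) * sin (\<theta> p) = 0) \<and>
      (W2p \<in> Z \<or> (\<forall>x y. cos (\<theta> p) *
          (act1 (J a p) (r\<^sub>M a p) x y - act2 (J a p) (r\<^sub>M a p) x y +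
            (II a p x y + act (J a p) (II a p) x y)) =
        2 * (1 / 6 * tr (gM a p) (II a p)) * cos (\<theta> p) * gM a p x y)) \<and>
      (W2m \<in> Z \<or> (\<forall>x y. sin (\<theta> p) *
          (act1 (J a p) (r\<^sub>M a p) x y - act2 (J a p) (r\<^sub>M a p) x y +
            (II a p x y + act (J a p) (II a p) x y)) =
        2 * (1 / 6 * tr (gM a p) (II a p)) * sin (\<theta> p) * gM a p x y)) \<and>
      (W3 \<in> Z \<or> (\<forall>x y. act (J a p) (II a p) x y = II a p x y)) \<and>
      (W4 \<in> Z \<or> (\<forall>x. r\<^sub>n a p x = 0))) \<and>
    (W5 \<notin> Z \<longrightarrow> everywhere A (\<lambda>a p. \<forall>x. cderiv a \<theta> p x = r\<^sub>n a p x))"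
  (is "_ \<longleftrightarrow> everywhere A ?P \<and> _")
  unfolding su3_type_def
proof (rule arg_cong2[where f = conj, OF everywhere_cong arg_cong[where f = "(\<longrightarrow>) _", OF everywhere_cong]])
  fix a p
  assume "g2_hypersurface_point Mb Ab g \<phi> M A \<iota> n a p"
  then interpret g2_hypersurface_point Mb Ab g \<phi> M A \<iota> n a p .
  from classes(2)[OF X2 \<theta>, of Z, folded pull2_r normal_part_rn]
  show "in_classes (gM a p) (J a p) (psi_p \<theta> a p) Z (nabla_omega gM J a p) \<longleftrightarrow> ?P a p" .
  show "(\<forall>x. su3_eta gM J (psi_p \<theta>) (psi_m \<theta>) a p x = 0) \<longleftrightarrow>
      (\<forall>x. cderiv a \<theta> p x = r\<^sub>n a p x)"
    unfolding normal_part_rn by (rule su3_eta_0[OF X2 \<theta>])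
qed

end

end

lemma cos_sin_cancel:
  fixes t k :: real and X Y :: "'a \<Rightarrow> 'b \<Rightarrow> real"
  shows "k * cos t = 0 \<and> k * sin t = 0 \<longleftrightarrow> k = 0"
    and "(\<forall>x y. cos t * X x y = 2 * k * cos t * Y x y) \<and> (\<forall>x y. sin t * X x y = 2 * k * sin t * Y x y) \<longleftrightarrow>
      (\<forall>x y. X x y = 2 * k * Y x y)"
proof -
  show "k * cos t = 0 \<and> k * sin t = 0 \<longleftrightarrow> k = 0"
    using sin_zero_abs_cos_one[of t] by auto
  have "cos t * X x y = 2 * k * cos t * Y x y \<and> sin t * X x y = 2 * k * sin t * Y x y \<longleftrightarrow>
      X x y = 2 * k * Y x y" for x y
    using sin_cos_squared_add[of t] by algebra
  then show "(\<forall>x y. cos t * X x y = 2 * k * cos t * Y x y) \<and> (\<forall>x y. sin t * X x y = 2 * k * sin t * Y x y) \<longleftrightarrow>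
      (\<forall>x y. X x y = 2 * k * Y x y)" by blast
qed

text \<open>For abstract predicates the ten cases are Boolean. When both signs of a class are
  absent, \<open>cos_sin_cancel\<close> merges the two conditions, since cosine and sine have no
  common zero; when W4 and W5 are both absent, r = 0 and d = r become r = 0 and d = 0.\<close>

lemma torsion_types:
  fixes G S :: "('a, 6) tensor2"
  assumes T: "\<And>Z. T Z \<longleftrightarrow> everywhere A (\<lambda>a p.
      (W1p \<in> Z \<or> h a p * cos (\<theta> p) = 0) \<and> (W1m \<in> Z \<or> h a p * sin (\<theta> p) = 0) \<and>
      (W2p \<in> Z \<or> (\<forall>x y. cos (\<theta> p) * S a p x y = 2 * h a p * cos (\<theta> p) * G a p x y)) \<and>
      (W2m \<in> Z \<or> (\<forall>x y. sin (\<theta> p) * S a p x y = 2 * h a p * sin (\<theta> p) * G a p x y)) \<and>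
      (W3 \<in> Z \<or> P a p) \<and> (W4 \<in> Z \<or> (\<forall>x. r a p x = 0))) \<and>
    (W5 \<notin> Z \<longrightarrow> everywhere A (\<lambda>a p. \<forall>x. d a p x = r a p x))"
  shows "T {W1p, W1m, W2p, W2m, W3, W4} \<longleftrightarrow> everywhere A (\<lambda>a p. \<forall>x. d a p x = r a p x)"
    and "T {W1p, W1m, W2p, W2m, W3, W5} \<longleftrightarrow> everywhere A (\<lambda>a p. \<forall>x. r a p x = 0)"
    and "T {W1p, W1m, W2p, W2m, W4, W5} \<longleftrightarrow> everywhere A P"
    and "T {W1p, W1m, W2p, W3, W4, W5} \<longleftrightarrow>
      everywhere A (\<lambda>a p. \<forall>x y. sin (\<theta> p) * S a p x y = 2 * h a p * sin (\<theta> p) * G a p x y)"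
    and "T {W1p, W1m, W2m, W3, W4, W5} \<longleftrightarrow>
      everywhere A (\<lambda>a p. \<forall>x y. cos (\<theta> p) * S a p x y = 2 * h a p * cos (\<theta> p) * G a p x y)"
    and "T {W1p, W2p, W2m, W3, W4, W5} \<longleftrightarrow> everywhere A (\<lambda>a p. h a p * sin (\<theta> p) = 0)"
    and "T {W1m, W2p, W2m, W3, W4, W5} \<longleftrightarrow> everywhere A (\<lambda>a p. h a p * cos (\<theta> p) = 0)"
    and "T {W1p, W1m, W2p, W2m, W3} \<longleftrightarrow>
      everywhere A (\<lambda>a p. \<forall>x. r a p x = 0) \<and> everywhere A (\<lambda>a p. \<forall>x. d a p x = 0)"
    and "T {W1p, W1m, W3, W4, W5} \<longleftrightarrow> everywhere A (\<lambda>a p. \<forall>x y. S a p x y = 2 * h a p * G a p x y)"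
    and "T {W2p, W2m, W3, W4, W5} \<longleftrightarrow> everywhere A (\<lambda>a p. h a p = 0)"
  unfolding T
  by (simp_all only: insert_iff empty_iff su3_class.distinct simp_thms cos_sin_cancel) (auto simp: everywhere_def)

theorem theorem4p7:
  fixes Mb :: "'b topology" and Ab :: "('b, 7) chart set"
    and g :: "('b, 7) tensor2" and \<phi> :: "('b, 7) tensor3"
    and M :: "'a topology" and A :: "('a, 6) chart set"
    and \<iota> :: "'a \<Rightarrow> 'b" and n :: "('b, 7) chart \<Rightarrow> 'a \<Rightarrow> real ^ 7" and \<theta> :: "'a \<Rightarrow> real"
  assumes "riemannian_manifold Mb Ab g" and "g2_structure Mb Ab g \<phi>" and "g2_type_X2 Ab g \<phi>"
    and "hypersurface Mb Ab M A \<iota>" and "unit_normal Ab g A \<iota> n"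
    and "smooth_function A \<theta>"
  shows
    "let G = pull2 Ab \<iota> g;
         J = induced_I Ab g \<phi> \<iota> n;
         \<psi>p = induced_psi_plus Ab g \<phi> \<iota> n \<theta>;
         \<psi>m = induced_psi_minus Ab g \<phi> \<iota> n \<theta>;
         \<eta> = su3_eta G J \<psi>p \<psi>m;
         d\<theta> = (\<lambda>a. cderiv a \<theta>);
         B = second_form Ab g \<iota> n;
         h = (\<lambda>a p. 1 / 6 * tr (G a p) (B a p));
         r = pull2 Ab \<iota> (rbar g \<phi>);
         r\<^sub>n = normal_part Ab \<iota> n (rbar g \<phi>);
         S = (\<lambda>a p x y. act1 (J a p) (r a p) x y - act2 (J a p) (r a p) x y
                + (B a p x y + act (J a p) (B a p) x y))
     in everywhere A (\<lambda>a p. \<forall>x.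
          dstar_omega G J a p x = 6 * act_form (J a p) (\<eta> a p) x - 2 * d\<theta> a p x \<and>
          6 * act_form (J a p) (\<eta> a p) x - 2 * d\<theta> a p x = - 2 * r\<^sub>n a p x) \<and>
        (su3_type A G J \<psi>p \<psi>m {W1p, W1m, W2p, W2m, W3, W4} \<longleftrightarrow>
           everywhere A (\<lambda>a p. \<forall>x. d\<theta> a p x = r\<^sub>n a p x)) \<and>
        (su3_type A G J \<psi>p \<psi>m {W1p, W1m, W2p, W2m, W3, W5} \<longleftrightarrow>
           everywhere A (\<lambda>a p. \<forall>x. r\<^sub>n a p x = 0)) \<and>
        (su3_type A G J \<psi>p \<psi>m {W1p, W1m, W2p, W2m, W4, W5} \<longleftrightarrow>
           everywhere A (\<lambda>a p. \<forall>x y. act (J a p) (B a p) x y = B a p x y)) \<and>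
        (su3_type A G J \<psi>p \<psi>m {W1p, W1m, W2p, W3, W4, W5} \<longleftrightarrow>
           everywhere A (\<lambda>a p. \<forall>x y.
             sin (\<theta> p) * S a p x y = 2 * h a p * sin (\<theta> p) * G a p x y)) \<and>
        (su3_type A G J \<psi>p \<psi>m {W1p, W1m, W2m, W3, W4, W5} \<longleftrightarrow>
           everywhere A (\<lambda>a p. \<forall>x y.
             cos (\<theta> p) * S a p x y = 2 * h a p * cos (\<theta> p) * G a p x y)) \<and>
        (su3_type A G J \<psi>p \<psi>m {W1p, W2p, W2m, W3, W4, W5} \<longleftrightarrow>
           everywhere A (\<lambda>a p. h a p * sin (\<theta> p) = 0)) \<and>
        (su3_type A G J \<psi>p \<psi>m {W1m, W2p, W2m, W3, W4, W5} \<longleftrightarrow>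
           everywhere A (\<lambda>a p. h a p * cos (\<theta> p) = 0)) \<and>
        (su3_type A G J \<psi>p \<psi>m {W1p, W1m, W2p, W2m, W3} \<longleftrightarrow>
           everywhere A (\<lambda>a p. \<forall>x. r\<^sub>n a p x = 0) \<and> everywhere A (\<lambda>a p. \<forall>x. d\<theta> a p x = 0)) \<and>
        (su3_type A G J \<psi>p \<psi>m {W1p, W1m, W3, W4, W5} \<longleftrightarrow>
           everywhere A (\<lambda>a p. \<forall>x y. S a p x y = 2 * h a p * G a p x y)) \<and>
        (su3_type A G J \<psi>p \<psi>m {W2p, W2m, W3, W4, W5} \<longleftrightarrow>
           everywhere A (\<lambda>a p. h a p = 0))"
proof -
  interpret g2_hypersurface Mb Ab g \<phi> M A \<iota> n
    using assms by unfold_locales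
  show ?thesis
    unfolding Let_def
    by (intro conjI dstar_omega_everywhere[OF assms(3,6)] torsion_types[OF su3_type_iff[OF assms(3,6)]])
qed

end
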